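(* Let $(\ell_t)_{t\ge 1}$ be i.i.d. random convex sub-differentiable loss functions on $\mathbb{R}^d$ whose risk $\theta\mapsto\mathbb{E}[\ell_t(\theta)]$ satisfies, for some $\alpha>0$ and all $\theta_1,\theta_2\in\mathbb{R}^d$, $$\mathbb{E}[\ell_t(\theta_1)-\ell_t(\theta_2)]\le \mathbb{E}[\nabla\ell_t(\theta_1)]^\top(\theta_1-\theta_2)-\alpha\|\theta_1-\theta_2\|_2^2 .$$ Let $\theta^\ast$ be the unique minimizer of the risk over $\mathbb{R}^d$, and let $d_0\ge 1$, $U>0$, $B>0$ be such that $\|\theta^\ast\|_0\le d_0$, $\|\theta^\ast\|_1\le U$ and, almost surely, $\|\nabla\ell_t(\theta)\|_\infty\le B$ for all $t\ge1$ and all $\theta$ with $\|\theta\|_1\le 2U$. Let $0<\delta<1$, let $T\ge1$, and let $\hat\theta_0,\dots,\hat\theta_{T-1}$ be the predictions of the algorithm SAEW (defined in the context) with parameters $d_0,\alpha,U,B,\delta$ and a subroutine $\mathcal{S}$ satisfying the regret bound with constants $a,b\ge 0$ stated in the context. Then, with probability at least $1-\delta$, the cumulative risk $\mathrm{Risk}_{1:T}(\hat\theta_{0:(T-1)}):=\sum_{t=1}^T\mathrm{Risk}(\hat\theta_{t-1})$ satisfies $$\mathrm{Risk}_{1:T}(\hat\theta_{0:(T-1)})\le\min\bigg\{4UB(a'\sqrt T+b'+1),\ \ \frac{2^5d_0B^2}{\alpha}a'^2\log_2T+4UB(1+b')+\frac{\alpha U^2}{8d_0}\bigg\},$$ where $a'=a+\sqrt{6\log(1+3\log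 T)-2\log\delta}$ and $b'=b+\tfrac12+3\log(1+3\log T)-\log\delta$.
   Context: Notation. $\|\theta\|_0$ is the number of nonzero coordinates of $\theta$; $\mathrm{Risk}(\theta):=\mathbb{E}[\ell_t](\theta)-\mathbb{E}[\ell_t](\theta^\ast)$ is the excess risk, where $\mathbb{E}[\ell_t](\theta)=\mathbb{E}[\ell_t(\theta)]$ for deterministic $\theta$ and $\mathbb{E}[\ell_t](\hat\theta_{t-1})=\mathbb{E}[\ell_t(\hat\theta_{t-1})\mid\ell_1,\dots,\ell_{t-1}]$. $\mathcal{B}_1(c,\epsilon)=\{\theta\in\mathbb{R}^d:\|\theta-c\|_1\le\epsilon\}$. $[\theta]_{d_0}$ is obtained from $\theta$ by setting to zero its $d-d_0$ smallest (in absolute value) coordinates (ties broken arbitrarily). Online setting. At each time $t\ge 1$ the parameter $\hat\theta_{t-1}$ is chosen from the past only (it depends on $\ell_1,\dots,\ell_{t-1}$ only through observed gradients), then $\nabla\ell_t(\hat\theta_{t-1})$ is observed. Subroutine $\mathcal{S}$. An online convex optimization procedure which, given $B>0$, a starting time $t_{\mathrm{start}}$, a center $\theta_{\mathrm{center}}\in\mathbb{R}^d$ and a radius $\epsilon>0$, outputs for each $t\ge t_{\mathrm{start}}$ a prediction $\hat\theta_{t-1}\in\mathcal{B}_1(\theta_{\mathrm{center}},\epsilon)$ and then observes $\nabla\ell_t(\hat\theta_{t-1})$. It is assumed that, for constants $a,b\ge0$ (possibly depending on $d$), on any sequence of convex sub-differentiable losses, for all $t_{\mathrm{end}}\ge t_{\mathrm{start}}$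 and all $\theta\in\mathcal{B}_1(\theta_{\mathrm{center}},\epsilon)$, $$\sum_{t=t_{\mathrm{start}}}^{t_{\mathrm{end}}}\ell_t(\hat\theta_{t-1})-\ell_t(\theta)\le a\epsilon\sqrt{\sum_{t=t_{\mathrm{start}}}^{t_{\mathrm{end}}}\|\nabla\ell_t(\hat\theta_{t-1})\|_\infty^2}+b\epsilon B .$$ Algorithm SAEW (parameters $d_0,\alpha,U,B,\delta,\mathcal{S}$). Put $t_0=1$, $\epsilon_0=U$, $\bar\theta_0=0$, $\delta_j=\delta/(j+1)^2$ for $j\ge1$. For sessions $i=0,1,2,\dots$: start a new instance $\mathcal{S}_i$ of $\mathcal{S}$ with $t_{\mathrm{start}}=t_i$, $\theta_{\mathrm{center}}=[\bar\theta_{t_i-1}]_{d_0}$, radius $U2^{-i/2}$ and $B$. For $t=t_i,t_i+1,\dots$, as long as $\epsilon_{t-1}>U2^{-(i+1)/2}$: predict $\hat\theta_{t-1}$ with $\mathcal{S}_i$, observe $\nabla\ell_t(\hat\theta_{t-1})$, and set $$\mathrm{Err}_t=a_i'\sqrt{\sum_{s=t_i}^t\|\nabla\ell_s(\hat\theta_{s-1})\|_\infty^2}+b_i'B,\qquad \epsilon_t=2\sqrt{\frac{2d_0U2^{-i/2}}{\alpha(t-t_i+1)}\mathrm{Err}_t},\qquad \bar\theta_t=\frac{1}{t-t_i+1}\sum_{s=t_i}^t\hat\theta_{s-1},$$ where $a_i'=a+\sqrt2\sqrt{\log\big(1+\tfrac12\log\tfrac{t-t_i+1}{2}\big)-\log\delta_{i+1}}$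 and $b_i'=b+\tfrac12+\log\big(1+\tfrac12\log\tfrac{t-t_i+1}{2}\big)-\log\delta_{i+1}$. The session stops at the first $t\ge t_i$ with $\epsilon_{t-1}\le U2^{-(i+1)/2}$ and this $t$ is $t_{i+1}$ (so a session may be empty). *)

theory Defs
  imports "HOL-Probability.Probability"
begin

definition l0_norm :: "real ^ 'd \<Rightarrow> nat" where
  "l0_norm x = card {k. x $ k \<noteq> 0}"

definition l1_norm :: "real ^ 'd \<Rightarrow> real" where
  "l1_norm x = (\<Sum>k\<in>UNIV. \<bar>x $ k\<bar>)"

definition l1_cball :: "real ^ 'd \<Rightarrow> real \<Rightarrow> (real ^ 'd) set" where
  "l1_cball c r = {x. l1_norm (x - c) \<le> r}"

text \<open>
  \<open>is_truncation d0 x y\<close>: the vector \<open>y\<close> is one of the possible values of the hard truncation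
  of \<open>x\<close> to its \<open>d0\<close> largest entries in absolute value. It is a relation because ties may be
  broken arbitrarily. For \<open>d0 \<ge> CARD('d)\<close> the truncated subtraction leaves \<open>x\<close> unchanged.
\<close>

definition is_truncation :: "nat \<Rightarrow> real ^ 'd \<Rightarrow> real ^ 'd \<Rightarrow> bool" where
  "is_truncation d0 x y \<longleftrightarrow>
     (\<exists>K. card K = CARD('d) - d0 \<and> (\<forall>k\<in>K. \<forall>j\<in>- K. \<bar>x $ k\<bar> \<le> \<bar>x $ j\<bar>) \<and>
          y = (\<chi> k. if k \<in> K then 0 else x $ k))"

definition subdifferential :: "('a::real_inner \<Rightarrow> real) \<Rightarrow> 'a \<Rightarrow> 'a set" where
  "subdifferential f x = {g. \<forall>y. f x + g \<bullet> (y - x) \<le> f y}"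

definition convex_losses :: "(real ^ 'd \<Rightarrow> real) set" where
  "convex_losses = {f. convex_on UNIV f \<and> (\<forall>x. subdifferential f x \<noteq> {})}"

text \<open>
  Random losses are random elements of the set of convex losses, with the sigma-algebra generated
  by the evaluations at the points of the domain. As convex functions are continuous, this is also
  the Borel sigma-algebra of locally uniform convergence.
\<close>

definition loss_space :: "(real ^ 'd \<Rightarrow> real) measure" where
  "loss_space = restrict_space (\<Pi>\<^sub>M x\<in>UNIV. borel) convex_losses"

text \<open>
  A subgradient oracle fixes the meaning of the gradient of a loss that need not be differentiable.
  Joint measurability makes the gradient at a random point a random vector.
\<close>

definition subgradient_oracle :: "((real ^ 'd \<Rightarrow> real) \<Rightarrow> real ^ 'd \<Rightarrow> real ^ 'd) \<Rightarrow> bool" where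
  "subgradient_oracle grad \<longleftrightarrow>
     (\<forall>f\<in>convex_losses. \<forall>x. grad f x \<in> subdifferential f x) \<and>
     (\<lambda>(f, x). grad f x) \<in> borel_measurable (loss_space \<Otimes>\<^sub>M borel)"

text \<open>The sigma-algebra on the sample space generated by the losses at times \<open>1, \<dots>, n\<close>.\<close>

definition past :: "'w measure \<Rightarrow> (nat \<Rightarrow> 'w \<Rightarrow> real ^ 'd \<Rightarrow> real) \<Rightarrow> nat \<Rightarrow> 'w measure" where
  "past M loss n =
     vimage_algebra (space M) (\<lambda>\<omega>. \<lambda>t\<in>{1..n}. loss t \<omega>) (\<Pi>\<^sub>M t\<in>{1..n}. loss_space)"

text \<open>
  The excess risk of the prediction used at time \<open>t\<close>, where \<open>p\<close> is a random parameter which is a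
  function of the past: the first term is the conditional expectation of the loss given the losses
  at times \<open>1, \<dots>, t - 1\<close>.
\<close>

definition excess_risk ::
  "'w measure \<Rightarrow> (nat \<Rightarrow> 'w \<Rightarrow> real ^ 'd \<Rightarrow> real) \<Rightarrow> real ^ 'd \<Rightarrow> nat \<Rightarrow> ('w \<Rightarrow> real ^ 'd) \<Rightarrow> 'w \<Rightarrow> real"
where
  "excess_risk M loss \<theta>s t p \<omega> =
     real_cond_exp M (past M loss (t - 1)) (\<lambda>\<omega>'. loss t \<omega>' (p \<omega>')) \<omega> - (\<integral>\<omega>'. loss t \<omega>' \<theta>s \<partial>M)"

text \<open>
  An online procedure \<open>S B s c r gs\<close> maps the gradient bound \<open>B\<close>, the starting time \<open>s\<close>, the centre
  \<open>c\<close>, the radius \<open>r\<close> and the list \<open>gs\<close> of the gradients observed at times \<open>s, \<dots>, t - 1\<close> to the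
  prediction used at time \<open>t\<close>.
\<close>

type_synonym 'd subroutine =
  "real \<Rightarrow> nat \<Rightarrow> real ^ 'd \<Rightarrow> real \<Rightarrow> (real ^ 'd) list \<Rightarrow> real ^ 'd"

definition regret_bound :: "('d::finite) subroutine \<Rightarrow> real \<Rightarrow> real \<Rightarrow> bool" where
  "regret_bound S a b \<longleftrightarrow>
     (\<forall>B>0. \<forall>s\<ge>1. \<forall>c. \<forall>r>0.
        (\<forall>gs. S B s c r gs \<in> l1_cball c r) \<and>
        (\<forall>f g. let pred = (\<lambda>t. S B s c r (map g [s..<t])) in
           (\<forall>t\<ge>s. f t \<in> convex_losses \<and> g t \<in> subdifferential (f t) (pred t)) \<longrightarrow>
           (\<forall>e\<ge>s. \<forall>\<theta>\<in>l1_cball c r.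
              (\<Sum>t=s..e. f t (pred t) - f t \<theta>)
                \<le> a * r * sqrt (\<Sum>t=s..e. (infnorm (g t))\<^sup>2) + b * r * B)))"

text \<open>
  The quantities of session \<open>i\<close> after \<open>n\<close> rounds of this session. The session uses the confidence
  level of index \<open>i + 1\<close>, that is \<open>\<delta> / (i + 2)\<^sup>2\<close>.
\<close>

definition saew_log :: "real \<Rightarrow> nat \<Rightarrow> nat \<Rightarrow> real" where
  "saew_log \<delta> i n = ln (1 + 1/2 * ln (real n / 2)) - ln (\<delta> / (real i + 2)\<^sup>2)"

definition saew_err :: "real \<Rightarrow> real \<Rightarrow> real \<Rightarrow> real \<Rightarrow> nat \<Rightarrow> (nat \<Rightarrow> real ^ 'd) \<Rightarrow> nat \<Rightarrow> nat \<Rightarrow> real"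
where
  "saew_err a b B \<delta> i g s t =
     (a + sqrt 2 * sqrt (saew_log \<delta> i (t - s + 1))) * sqrt (\<Sum>r=s..t. (infnorm (g r))\<^sup>2)
     + (b + 1/2 + saew_log \<delta> i (t - s + 1)) * B"

text \<open>
  \<open>saew_run\<close> states that \<open>\<theta> 0, \<theta> 1, \<dots>\<close> are the predictions of the algorithm when the gradient
  observed at time \<open>t \<ge> 1\<close>, at the point \<open>\<theta> (t - 1)\<close>, is \<open>g t\<close>. The witnesses are the starting
  times \<open>\<tau> i\<close> of the sessions, their centres \<open>c i\<close>, the accuracies \<open>\<epsilon> t\<close> and the averages \<open>\<theta>a t\<close>.
  A session may last forever: then its successor starts at time \<open>\<infinity>\<close>, the infimum of the empty set.
  A session \<open>i\<close> with \<open>\<tau> (Suc i) = \<tau> i\<close> is empty.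
\<close>

definition saew_run ::
  "('d::finite) subroutine \<Rightarrow> real \<Rightarrow> real \<Rightarrow> nat \<Rightarrow> real \<Rightarrow> real \<Rightarrow> real \<Rightarrow> real \<Rightarrow>
   (nat \<Rightarrow> real ^ 'd) \<Rightarrow> (nat \<Rightarrow> real ^ 'd) \<Rightarrow> bool"
where
  "saew_run S a b d0 \<alpha> U B \<delta> g \<theta> \<longleftrightarrow>
     (\<exists>(\<tau> :: nat \<Rightarrow> enat) c \<epsilon> \<theta>a.
        \<tau> 0 = enat 1 \<and> \<epsilon> 0 = U \<and> \<theta>a 0 = 0 \<and>
        (\<forall>i. \<tau> (Suc i) =
           Inf {enat t |t. \<tau> i \<le> enat t \<and> \<epsilon> (t - 1) \<le> U * 2 powr (- (real i + 1) / 2)}) \<and>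
        (\<forall>i s. \<tau> i = enat s \<longrightarrow>
           is_truncation d0 (\<theta>a (s - 1)) (c i) \<and>
           (\<forall>t. s \<le> t \<and> enat t < \<tau> (Suc i) \<longrightarrow>
              \<theta> (t - 1) = S B s (c i) (U * 2 powr (- real i / 2)) (map g [s..<t]) \<and>
              \<epsilon> t = 2 * sqrt (2 * real d0 * (U * 2 powr (- real i / 2)) / (\<alpha> * real (t - s + 1))
                              * saew_err a b B \<delta> i g s t) \<and>
              \<theta>a t = (1 / real (t - s + 1)) *\<^sub>R (\<Sum>r=s..t. \<theta> (r - 1)))))"

end

theory Submission
  imports Defs
begin

text \<open>
  The regret bound for the linearised losses controls \<open>\<Sum> g t \<bullet> (\<theta> (t - 1) - \<theta>s)\<close> over a session. The
  difference to \<open>\<Sum> E (g t) \<bullet> (\<theta> (t - 1) - \<theta>s)\<close> is a martingale, which is bounded by exponential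
  supermartingales over a geometric grid of learning rates. Strong convexity used twice gives
  \<open>E (g t) \<bullet> (\<theta> (t - 1) - \<theta>s) \<ge> 2 * \<alpha> * norm (\<theta> (t - 1) - \<theta>s) ^ 2\<close>, so the average of a session is close
  to \<open>\<theta>s\<close> in the Euclidean norm, and its truncation is close in the 1-norm because \<open>\<theta>s\<close> is sparse. The
  factor 2 here, and the constant 5 instead of 8 in the truncation step, pay for the uniformity in time.
  By induction \<open>\<theta>s\<close> stays in the balls of all sessions. The total risk is then bounded by the sum of the
  regrets and one more deviation inequality with a fixed learning rate for all sessions at once.
  Sessions are long because strong convexity and bounded gradients force \<open>4 * \<alpha> * U \<le> B\<close>, so there
  are at most about \<open>2 * log 2 T\<close> of them.
\<close>

section \<open>Norms and hard truncation\<close>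

text \<open>A session ends at a data-dependent time, so its deviation bound must hold for all
  numbers of rounds at once, while \<open>saew_err\<close> grants one iterated logarithm and fixed
  constants. The grid of learning rates loses a factor 16/10 against \<open>saew_err\<close>; in a
  ball of diameter \<open>2 * radius i\<close>, regret and deviation then sum up to at most
  \<open>32/10 * radius i * Err\<close>. Dividing by the curvature \<open>2 * \<alpha>\<close> and
  multiplying by the truncation constant gives 5 * 32/10 / 2 = 8, exactly the constant in the
  squared accuracy.

  A second obstacle is circular: gradients are bounded by \<open>B\<close> only while the
  predictions stay in the ball of radius \<open>2 * U\<close>, and this is known only if the earlier
  deviations were small. The exponential processes therefore carry predictable guards that switch
  off all other rounds; an induction over the rounds then shows that on the good event no round is
  switched off.

  The failure probability \<delta> is split as 0.65 + 0.175 + 0.175, for the sessions and for one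
  total deviation per claimed bound.\<close>

lemma l1_norm_nonneg [simp]: "0 \<le> l1_norm x"
  unfolding l1_norm_def by (simp add: sum_nonneg)

lemma l1_norm_zero [simp]: "l1_norm 0 = 0"
  unfolding l1_norm_def by simp

lemma l1_norm_triangle: "l1_norm (x + y) \<le> l1_norm x + l1_norm y"
  unfolding l1_norm_def by (simp flip: sum.distrib add: sum_mono)

lemma l1_norm_minus [simp]: "l1_norm (- x) = l1_norm x"
  unfolding l1_norm_def by simp

lemma l1_norm_minus_commute: "l1_norm (x - y) = l1_norm (y - x)"
  using l1_norm_minus[of "x - y"] by simp

lemma l1_norm_triangle_sub: "l1_norm (x - z) \<le> l1_norm (x - y) + l1_norm (y - z)"
  using l1_norm_triangle[of "x - y" "y - z"] by simp

lemma l1_norm_scaleR: "l1_norm (r *\<^sub>R x) = \<bar>r\<bar> * l1_norm x"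
  unfolding l1_norm_def by (simp add: abs_mult sum_distrib_left)

lemma l1_norm_sum: "l1_norm (sum f I) \<le> (\<Sum>i\<in>I. l1_norm (f i))"
  by (induction I rule: infinite_finite_induct)
     (auto intro: order.trans[OF l1_norm_triangle])

lemma l1_norm_average:
  assumes "\<And>r. r \<in> {s..t} \<Longrightarrow> l1_norm (x r) \<le> C" and "s \<le> t"
  shows "l1_norm ((1 / real (t - s + 1)) *\<^sub>R (\<Sum>r=s..t. x r)) \<le> C"
proof -
  have "l1_norm (\<Sum>r=s..t. x r) \<le> (\<Sum>r=s..t. C)"
    by (rule order.trans[OF l1_norm_sum]) (intro sum_mono assms)
  then have "l1_norm (\<Sum>r=s..t. x r) \<le> real (t - s + 1) * C"
    using assms(2) by (simp add: Suc_diff_le)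
  then show ?thesis
    by (simp add: l1_norm_scaleR field_simps)
qed

lemma borel_measurable_l1_norm [measurable]: "(l1_norm :: real ^ 'd \<Rightarrow> real) \<in> borel_measurable borel"
  unfolding l1_norm_def[abs_def] by measurable

lemma abs_component_le_infnorm: "\<bar>x $ k\<bar> \<le> infnorm (x :: real ^ 'd)"
proof -
  have "finite {\<bar>x $ i\<bar> |i. i \<in> UNIV}"
    by (simp add: full_SetCompr_eq)
  then show ?thesis
    unfolding infnorm_cart by (intro cSup_upper bdd_above_finite) auto
qed

lemma abs_inner_le_infnorm_l1_norm: "\<bar>g \<bullet> x\<bar> \<le> infnorm g * l1_norm (x :: real ^ 'd)"
proof -
  have "\<bar>g \<bullet> x\<bar> \<le> (\<Sum>k\<in>UNIV. \<bar>g $ k\<bar> * \<bar>x $ k\<bar>)"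
    unfolding inner_vec_def by (rule order.trans[OF sum_abs]) (simp add: abs_mult)
  also have "\<dots> \<le> (\<Sum>k\<in>UNIV. infnorm g * \<bar>x $ k\<bar>)"
    by (intro sum_mono mult_right_mono abs_component_le_infnorm) auto
  finally show ?thesis
    by (simp add: l1_norm_def sum_distrib_left)
qed

lemma borel_measurable_infnorm [measurable]: "(infnorm :: real ^ 'd \<Rightarrow> real) \<in> borel_measurable borel"
  by (intro borel_measurable_continuous_onI continuous_at_imp_continuous_on ballI continuous_infnorm
      continuous_ident)

text \<open>Jensen's inequality for the squared Euclidean norm and the uniform average, from
  Cauchy-Schwarz. The number of rounds stays on the left, to meet the curvature terms summed over a
  session.\<close>

lemma average_norm_le:
  fixes x :: "nat \<Rightarrow> real ^ 'd"
  assumes "s \<le> t"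
  shows "real (t - s + 1) * (norm ((1 / real (t - s + 1)) *\<^sub>R (\<Sum>r=s..t. x r) - y))\<^sup>2
           \<le> (\<Sum>r=s..t. (norm (x r - y))\<^sup>2)"
proof -
  define n where "n = real (t - s + 1)"
  have n: "n > 0" "real (card {s..t}) = n"
    using assms by (auto simp: n_def)
  have "(1 / n) *\<^sub>R (\<Sum>r=s..t. x r) - y = (1 / n) *\<^sub>R (\<Sum>r=s..t. x r - y)"
    using n(1) by (simp only: sum_subtractf scaleR_diff_right sum_constant_scaleR n(2)) simp
  then have "(norm ((1 / n) *\<^sub>R (\<Sum>r=s..t. x r) - y))\<^sup>2 = (1 / n)\<^sup>2 * (norm (\<Sum>r=s..t. x r - y))\<^sup>2"
    by (simp add: power_mult_distrib power_divide)
  also have "\<dots> \<le> (1 / n)\<^sup>2 * (\<Sum>r=s..t. norm (x r - y))\<^sup>2"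
    by (intro mult_left_mono power_mono norm_sum) auto
  also have "(\<Sum>r=s..t. norm (x r - y))\<^sup>2 \<le> (\<Sum>r=s..t. (norm (x r - y))\<^sup>2) * n"
    using Cauchy_Schwarz_ineq_sum[of "\<lambda>_. 1" "\<lambda>r. norm (x r - y)" "{s..t}"] n by (simp add: mult.commute)
  then have "(1 / n)\<^sup>2 * (\<Sum>r=s..t. norm (x r - y))\<^sup>2 \<le> (1 / n)\<^sup>2 * ((\<Sum>r=s..t. (norm (x r - y))\<^sup>2) * n)"
    by (rule mult_left_mono) auto
  finally show ?thesis
    using n unfolding n_def[symmetric] by (simp add: power2_eq_square field_simps)
qed

lemma l1_norm_truncation_le:
  assumes "is_truncation d0 x y"
  shows "l1_norm y \<le> l1_norm x"
  using assms unfolding is_truncation_def l1_norm_def by (auto intro!: sum_mono)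

text \<open>
  The entries of the support of \<open>z\<close> that are deleted are matched with kept entries outside the
  support, which are at least as large. The total deviation is then bounded by
  \<open>\<Sum> w k * \<bar>x k - z k\<bar>\<close> with weights \<open>w k \<in> {0, 1, 2}\<close> whose squares sum up to \<open>5 * d0\<close>.
\<close>

lemma l1_norm_truncation_sparse:
  fixes x y z :: "real ^ 'd"
  assumes "is_truncation d0 x y" and z: "l0_norm z \<le> d0"
  shows "(l1_norm (y - z))\<^sup>2 \<le> 5 * real d0 * (norm (x - z))\<^sup>2"
proof -
  from assms(1) obtain K where K: "card K = CARD('d) - d0"
      "\<And>k j. k \<in> K \<Longrightarrow> j \<notin> K \<Longrightarrow> \<bar>x $ k\<bar> \<le> \<bar>x $ j\<bar>"
      and y: "y = (\<chi> k. if k \<in> K then 0 else x $ k)"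
    unfolding is_truncation_def by auto
  define P where "P = {k. z $ k \<noteq> 0}"
  define e where "e k = \<bar>x $ k - z $ k\<bar>" for k
  have P: "card P \<le> d0"
    using z by (simp add: P_def l0_norm_def)
  have cK: "card (- K) = CARD('d) - card K" "card K \<le> CARD('d)"
    by (auto simp: card_mono Compl_eq_Diff_UNIV card_Diff_subset)
  have card_le: "card (- K) \<le> d0"
    using K(1) cK by simp
  \<comment> \<open>If \<open>d0\<close> is at most the dimension, exactly \<open>d0\<close> entries
    are kept, at least as many as the support \<open>P\<close> has; removing the common part
    \<open>P \<inter> - K\<close> from both sets leaves this. A larger \<open>d0\<close> deletes
    nothing.\<close>
  have "card (P \<inter> K) \<le> card (- K - P)"
  proof (cases "d0 \<le> CARD('d)")
    case True
    have "card P = card (P \<inter> K) + card (P \<inter> - K)"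
      by (subst card_Un_disjoint[symmetric]) (auto intro: arg_cong[of _ _ card])
    moreover have "card (- K) = card (P \<inter> - K) + card (- K - P)"
      by (subst card_Un_disjoint[symmetric]) (auto intro: arg_cong[of _ _ card])
    ultimately show ?thesis
      using True P cK K(1) by simp
  next
    case False
    then have "K = {}" using K(1) by (auto simp: card_eq_0_iff)
    then show ?thesis by simp
  qed
  then obtain h where h: "inj_on h (P \<inter> K)" "h ` (P \<inter> K) \<subseteq> - K - P"
    using card_le_inj[of "P \<inter> K" "- K - P"] by auto
  define Q where "Q = h ` (P \<inter> K)"
  define w :: "'d \<Rightarrow> real" where "w k = of_bool (k \<notin> K) + of_bool (k \<in> Q) + of_bool (k \<in> P \<inter> K)" for k
  have Q: "card Q = card (P \<inter> K)" "Q \<inter> K = {}" "Q \<inter> P = {}"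
    using h card_image[OF h(1)] by (auto simp: Q_def)
  \<comment> \<open>\<open>z\<close> vanishes at \<open>h k\<close>, so \<open>e (h k)\<close> is
    the whole entry of \<open>x\<close> there, and this kept entry dominates the deleted entry
    \<open>x $ k\<close>.\<close>
  have zk: "\<bar>z $ k\<bar> \<le> e k + e (h k)" if "k \<in> P \<inter> K" for k
  proof -
    have "h k \<notin> K" "h k \<notin> P" using h that by auto
    then have "\<bar>x $ k\<bar> \<le> e (h k)"
      using K(2)[of k "h k"] that by (auto simp: e_def P_def)
    then show ?thesis unfolding e_def by linarith
  qed
  have "l1_norm (y - z) = (\<Sum>k\<in>UNIV. of_bool (k \<notin> K) * e k + of_bool (k \<in> P \<inter> K) * \<bar>z $ k\<bar>)"
    unfolding l1_norm_def y e_def P_def by (intro sum.cong) auto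
  also have "\<dots> = (\<Sum>k\<in>UNIV. of_bool (k \<notin> K) * e k) + (\<Sum>k\<in>P \<inter> K. \<bar>z $ k\<bar>)"
    by (simp add: sum.distrib of_bool_def if_distrib[of "\<lambda>x. x * _"] sum.inter_filter[symmetric]
        flip: Int_def cong: if_cong)
  also have "(\<Sum>k\<in>P \<inter> K. \<bar>z $ k\<bar>) \<le> (\<Sum>k\<in>P \<inter> K. e k + e (h k))"
    by (intro sum_mono zk)
  also have "\<dots> = (\<Sum>k\<in>P \<inter> K. e k) + (\<Sum>k\<in>Q. e k)"
    unfolding Q_def by (simp add: sum.distrib sum.reindex[OF h(1)])
  also have "(\<Sum>k\<in>UNIV. of_bool (k \<notin> K) * e k) + \<dots> = (\<Sum>k\<in>UNIV. w k * e k)"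
    unfolding w_def
    by (simp add: sum.distrib algebra_simps of_bool_def if_distrib[of "\<lambda>x. _ * x"] sum.inter_filter[symmetric]
        flip: Int_def cong: if_cong)
  finally have "l1_norm (y - z) \<le> (\<Sum>k\<in>UNIV. w k * e k)" by simp
  then have "(l1_norm (y - z))\<^sup>2 \<le> (\<Sum>k\<in>UNIV. w k * e k)\<^sup>2"
    by (intro power_mono) auto
  also have "\<dots> \<le> (\<Sum>k\<in>UNIV. (w k)\<^sup>2) * (\<Sum>k\<in>UNIV. (e k)\<^sup>2)"
    by (rule Cauchy_Schwarz_ineq_sum)
  also have "(\<Sum>k\<in>UNIV. (e k)\<^sup>2) = (norm (x - z))\<^sup>2"
    by (simp add: e_def norm_vec_def L2_set_def sum_nonneg)
  also have "(\<Sum>k\<in>UNIV. (w k)\<^sup>2) \<le> 5 * real d0"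
  proof -
    \<comment> \<open>The weight is 2 on \<open>Q\<close>, which lies among the kept indices, so 4 =
      1 + 3 there; it is 1 on the other kept indices and on \<open>P \<inter> K\<close>. The three
      cardinalities contribute d0 + 3 * d0 + d0 at most.\<close>
    have "(w k)\<^sup>2 = of_bool (k \<notin> K) + 3 * of_bool (k \<in> Q) + of_bool (k \<in> P \<inter> K)" for k
      using Q by (auto simp: w_def)
    then have "(\<Sum>k\<in>UNIV. (w k)\<^sup>2) = real (card (- K)) + 3 * real (card Q) + real (card (P \<inter> K))"
      by (simp add: sum.distrib of_bool_def sum.inter_filter[symmetric] flip: sum_distrib_left
         Int_def Compl_eq cong: if_cong)
    moreover have "card (P \<inter> K) \<le> d0"
      using P card_mono[of P "P \<inter> K"] by simp
    ultimately show ?thesis using card_le Q by simp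
  qed
  finally show ?thesis by (simp add: mult_right_mono)
qed

section \<open>A deviation bound uniform over a grid of learning rates\<close>

text \<open>Two terms of the series of 2 * artanh ((x - 1) / (x + 1)) = ln x, whose terms are
  positive. Rational arguments then give explicit numerical bounds.\<close>

lemma ln_ge_cubic:
  fixes x :: real
  assumes "x > 1"
  shows "ln x \<ge> 2 * ((x - 1) / (x + 1)) + 2 / 3 * ((x - 1) / (x + 1)) ^ 3"
proof -
  define y where "y = (x - 1) / (x + 1)"
  have "(\<Sum>k<2. 2 * y ^ (2 * k + 1) / of_nat (2 * k + 1)) \<le> ln x"
    using ln_approx_bounds[of x 2] assms unfolding y_def atLeastAtMost_iff by blast
  moreover have "(\<Sum>k<2. 2 * y ^ (2 * k + 1) / of_nat (2 * k + 1)) = 2 * y + 2 / 3 * y ^ 3"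
    by (simp add: lessThan_Suc numeral_2_eq_2 numeral_3_eq_3)
  ultimately show ?thesis
    unfolding y_def[symmetric] by linarith
qed

lemma ln_leI:
  fixes x c :: real
  assumes "0 < x" "x \<le> exp c"
  shows "ln x \<le> c"
  using assms by (subst ln_exp[of c, symmetric], subst ln_le_cancel_iff) auto

text \<open>The left side vanishes at 0 and its derivative has the sign of
  \<open>x * (2 * c * (1 - x) - 1)\<close>: it decreases up to 0, then increases, and decreases
  again beyond \<open>1 - 1 / (2 * c)\<close>. On y \<le> \<eta> the minimum is therefore at 0 or at
  \<eta>, and the single check at \<eta> suffices.\<close>

lemma ln_quadratic_lower:
  fixes c \<eta> y :: real
  assumes c: "1/2 \<le> c" and \<eta>: "0 \<le> \<eta>" "\<eta> < 1" "0 \<le> ln (1 - \<eta>) + \<eta> + c * \<eta>\<^sup>2" and y: "y \<le> \<eta>"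
  shows "0 \<le> ln (1 - y) + y + c * y\<^sup>2"
proof -
  define F where "F x = ln (1 - x) + x + c * x\<^sup>2" for x
  define F' where "F' x = x * (2 * c * (1 - x) - 1) / (1 - x)" for x
  have DF: "(F has_real_derivative F' x) (at x)" if "x < 1" for x
    unfolding F_def F'_def using that
    by (auto intro!: derivative_eq_intros simp: field_simps power2_eq_square)
  consider "y \<le> 0" | "0 < y" "2 * c * (1 - y) \<ge> 1" | "0 < y" "2 * c * (1 - y) < 1" by linarith
  then have "0 \<le> F y"
  proof cases
    case 1
    have "F 0 \<le> F y"
    proof (rule DERIV_nonpos_imp_nonincreasing[OF 1])
      fix x :: real assume x: "y \<le> x" "x \<le> 0"
      have "1 * 1 \<le> (2 * c) * (1 - x)" using c x by (intro mult_mono) auto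
      then have "F' x \<le> 0" unfolding F'_def using x
        by (intro divide_nonpos_pos mult_nonpos_nonneg) auto
      then show "\<exists>d. (F has_real_derivative d) (at x) \<and> d \<le> 0"
        using DF[of x] x by auto
    qed
    then show ?thesis by (simp add: F_def)
  next
    case 2
    have "F 0 \<le> F y"
    proof (rule DERIV_nonneg_imp_nondecreasing[of 0 y F])
      fix x assume x: "0 \<le> x" "x \<le> y"
      have "2 * c * (1 - y) \<le> 2 * c * (1 - x)" using c x by (intro mult_left_mono) auto
      then have "F' x \<ge> 0" unfolding F'_def using x 2 y \<eta>
        by (intro divide_nonneg_pos mult_nonneg_nonneg) auto
      then show "\<exists>d. (F has_real_derivative d) (at x) \<and> d \<ge> 0"
        using DF[of x] x y \<eta> by auto
    qed (use 2 in simp)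
    then show ?thesis by (simp add: F_def)
  next
    case 3
    have "F \<eta> \<le> F y"
    proof (rule DERIV_nonpos_imp_nonincreasing[OF y])
      fix x assume x: "y \<le> x" "x \<le> \<eta>"
      have "2 * c * (1 - x) \<le> 2 * c * (1 - y)" using c x by (intro mult_left_mono) auto
      then have "F' x \<le> 0" unfolding F'_def using x 3 \<eta>
        by (intro divide_nonpos_pos mult_nonneg_nonpos) auto
      then show "\<exists>d. (F has_real_derivative d) (at x) \<and> d \<le> 0"
        using DF[of x] x \<eta> by auto
    qed
    then show ?thesis using \<eta> by (simp add: F_def)
  qed
  then show ?thesis by (simp add: F_def)
qed

text \<open>
  The grid of learning rates, the constants of the quadratic bounds for \<open>ln (1 - y)\<close> on
  \<open>y \<le> rate k\<close>, and the penalties of a union bound over the grid.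
\<close>

definition rate :: "nat \<Rightarrow> real" where
  "rate k = (if k = 0 then 2/3 else exp (1 - real k) / 3)"

definition curv :: "nat \<Rightarrow> real" where
  "curv k = (if k = 0 then 975/1000 else 1/2 + rate k / 2)"

definition penalty :: "nat \<Rightarrow> real" where
  "penalty k = ln 2 + 3/2 * ln (real k + 2)"

lemma rate_pos: "rate k > 0"
  by (simp add: rate_def)

lemma rate_le: "k \<ge> 1 \<Longrightarrow> rate k \<le> 1/3"
  by (simp add: rate_def)

lemma rate_less_1: "rate k < 1"
  using rate_le[of k] by (cases "k = 0") (auto simp: rate_def[of 0])

lemma curv_ge: "curv k \<ge> 1/2"
  using rate_pos[of k] by (simp add: curv_def)

text \<open>For \<open>k = 0\<close> the claim reads ln 3 \<le> 2/3 + 975/1000 * 4/9 = 11/10, which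
  is where 975/1000 comes from. For \<open>k \<ge> 1\<close> the derivative of \<open>G\<close> is
  x^2 * (1/2 - 3/2 * x) / (1 - x), nonnegative up to 1/3, the largest rate of this branch.\<close>

lemma rate_curv: "0 \<le> ln (1 - rate k) + rate k + curv k * (rate k)\<^sup>2"
proof (cases "k = 0")
  case True
  have "\<bar>exp 1 - 5837465777 / 2147483648\<bar> \<le> (1 / 4294967296 :: real)"
    using e_approx_32 by (simp add: inverse_eq_divide)
  then have "2718/1000 \<le> exp (1::real)" by linarith
  moreover have "1 + 1/10 + (1/10)\<^sup>2 / 2 \<le> exp (1/10 :: real)"
    by (rule exp_lower_Taylor_quadratic) simp
  ultimately have "2718/1000 * (1105/1000) \<le> exp 1 * exp (1/10 :: real)"
    by (intro mult_mono) (auto simp: power2_eq_square)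
  also have "\<dots> = exp (11/10 :: real)" by (simp flip: exp_add)
  finally have "ln 3 \<le> (11/10 :: real)"
    by (intro ln_leI) auto
  moreover have "ln (1/3 :: real) = - ln 3" by (simp add: ln_div)
  ultimately show ?thesis
    using True by (simp add: rate_def curv_def power2_eq_square)
next
  case False
  define G :: "real \<Rightarrow> real" where "G x = ln (1 - x) + x + x\<^sup>2 / 2 + x ^ 3 / 2" for x
  have "G 0 \<le> G (rate k)"
  proof (rule DERIV_nonneg_imp_nondecreasing[of 0 "rate k" G])
    fix x :: real assume x: "0 \<le> x" "x \<le> rate k"
    then have x3: "x \<le> 1/3" using rate_le[of k] False by linarith
    have "(G has_real_derivative x\<^sup>2 * (1/2 - 3/2 * x) / (1 - x)) (at x)"
      unfolding G_def using x3
      by (auto intro!: derivative_eq_intros simp: field_simps power2_eq_square power3_eq_cube)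
    moreover have "0 \<le> x\<^sup>2 * (1/2 - 3/2 * x) / (1 - x)"
      using x3 by (intro divide_nonneg_pos mult_nonneg_nonneg) auto
    ultimately show "\<exists>d. (G has_real_derivative d) (at x) \<and> d \<ge> 0" by blast
  qed (use rate_pos[of k] in simp)
  then show ?thesis
    using False by (simp add: G_def curv_def algebra_simps power2_eq_square power3_eq_cube)
qed

text \<open>With x = sqrt (k + 1) and y = sqrt (k + 2), \<open>exp (- penalty k)\<close> is 1 / (2 *
  y^3). Since y - x = 1 / (x + y), the difference 1 / x - 1 / y dominates it and telescopes to at
  most 1. The summand \<open>ln 2\<close> of the penalty is the factor 2 of this comparison.\<close>

lemma sum_exp_penalty: "(\<Sum>k<K. exp (- penalty k)) \<le> 1"
proof -
  have le: "exp (- penalty k) \<le> 1 / sqrt (real k + 1) - 1 / sqrt (real k + 2)" for k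
  proof -
    define x where "x = sqrt (real k + 1)"
    define y where "y = sqrt (real k + 2)"
    have xy: "0 < x" "0 < y" "x \<le> y" "(y - x) * (y + x) = 1" "y\<^sup>2 = real k + 2"
      by (auto simp: x_def y_def algebra_simps)
    have "penalty k = ln (2 * y ^ 3)"
    proof -
      have "ln (real k + 2) = 2 * ln y"
        using xy ln_realpow[of y 2] by simp
      moreover have "ln (2 * y ^ 3) = ln 2 + 3 * ln y"
        using xy by (simp add: ln_mult ln_realpow)
      ultimately show ?thesis unfolding penalty_def by simp
    qed
    then have "exp (- penalty k) = 1 / (2 * y ^ 3)"
      using xy by (simp add: exp_minus inverse_eq_divide)
    also have "\<dots> \<le> (y - x) / (x * y)"
    proof -
      have "x * y \<le> y * y" using xy by (intro mult_right_mono) auto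
      also have "\<dots> = y * y * ((y - x) * (y + x))" using xy by simp
      also have "\<dots> \<le> y * y * ((y - x) * (2 * y))"
        using xy by (intro mult_left_mono) auto
      finally have "x * y \<le> (y - x) * (2 * y ^ 3)" by (simp add: power3_eq_cube mult_ac)
      then show ?thesis using xy by (simp add: divide_le_eq pos_le_divide_eq)
    qed
    also have "\<dots> = 1 / x - 1 / y" using xy by (simp add: diff_divide_distrib)
    finally show ?thesis unfolding x_def y_def .
  qed
  have "(\<Sum>k<K. exp (- penalty k)) \<le> (\<Sum>k<K. 1 / sqrt (real k + 1) - 1 / sqrt (real (Suc k) + 1))"
    by (intro sum_mono) (use le in \<open>simp add: add.commute\<close>)
  also have "\<dots> = 1 - 1 / sqrt (real K + 1)"
    by (subst sum_lessThan_telescope') simp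
  finally show ?thesis by (rule order.trans) simp
qed

text \<open>The first term 1/4 is kept, and each later term 1 / x^2 is compared with 1 / (x - 1/2) -
  1 / (x + 1/2) = 1 / (x^2 - 1/4), which telescopes from 1 / (5/2): 1/4 + 2/5 = 65/100.\<close>

lemma sum_inverse_squares: "(\<Sum>i<N. 1 / (real i + 2)\<^sup>2) \<le> 65/100"
proof -
  have "(\<Sum>i<Suc N. 1 / (real i + 2)\<^sup>2) \<le> 65/100 - 1 / (real N + 5/2)" for N
  proof (induction N)
    case (Suc N)
    have "1 / (real (Suc N) + 2)\<^sup>2 \<le> 1 / (real N + 5/2) - 1 / (real (Suc N) + 5/2)"
    proof -
      define x where "x = real N + 3"
      have x: "x \<ge> 3" "real (Suc N) + 2 = x" "real N + 5/2 = x - 1/2" "real (Suc N) + 5/2 = x + 1/2"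
        by (auto simp: x_def)
      have "1 / (x - 1/2) - 1 / (x + 1/2) = 1 / (x\<^sup>2 - 1/4)"
        using x by (subst diff_frac_eq) (auto simp: algebra_simps power2_eq_square)
      moreover have "1 / x\<^sup>2 \<le> 1 / (x\<^sup>2 - 1/4)"
        using x power_mono[of 3 x 2] by (intro divide_left_mono) auto
      ultimately show ?thesis unfolding x by simp
    qed
    then show ?case using Suc by simp
  qed simp
  from this[of N] have "(\<Sum>i<Suc N. 1 / (real i + 2)\<^sup>2) \<le> 65/100"
    by (rule order.trans) simp
  moreover have "(\<Sum>i<N. 1 / (real i + 2)\<^sup>2) \<le> (\<Sum>i<Suc N. 1 / (real i + 2)\<^sup>2)" by simp
  ultimately show ?thesis by (rule order.trans[rotated])
qed

section \<open>Numerical logarithms and the optimal rate of the grid\<close>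

lemma ln_2_bounds: "691/1000 \<le> ln (2::real)" "ln (2::real) \<le> 25/36"
  using ln_ge_cubic[of 2] ln2_le_25_over_36 by (simp_all add: power3_eq_cube)

text \<open>The threshold 89 is the length that \<open>session_length_ge\<close> guarantees for
  every completed session; 89 / 2 slightly exceeds 2^5 * 139/100.\<close>

lemma half_ln_ge:
  fixes n :: real
  assumes "n \<ge> 89"
  shows "1 + 1/2 * ln (n / 2) \<ge> 288/100"
proof -
  have "ln (139/100 :: real) \<ge> 32/100"
    by (rule order.trans[OF _ ln_ge_cubic]) (simp_all add: power3_eq_cube)
  moreover have "ln (2 ^ 5 * (139/100) :: real) = 5 * ln 2 + ln (139/100)"
    by (subst ln_mult) (simp_all add: ln_realpow del: power_numeral)
  moreover have "ln (2 ^ 5 * (139/100) :: real) \<le> ln (n / 2)"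
    using assms by (subst ln_le_cancel_iff) auto
  ultimately show ?thesis using ln_2_bounds by linarith
qed

text \<open>
  The bounds of the grid are combined into one bound with an iterated logarithm: with
  \<open>z = rate k * sqrt (v / L)\<close> and \<open>1 \<le> z \<le> exp 1\<close> everything reduces to two quadratic inequalities
  in \<open>z\<close>.
\<close>

lemma grid_bound:
  fixes p n v D :: real
  assumes p: "p \<ge> ln 4" and n: "n \<ge> 89" and v: "0 \<le> v" "v \<le> n"
    and D: "\<And>k. real k \<le> ln n \<Longrightarrow> D \<le> curv k * rate k * v + (p + penalty k) / rate k"
  defines "L \<equiv> p + ln (1 + 1/2 * ln (n / 2))"
  shows "D \<le> 16/10 * sqrt 2 * sqrt (L * v) + 8/10 + 16/10 * L"
proof -
  define l where "l = 1 + 1/2 * ln (n / 2)"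
  have l: "l \<ge> 288/100" unfolding l_def by (rule half_ln_ge[OF n])
  have e: "exp 1 < (272/100 :: real)" by (rule e_less_272)
  have "exp (105/100 :: real) = exp 1 * exp (5/100)"
    by (simp flip: exp_add)
  also have "\<dots> \<le> 272/100 * (1 + 5/100 + (5/100)\<^sup>2)"
    using e by (intro mult_mono exp_bound) auto
  also have "\<dots> \<le> l" using l by (simp add: power2_eq_square)
  finally have lnl: "ln l \<ge> 105/100"
    using l by (subst ln_ge_iff) auto
  have ln4: "ln (4::real) = 2 * ln 2"
    using ln_realpow[of 2 2] by simp
  have L: "L = p + ln l" by (simp add: L_def l_def)
  have L_ge: "L \<ge> 243/100" using p ln4 ln_2_bounds lnl unfolding L by linarith
  have s2: "16/10 * sqrt 2 \<ge> 2262/1000"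
  proof -
    have "2262/1600 \<le> sqrt 2" by (rule real_le_rsqrt) (simp add: power2_eq_square)
    then show ?thesis by simp
  qed
  show ?thesis
  proof (cases "v \<le> 9 * L")
    \<comment> \<open>Small variance: the rate 2/3 alone suffices. It costs 65/100 * v, and
      \<open>v \<le> 9 * L\<close> gives \<open>v / 3 \<le> sqrt (L * v)\<close>, so the square root
      term absorbs it.\<close>
    case True
    have "penalty 0 = 5/2 * ln 2" by (simp add: penalty_def)
    moreover have "D \<le> 65/100 * v + 3/2 * (p + penalty 0)"
      using D[of 0] n by (simp add: curv_def rate_def field_simps)
    ultimately have 1: "D \<le> 65/100 * v + 16/10 * L + 8/10"
      using p ln4 ln_2_bounds lnl unfolding L by (simp add: field_simps)
    have "(v / 3)\<^sup>2 \<le> L * v"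
      using True v mult_right_mono[OF True v(1)] by (simp add: power2_eq_square)
    then have "v / 3 \<le> sqrt (L * v)" by (rule real_le_rsqrt)
    then have "(2262/1000) * (v / 3) \<le> (16/10 * sqrt 2) * sqrt (L * v)"
      using s2 v by (intro mult_mono) auto
    with 1 v(1) show ?thesis by linarith
  next
    case False
    \<comment> \<open>The ideal rate is of order 1 / sqrt u. As \<open>exp h = w / 3\<close> and
      \<open>rate k = exp (1 - real k) / 3\<close>, rounding h up gives z = exp (h + 1 - k), between
      1 and exp 1: the grid misses the ideal rate by at most a constant factor.\<close>
    define u where "u = v / L"
    define h where "h = 1/2 * ln (u / 9)"
    define k where "k = nat \<lceil>h\<rceil>"
    define w where "w = sqrt u"
    define z where "z = rate k * w"
    have u: "u > 9" using False L_ge by (simp add: u_def field_simps)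
    have h: "h > 0" using u by (simp add: h_def)
    then have k: "real k - 1 < h" "h \<le> real k" "k \<ge> 1"
      unfolding k_def by linarith+
    have exph: "exp h = w / 3"
    proof -
      have "(exp h)\<^sup>2 = u / 9"
        using u by (simp add: h_def flip: exp_double)
      then have "exp h = sqrt (u / 9)" by (metis exp_ge_zero real_sqrt_abs abs_of_nonneg)
      then show ?thesis by (simp add: w_def real_sqrt_divide)
    qed
    have rk: "rate k = exp (1 - real k) / 3" using k by (simp add: rate_def)
    have w0: "w > 0" using u by (simp add: w_def)
    have "z = exp (h + (1 - real k))"
      unfolding z_def rk exp_add exph by simp
    then have "exp 0 \<le> z" "z \<le> exp 1"
      using k by (simp_all only: exp_le_cancel_iff)
    then have z: "1 \<le> z" "z \<le> 272/100" using e by auto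
    \<comment> \<open>Source of the iterated logarithm: as \<open>v \<le> n\<close> and L is not too
      small, the chosen index stays below l - 1, so its penalty is about 3/2 * ln l.\<close>
    have hl: "h \<le> l - 2"
    proof -
      have "exp 1 * exp 1 \<le> (272/100) * (272/100 :: real)"
        using e by (intro mult_mono) auto
      then have "exp 2 \<le> (9/2) * L" using L_ge by (simp flip: exp_add)
      have "u / 9 \<le> n / 2 / exp 2"
      proof -
        have "v * exp 2 \<le> n * ((9/2) * L)"
          using v \<open>exp 2 \<le> (9/2) * L\<close> by (intro mult_mono) auto
        then show ?thesis using L_ge by (simp add: u_def field_simps)
      qed
      then have "ln (u / 9) \<le> ln (n / 2 / exp 2)"
        using u n by (subst ln_le_cancel_iff) auto
      also have "\<dots> = ln (n / 2) - 2" using n by (subst ln_div) auto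
      finally show ?thesis by (simp add: h_def l_def)
    qed
    have "ln (real k + 2) \<le> ln (l + 1)"
      using k hl by (subst ln_le_cancel_iff) auto
    also have "\<dots> = ln l + ln (1 + 1 / l)"
    proof -
      have "l + 1 = l * (1 + 1 / l)" using l by (simp add: field_simps)
      moreover have "0 < 1 + 1 / l" using l by (intro add_pos_pos) auto
      ultimately show ?thesis using l ln_mult[of l "1 + 1 / l"] by simp
    qed
    also have "ln (1 + 1 / l) \<le> 31/100"
    proof -
      have "1 + 1 / l \<le> 1 + 31/100 + (31/100)\<^sup>2 / 2"
        using l by (simp add: field_simps power2_eq_square)
      also have "\<dots> \<le> exp (31/100)" by (rule exp_lower_Taylor_quadratic) simp
      finally show ?thesis using l by (intro ln_leI) (auto simp: add_pos_pos)
    qed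
    \<comment> \<open>The spare 7/10 of \<open>p \<ge> ln 4\<close> and 2/10 of \<open>ln l\<close>
      pay for the additive constants ln 2 and 3/2 * 31/100.\<close>
    finally have pen: "p + penalty k \<le> 17/10 * L"
      using p ln4 ln_2_bounds lnl unfolding penalty_def L by (simp add: field_simps)
    have "real k \<le> ln n"
    proof -
      have "ln (n / 2) \<le> ln n" using n by (subst ln_le_cancel_iff) auto
      moreover have "0 \<le> ln (n / 2)" using n by simp
      ultimately show ?thesis using k hl unfolding l_def by linarith
    qed
    from D[OF this] have "D \<le> curv k * rate k * v + (p + penalty k) / rate k" .
    also have "\<dots> \<le> curv k * rate k * v + 17/10 * L / rate k"
      using pen rate_pos[of k] by (intro add_left_mono divide_right_mono) auto
    also have "\<dots> = L * (z * w / 2 + z\<^sup>2 / 2 + 17/10 * (w / z))"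
    proof -
      have "v = L * w\<^sup>2" using u L_ge by (simp add: u_def w_def)
      moreover have "1 / rate k = w / z" using w0 rate_pos[of k] by (simp add: z_def)
      moreover have "curv k = 1/2 + rate k / 2" using k by (simp add: curv_def)
      ultimately show ?thesis
        by (simp add: z_def algebra_simps power2_eq_square)
    qed
    also have "\<dots> \<le> L * (2262/1000 * w + 16/10)"
    proof (rule mult_left_mono)
      \<comment> \<open>Multiplied by z, the goal becomes
        \<open>z * (z\<^sup>2 / 2 - 16/10) \<le> w * q\<close>. The chord over the range of z bounds
        z^2 by a linear function, and \<open>3 * z \<le> w\<close>, which is
        \<open>rate k \<le> 1/3\<close>, reduces the rest to linear inequalities.\<close>
      define q where "q = 2262/1000 * z - z\<^sup>2 / 2 - 17/10"
      have "(z - 1) * (272/100 - z) \<ge> 0" using z by (intro mult_nonneg_nonneg) auto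
      moreover have "(z - 1) * (272/100 - z) = 372/100 * z - 272/100 - z\<^sup>2"
        by (simp add: field_simps power2_eq_square)
      ultimately have z2: "z\<^sup>2 \<le> 372/100 * z - 272/100" by linarith
      have "3 * q = 6786/1000 * z - 3/2 * z\<^sup>2 - 51/10"
        unfolding q_def by (simp add: field_simps)
      then have q: "q \<ge> 0" "3 * q \<ge> z\<^sup>2 / 2 - 16/10" using z2 z by linarith+
      have "3 * z \<le> w"
      proof -
        have "z \<le> 1/3 * w" unfolding z_def using rate_le[OF k(3)] w0 by (intro mult_right_mono) auto
        then show ?thesis by simp
      qed
      then have "3 * z * q \<le> w * q" using q by (intro mult_right_mono) auto
      moreover have "z * (z\<^sup>2 / 2 - 16/10) \<le> z * (3 * q)" using q z by (intro mult_left_mono) auto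
      ultimately have "z * (z\<^sup>2 / 2 - 16/10) \<le> w * q" by (simp add: mult_ac)
      then have "z * (z * w / 2 + z\<^sup>2 / 2 + 17/10 * (w / z)) \<le> z * (2262/1000 * w + 16/10)"
        using z by (simp add: q_def algebra_simps power2_eq_square)
      then show "z * w / 2 + z\<^sup>2 / 2 + 17/10 * (w / z) \<le> 2262/1000 * w + 16/10"
        using z by (simp add: mult_le_cancel_left_pos)
    qed (use L_ge in simp)
    also have "\<dots> \<le> 16/10 * sqrt 2 * (L * w) + 16/10 * L"
    proof -
      have "2262/1000 * (L * w) \<le> 16/10 * sqrt 2 * (L * w)"
        using s2 L_ge w0 by (intro mult_right_mono) auto
      then show ?thesis by (simp add: algebra_simps)
    qed
    also have "L * w = sqrt (L * v)"
    proof -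
      have "L * v = L\<^sup>2 * u" using L_ge by (simp add: u_def power2_eq_square)
      then show ?thesis using L_ge by (simp add: w_def real_sqrt_mult)
    qed
    finally show ?thesis by simp
  qed
qed

section \<open>The sessions of the algorithm\<close>

text \<open>The deterministic side of the algorithm. The random losses enter only through
  \<open>\<alpha>_le\<close>, which \<open>loss_model\<close> derives from strong convexity and
  bounded gradients.\<close>

locale saew =
  fixes S :: "('d::finite) subroutine" and a b \<alpha> U B \<delta> :: real and d0 :: nat
  assumes \<alpha>: "\<alpha> > 0" and U: "U > 0" and B: "B > 0" and \<delta>: "0 < \<delta>" "\<delta> < 1"
    and a: "a \<ge> 0" and b: "b \<ge> 0" and d0: "d0 \<ge> 1" and regret: "regret_bound S a b"
    and \<alpha>_le: "4 * \<alpha> * U \<le> B"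
begin

section \<open>Radii, accuracies and the recursion for the sessions\<close>

definition radius :: "nat \<Rightarrow> real" where
  "radius i = U * 2 powr (- real i / 2)"

definition acc :: "(nat \<Rightarrow> real ^ 'd) \<Rightarrow> nat \<Rightarrow> nat \<Rightarrow> nat \<Rightarrow> real" where
  "acc g i s t =
     2 * sqrt (2 * real d0 * radius i / (\<alpha> * real (t - s + 1)) * saew_err a b B \<delta> i g s t)"

text \<open>
  \<open>sess g n\<close> is the pair of the index and the starting time of the session of round \<open>n + 1\<close>. It is a
  function of the gradients of the rounds up to \<open>n\<close>, which makes it predictable.
\<close>

primrec sess :: "(nat \<Rightarrow> real ^ 'd) \<Rightarrow> nat \<Rightarrow> nat \<times> nat" where
  "sess g 0 = (0, 1)"
| "sess g (Suc n) =
     (let (i, s) = sess g n; e = acc g i s (Suc n)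
      in if radius (Suc i) < e then (i, s) else (LEAST j. radius (Suc j) < e, Suc (Suc n)))"

lemma radius_pos: "radius i > 0"
  by (simp add: radius_def U)

lemma radius_0 [simp]: "radius 0 = U"
  by (simp add: radius_def)

lemma radius_Suc: "radius (Suc i) = U * 2 powr (- (real i + 1) / 2)"
  by (simp add: radius_def add.commute)

lemma radius_sq: "(radius i)\<^sup>2 = U\<^sup>2 / 2 ^ i"
proof -
  have "(2 powr (- real i / 2))\<^sup>2 = 2 powr (- real i / 2 + - real i / 2)"
    by (simp only: power2_eq_square powr_add)
  also have "\<dots> = 2 powr (- real i)" by simp
  also have "\<dots> = 1 / 2 ^ i" by (simp only: powr_minus_divide powr_realpow zero_less_numeral)
  finally show ?thesis
    by (simp only: radius_def power_mult_distrib times_divide_eq_right mult_1_right)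
qed

lemma radius_mono: "i \<le> j \<Longrightarrow> radius j \<le> radius i"
  unfolding radius_def using U by (intro mult_left_mono powr_mono) auto

lemma radius_le_U: "radius i \<le> U"
  using radius_mono[of 0 i] by simp

lemma radius_small:
  assumes "e > 0"
  shows "\<exists>j. radius (Suc j) < e"
proof -
  obtain j where "U\<^sup>2 / e\<^sup>2 < real j"
    using reals_Archimedean2 by blast
  also have "real j < 2 ^ Suc j"
    using of_nat_less_two_power[of "Suc j", where ?'a = real] by linarith
  finally have "U\<^sup>2 < 2 ^ Suc j * e\<^sup>2"
    using assms by (subst (asm) pos_divide_less_eq) auto
  then have "U\<^sup>2 / 2 ^ Suc j < e\<^sup>2"
    by (subst pos_divide_less_eq) (auto simp: mult.commute)
  then have "(radius (Suc j))\<^sup>2 < e\<^sup>2"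
    by (simp only: radius_sq)
  then have "radius (Suc j) < e"
    by (rule power2_less_imp_less) (use assms in simp)
  then show ?thesis ..
qed

text \<open>The critical case is a single round, where ln (n / 2) is negative and the iterated
  logarithm is only known to exceed ln (65/100). The confidence level supplies
  \<open>(real i + 2)\<^sup>2 \<ge> 4\<close>, and ln (4 * 65/100) \<ge> 9/10. In particular the
  square roots in the accuracy have positive arguments.\<close>

lemma saew_log_ge:
  assumes "n \<ge> 1"
  shows "saew_log \<delta> i n \<ge> 9/10"
proof -
  have ln2: "ln (2::real) \<le> 7/10"
    using ln2_le_25_over_36 by linarith
  have "ln (real n / 2) \<ge> ln (1 / 2)"
    using assms by (subst ln_le_cancel_iff) auto
  then have "1 + 1/2 * ln (real n / 2) \<ge> 65/100"
    using ln2 by (simp add: ln_div)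
  then have l: "ln (1 + 1/2 * ln (real n / 2)) \<ge> ln (65/100)"
    by (subst ln_le_cancel_iff) auto
  have "\<delta> / (real i + 2)\<^sup>2 \<le> 1 / 4"
    using \<delta> power_mono[of 2 "real i + 2" 2] by (simp add: field_simps)
  then have "ln (\<delta> / (real i + 2)\<^sup>2) \<le> ln (1 / 4)"
    using \<delta> by (subst ln_le_cancel_iff) auto
  with l have "saew_log \<delta> i n \<ge> ln (65/100) - ln (1/4)"
    unfolding saew_log_def by linarith
  also have "ln (65/100) - ln (1/4) = ln (26/10 :: real)"
    using ln_div[of "65/100" "1/4 :: real"] by simp
  also have "ln (26/10 :: real) \<ge> 9/10"
    by (rule order.trans[OF _ ln_ge_cubic]) (simp_all add: power3_eq_cube)
  finally show ?thesis .
qed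

lemma saew_err_ge:
  assumes "s \<le> t"
  shows "saew_err a b B \<delta> i g s t \<ge> (b + 14/10) * B"
proof -
  have L: "saew_log \<delta> i (t - s + 1) \<ge> 9/10"
    by (rule saew_log_ge) simp
  have "(b + 14/10) * B \<le> (b + 1/2 + saew_log \<delta> i (t - s + 1)) * B"
    using L B by (intro mult_right_mono) auto
  moreover have "0 \<le> (a + sqrt 2 * sqrt (saew_log \<delta> i (t - s + 1))) * sqrt (\<Sum>r=s..t. (infnorm (g r))\<^sup>2)"
    using L a by (intro mult_nonneg_nonneg add_nonneg_nonneg) (auto intro: sum_nonneg)
  ultimately show ?thesis
    unfolding saew_err_def by linarith
qed

lemma saew_err_pos:
  assumes "s \<le> t"
  shows "saew_err a b B \<delta> i g s t > 0"
proof -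
  have "0 < (b + 14/10) * B" using b B by simp
  then show ?thesis using saew_err_ge[OF assms, of i g] by linarith
qed

lemma acc_sq:
  assumes "s \<le> t"
  shows "(acc g i s t)\<^sup>2 = 8 * real d0 * radius i * saew_err a b B \<delta> i g s t / (\<alpha> * real (t - s + 1))"
proof -
  have "0 \<le> 2 * real d0 * radius i / (\<alpha> * real (t - s + 1)) * saew_err a b B \<delta> i g s t"
    using radius_pos[of i] \<alpha> saew_err_pos[OF assms, of i g]
    by (intro mult_nonneg_nonneg divide_nonneg_nonneg) auto
  then show ?thesis
    unfolding acc_def by (simp add: power_mult_distrib)
qed

lemma acc_pos:
  assumes "s \<le> t"
  shows "acc g i s t > 0"
  unfolding acc_def using radius_pos[of i] \<alpha> saew_err_pos[OF assms, of i g] d0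
  by (intro mult_pos_pos divide_pos_pos iffD2[OF real_sqrt_gt_0_iff]) auto

section \<open>The order of the sessions and their lengths\<close>

lemma sess_start: "1 \<le> snd (sess g n) \<and> snd (sess g n) \<le> Suc n"
  by (induction n) (auto simp: Let_def split_beta)

declare sess.simps(2) [simp del]

lemma sess_Suc:
  assumes "sess g n = (i, s)"
  shows "radius (Suc i) < acc g i s (Suc n) \<Longrightarrow> sess g (Suc n) = (i, s)"
    "\<not> radius (Suc i) < acc g i s (Suc n) \<Longrightarrow>
       sess g (Suc n) = (LEAST j. radius (Suc j) < acc g i s (Suc n), Suc (Suc n))"
  using assms by (simp_all add: sess.simps(2) Let_def)

text \<open>A change of state resets the start to the following round, so a state whose start is at
  most \<open>Suc m\<close> was already in force at index m. Index m belongs to round m + 1.\<close>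

lemma sess_same:
  assumes "sess g n = (i, s)" "s \<le> Suc m" "m \<le> n"
  shows "sess g m = (i, s)"
  using assms(3,1,2)
proof (induction n rule: dec_induct)
  case (step n)
  have "sess g n = (i, s)"
    using step.prems step.hyps
    by (auto simp: sess.simps(2) Let_def split_beta split: if_splits)
  then show ?case using step by simp
qed simp

lemma sess_continue:
  assumes "sess g n = (i, s)" "s \<le> n"
  shows "radius (Suc i) < acc g i s n"
proof -
  obtain m where m: "n = Suc m"
    using assms sess_start[of g n] by (cases n) auto
  have "sess g m = (i, s)"
    using sess_same[OF assms(1), of m] assms(2) m by simp
  then show ?thesis
    using assms m sess_Suc(2)[of g m i s] by auto
qed

text \<open>Sessions whose final radius is already reached are empty and are skipped. Minimality of
  i makes the test fail at i - 1, which reads \<open>acc g j s t \<le> radius i\<close>: the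
  accuracy reached justifies the radius of the new session.\<close>

lemma sess_Least:
  assumes "s \<le> t" and "\<not> radius (Suc j) < acc g j s t" and "(LEAST k. radius (Suc k) < acc g j s t) = i"
  shows "j < i" "acc g j s t \<le> radius i" "radius (Suc i) < acc g j s t"
proof -
  show 1: "radius (Suc i) < acc g j s t"
    unfolding assms(3)[symmetric] by (rule LeastI_ex) (intro radius_small acc_pos assms)
  have min: "k < i \<Longrightarrow> \<not> radius (Suc k) < acc g j s t" for k
    unfolding assms(3)[symmetric] by (rule not_less_Least)
  show "j < i"
  proof (rule ccontr)
    assume "\<not> j < i"
    then have "radius (Suc j) \<le> radius (Suc i)" by (intro radius_mono) simp
    with 1 assms(2) show False by simp
  qed
  then obtain k where k: "i = Suc k"
    by (metis less_imp_Suc_add)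
  show "acc g j s t \<le> radius i"
    using min[of k] unfolding k by simp
qed

text \<open>The state at index \<open>s - 2\<close> belongs to round \<open>s - 1\<close>, the last
  round of the preceding session; \<open>1 < s\<close> excludes the first session.\<close>

lemma sess_new:
  assumes "sess g n = (i, s)" "1 < s" "sess g (s - 2) = (j, s')"
  shows "j < i" "acc g j s' (s - 1) \<le> radius i" "s' \<le> s - 1"
proof -
  obtain m where s: "s = Suc (Suc m)"
    using that[of "s - 2"] assms(2) by simp
  have m: "s - 2 = m" "s - 1 = Suc m" using s by simp_all
  have "s \<le> Suc n" using sess_start[of g n] unfolding assms(1) by simp
  then have new: "sess g (Suc m) = (i, s)"
    by (intro sess_same[OF assms(1)]) (simp_all add: s)
  have old: "sess g m = (j, s')" using assms(3) unfolding m .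
  show le: "s' \<le> s - 1" using sess_start[of g m] unfolding old m by simp
  show "j < i" "acc g j s' (s - 1) \<le> radius i"
  proof -
    have "\<not> radius (Suc j) < acc g j s' (Suc m)"
    proof
      assume "radius (Suc j) < acc g j s' (Suc m)"
      then have "sess g (Suc m) = (j, s')" by (rule sess_Suc(1)[OF old])
      then have "s' = s" using new by simp
      then show False using le s by linarith
    qed
    moreover from this have "(LEAST k. radius (Suc k) < acc g j s' (Suc m)) = i"
      using new sess_Suc(2)[OF old] by simp
    ultimately show "j < i" "acc g j s' (s - 1) \<le> radius i"
      using sess_Least(1,2)[of s' "Suc m" j g i] le unfolding m by blast+
  qed
qed

lemma sess_first:
  assumes "sess g n = (i, s)" "s \<le> 1"
  shows "i = 0"
proof -
  have "sess g 0 = (i, s)" by (rule sess_same[OF assms(1)]) (use assms in auto)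
  then show ?thesis by simp
qed

lemma sess_fst_Suc: "fst (sess g n) \<le> fst (sess g (Suc n))"
proof -
  obtain i s where n: "sess g n = (i, s)" by force
  show ?thesis
  proof (cases "radius (Suc i) < acc g i s (Suc n)")
    case False
    then have "i < (LEAST j. radius (Suc j) < acc g i s (Suc n))"
      using sess_Least(1)[OF _ False refl] sess_start[of g n] n by simp
    then show ?thesis using sess_Suc(2)[OF n False] n by simp
  qed (use sess_Suc(1)[OF n] n in simp)
qed

lemma sess_fst_mono: "m \<le> n \<Longrightarrow> fst (sess g m) \<le> fst (sess g n)"
  by (rule lift_Suc_mono_le[of "\<lambda>n. fst (sess g n)", OF sess_fst_Suc])

text \<open>The index strictly increases whenever the start changes, so it identifies the
  session.\<close>

lemma sess_fst_inj:
  assumes "m \<le> n" "fst (sess g m) = fst (sess g n)"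
  shows "sess g m = sess g n"
proof -
  obtain i s where n: "sess g n = (i, s)" by force
  have "s \<le> Suc m"
  proof (rule ccontr)
    assume *: "\<not> s \<le> Suc m"
    obtain j s' where j: "sess g (s - 2) = (j, s')" by force
    have "fst (sess g m) \<le> fst (sess g (s - 2))" using * by (intro sess_fst_mono) simp
    also have "\<dots> < i" using sess_new(1)[OF n _ j] * j by simp
    finally show False using assms n by simp
  qed
  then show ?thesis using sess_same[OF n _ assms(1)] n by simp
qed

lemma sess_rounds:
  assumes "sess g n = (i, s)" "n < T" "\<And>m. m < T \<Longrightarrow> fst (sess g m) = i \<Longrightarrow> m \<le> n"
  shows "{t \<in> {1..T}. fst (sess g (t - 1)) = i} = {s..Suc n}"
proof (intro equalityI subsetI)
  fix t assume t: "t \<in> {t \<in> {1..T}. fst (sess g (t - 1)) = i}"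
  then have "t - 1 \<le> n" using assms(3)[of "t - 1"] by auto
  moreover have "sess g (t - 1) = (i, s)"
    using sess_fst_inj[OF \<open>t - 1 \<le> n\<close>, of g] t assms(1) by simp
  then have "s \<le> Suc (t - 1)" using sess_start[of g "t - 1"] by simp
  ultimately show "t \<in> {s..Suc n}" using t by auto
next
  fix t assume t: "t \<in> {s..Suc n}"
  moreover have "1 \<le> s" using sess_start[of g n] assms(1) by simp
  ultimately have "sess g (t - 1) = (i, s)" by (intro sess_same[OF assms(1)]) auto
  then show "t \<in> {t \<in> {1..T}. fst (sess g (t - 1)) = i}"
    using t \<open>1 \<le> s\<close> assms(2) by auto
qed

text \<open>Stopping means \<open>(acc g j s t)\<^sup>2 \<le> U\<^sup>2 / 2 ^ i\<close>. The error
  is at least (b + 14/10) * B and \<alpha> * U \<le> B / 4, so the length is at least 32 * (b +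
  14/10) * 2^(i - j/2). From j < i a factor sqrt 2 is gained over 2^(i/2), and 45 \<le> 32 * sqrt 2.
  At i = 1 and b = 0 the bound is 64 * 14/10 > 89.\<close>

lemma session_length_ge:
  assumes "s \<le> t" "acc g j s t \<le> radius i" "j < i"
  shows "real (t - s + 1) \<ge> 45 * (b + 14/10) * 2 powr (real i / 2)" "real (t - s + 1) \<ge> 89"
proof -
  define n where "n = real (t - s + 1)"
  define q :: real where "q = 2 powr (- real j / 2)"
  define x :: real where "x = 2 powr (real i / 2)"
  define y :: real where "y = 2 ^ i"
  define \<beta> where "\<beta> = b + 14/10"
  have y: "y > 0" by (simp add: y_def)
  have n: "n > 0" by (simp add: n_def)
  have "(acc g j s t)\<^sup>2 \<le> (radius i)\<^sup>2"
    using assms acc_pos[OF assms(1), of g j] by (intro power_mono) auto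
  then have le: "8 * real d0 * radius j * saew_err a b B \<delta> j g s t \<le> U\<^sup>2 / 2 ^ i * (\<alpha> * n)"
    unfolding acc_sq[OF assms(1)] radius_sq n_def[symmetric] using n \<alpha> by (simp add: field_simps)
  have "8 * 1 * radius j * (\<beta> * B) \<le> 8 * real d0 * radius j * saew_err a b B \<delta> j g s t"
    unfolding \<beta>_def
    using d0 radius_pos[of j] saew_err_ge[OF assms(1), of j g] b B by (intro mult_mono) auto
  with le have "8 * 1 * radius j * (\<beta> * B) \<le> U\<^sup>2 / y * (\<alpha> * n)"
    unfolding y_def by (rule order.trans[rotated])
  also have "\<dots> = U / y * n * (\<alpha> * U)" by (simp add: power2_eq_square)
  also have "\<dots> \<le> U / y * n * (B / 4)"
    using \<alpha>_le U n y by (intro mult_left_mono) auto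
  finally have "8 * (U * q) * \<beta> * B \<le> U / y * n / 4 * B"
    unfolding radius_def q_def by simp
  then have "8 * (U * q) * \<beta> \<le> U / y * n / 4"
    using B by (rule mult_right_le_imp_le)
  then have "U * (32 * (q * y) * \<beta>) \<le> U * n"
    using y by (simp add: field_simps)
  then have "32 * (q * y) * \<beta> \<le> n"
    using U by (rule mult_left_le_imp_le)
  then have "32 * (q * 2 ^ i) * (b + 14/10) \<le> n"
    unfolding y_def \<beta>_def .
  moreover have "x * sqrt 2 \<le> q * 2 ^ i"
  proof -
    have "x * sqrt 2 = 2 powr (real i / 2 + 1 / 2)"
      unfolding x_def by (simp only: powr_add powr_half_sqrt zero_le_numeral)
    also have "\<dots> \<le> 2 powr (- real j / 2 + real i)"
      using assms(3) by (intro powr_mono) (auto simp: field_simps)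
    also have "\<dots> = q * 2 ^ i"
      unfolding q_def by (simp only: powr_add powr_realpow zero_less_numeral)
    finally show ?thesis .
  qed
  then have "32 * (x * sqrt 2) * (b + 14/10) \<le> 32 * (q * 2 ^ i) * (b + 14/10)"
    using b by (intro mult_right_mono mult_left_mono) auto
  ultimately have *: "32 * (x * sqrt 2) * (b + 14/10) \<le> n" by linarith
  have sqrt2: "45 / 32 \<le> sqrt 2" by (rule real_le_rsqrt) (simp add: power2_eq_square)
  have x: "sqrt 2 \<le> x"
  proof -
    have "sqrt 2 = 2 powr (1 / 2)" by (simp only: powr_half_sqrt zero_le_numeral)
    also have "\<dots> \<le> x"
      unfolding x_def using assms(3) by (intro powr_mono) auto
    finally show ?thesis .
  qed
  have "32 * (x * (45 / 32)) * (b + 14/10) \<le> 32 * (x * sqrt 2) * (b + 14/10)"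
    using b sqrt2 x by (intro mult_right_mono mult_left_mono) auto
  with * show "real (t - s + 1) \<ge> 45 * (b + 14/10) * 2 powr (real i / 2)"
    unfolding n_def[symmetric] x_def[symmetric] by (simp add: mult_ac)
  have "sqrt 2 * sqrt 2 \<le> x * sqrt 2"
    using x by (rule mult_right_mono) simp
  then have "2 \<le> x * sqrt 2" by simp
  then have "32 * 2 * (14/10) \<le> 32 * (x * sqrt 2) * (b + 14/10)"
    using b by (intro mult_mono) auto
  with * show "real (t - s + 1) \<ge> 89" unfolding n_def[symmetric] by linarith
qed

text \<open>Links the declarative run, with its infima in \<open>enat\<close> and its empty
  sessions, to the recursion \<open>sess\<close>: by \<open>inv\<close>, round n + 1 lies at or
  after the start of its session and before the start of the next one. Of the witnesses, the centres
  and the averages are passed on.\<close>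

lemma run_rounds:
  assumes "saew_run S a b d0 \<alpha> U B \<delta> g \<theta>"
  obtains c \<theta>a where "\<theta>a 0 = 0"
    "\<And>n i s. sess g n = (i, s) \<Longrightarrow> is_truncation d0 (\<theta>a (s - 1)) (c i)"
    "\<And>n i s. sess g n = (i, s) \<Longrightarrow> \<theta> n = S B s (c i) (radius i) (map g [s..<Suc n])"
    "\<And>n i s. sess g n = (i, s) \<Longrightarrow>
       \<theta>a (Suc n) = (1 / real (Suc n - s + 1)) *\<^sub>R (\<Sum>r=s..Suc n. \<theta> (r - 1))"
proof -
  from assms[unfolded saew_run_def, folded radius_Suc, folded radius_def, folded acc_def]
  obtain \<tau> :: "nat \<Rightarrow> enat" and c \<epsilon> \<theta>a where
    \<tau>0: "\<tau> 0 = enat 1" and \<epsilon>0: "\<epsilon> 0 = U" and \<theta>0: "\<theta>a 0 = 0" and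
    \<tau>': "\<forall>i. \<tau> (Suc i) = Inf {enat t |t. \<tau> i \<le> enat t \<and> \<epsilon> (t - 1) \<le> radius (Suc i)}" and
    c': "\<forall>i s. \<tau> i = enat s \<longrightarrow> is_truncation d0 (\<theta>a (s - 1)) (c i) \<and>
      (\<forall>t. s \<le> t \<and> enat t < \<tau> (Suc i) \<longrightarrow>
        \<theta> (t - 1) = S B s (c i) (radius i) (map g [s..<t]) \<and>
        \<epsilon> t = acc g i s t \<and> \<theta>a t = (1 / real (t - s + 1)) *\<^sub>R (\<Sum>r=s..t. \<theta> (r - 1)))"
    by (elim exE conjE) (rule that)
  note \<tau> = \<tau>'[rule_format]
  have c: "is_truncation d0 (\<theta>a (s - 1)) (c i)" if "\<tau> i = enat s" for i s
    using c'[rule_format, OF that] by (rule conjunct1)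
  have round: "\<theta> (t - 1) = S B s (c i) (radius i) (map g [s..<t]) \<and>
      \<epsilon> t = acc g i s t \<and> \<theta>a t = (1 / real (t - s + 1)) *\<^sub>R (\<Sum>r=s..t. \<theta> (r - 1))"
    if "\<tau> i = enat s" "s \<le> t" "enat t < \<tau> (Suc i)" for i s t
    by (rule c'[rule_format, OF that(1), THEN conjunct2, rule_format]) (use that in simp)
  have later: "enat t < \<tau> (Suc i)"
    if "\<tau> i \<ge> enat t" "radius (Suc i) < \<epsilon> (t - 1)" for i t
  proof -
    have "enat (Suc t) \<le> \<tau> (Suc i)"
      unfolding \<tau>
    proof (rule Inf_greatest, safe)
      fix u assume u: "\<tau> i \<le> enat u" "\<epsilon> (u - 1) \<le> radius (Suc i)"
      have "enat t \<le> enat u" using that(1) u(1) by (rule order.trans)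
      moreover have "u \<noteq> t" using u(2) that(2) by auto
      ultimately show "enat (Suc t) \<le> enat u" by simp
    qed
    then show ?thesis by (simp add: Suc_ile_eq)
  qed
  have inv: "\<tau> i = enat s \<and> s \<le> Suc n \<and> enat (Suc n) < \<tau> (Suc i)"
    if "sess g n = (i, s)" for n i s
    using that
  proof (induction n arbitrary: i s)
    case 0
    \<comment> \<open>Session 0 is not empty: the initial accuracy U exceeds the first
      threshold.\<close>
    have "radius (Suc 0) < U"
      unfolding radius_Suc using U by (simp add: powr_less_one)
    then show ?case using 0 later[of 1 0] \<tau>0 \<epsilon>0 by simp
  next
    case (Suc n)
    obtain i' s' where n: "sess g n = (i', s')" by force
    note IH = Suc.IH[OF n]
    have \<epsilon>: "\<epsilon> (Suc n) = acc g i' s' (Suc n)"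
      using round[of i' s' "Suc n"] IH by simp
    show ?case
    proof (cases "radius (Suc i') < acc g i' s' (Suc n)")
      case True
      then have same: "i = i'" "s = s'" using Suc.prems sess_Suc(1)[OF n] by auto
      have "enat (Suc (Suc n)) < \<tau> (Suc i')"
      proof -
        have "enat (Suc (Suc (Suc n))) \<le> \<tau> (Suc i')"
          unfolding \<tau>
        proof (rule Inf_greatest, safe)
          fix t assume t: "\<tau> i' \<le> enat t" "\<epsilon> (t - 1) \<le> radius (Suc i')"
          then have "\<tau> (Suc i') \<le> enat t" unfolding \<tau> by (intro Inf_lower) auto
          with IH have "Suc n < t" by (metis enat_ord_simps(2) order_less_le_trans)
          moreover have "t \<noteq> Suc (Suc n)" using t True \<epsilon> by auto
          ultimately show "enat (Suc (Suc (Suc n))) \<le> enat t" by simp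
        qed
        then show ?thesis by (simp add: Suc_ile_eq)
      qed
      then show ?thesis using IH same by simp
    next
      case False
      then have i: "(LEAST j. radius (Suc j) < acc g i' s' (Suc n)) = i" and s: "s = Suc (Suc n)"
        using Suc.prems sess_Suc(2)[OF n] by auto
      have s': "s' \<le> Suc n" using IH by simp
      note least = sess_Least[OF s' False i]
      have "\<tau> (Suc i') \<ge> enat (Suc (Suc n))" using IH by (simp add: Suc_ile_eq)
      moreover have "\<tau> (Suc i') \<le> enat (Suc (Suc n))"
      proof -
        have "\<tau> i' \<le> enat (Suc (Suc n))" using IH by simp
        then show ?thesis
          unfolding \<tau>[of i'] using False \<epsilon> by (intro Inf_lower) auto
      qed
      ultimately have start: "\<tau> (Suc i') = enat s" using s by simp
      \<comment> \<open>The skipped sessions all start at s, because the accuracy at s - 1 is not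
        above any of their thresholds.\<close>
      have "\<tau> j = enat s" if "Suc i' \<le> j" "j \<le> i" for j
        using that
      proof (induction j rule: dec_induct)
        case (step j)
        then have \<tau>j: "\<tau> j = enat s" by simp
        have "radius i \<le> radius (Suc j)" using step.prems by (rule radius_mono)
        then have "\<tau> (Suc j) \<le> enat s"
          unfolding \<tau>[of j] using \<tau>j \<epsilon> s least(2) by (intro Inf_lower) auto
        moreover have "enat s \<le> \<tau> (Suc j)"
          unfolding \<tau>[of j] using \<tau>j by (intro Inf_greatest) auto
        ultimately show ?case by simp
      qed (use start in simp)
      then have \<tau>i: "\<tau> i = enat s" using least(1) by simp
      then have "enat s < \<tau> (Suc i)"
        using later[of s i] least(3) \<epsilon> s by simp
      then show ?thesis using \<tau>i s by simp
    qed
  qed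
  show ?thesis
  proof (rule that[of \<theta>a c])
    fix n i s assume n: "sess g n = (i, s)"
    from inv[OF n] show "is_truncation d0 (\<theta>a (s - 1)) (c i)" by (intro c) simp
    show "\<theta> n = S B s (c i) (radius i) (map g [s..<Suc n])"
      "\<theta>a (Suc n) = (1 / real (Suc n - s + 1)) *\<^sub>R (\<Sum>r=s..Suc n. \<theta> (r - 1))"
      using round[of i s "Suc n"] inv[OF n] by auto
  qed (rule \<theta>0)
qed

end

section \<open>Martingale inequalities for independent losses\<close>

lemma space_loss_space: "space loss_space = convex_losses"
  by (simp add: loss_space_def space_restrict_space space_PiM)

lemma measurable_loss_eval [measurable]: "(\<lambda>f. f x) \<in> borel_measurable loss_space"
  unfolding loss_space_def by (intro measurable_restrict_space1 measurable_component_singleton) simp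

text \<open>
  Rounding the argument to the grid of mesh \<open>1 / (n + 1)\<close> leaves countably many evaluations; convex
  functions are continuous, so the limit over \<open>n\<close> recovers the evaluation.
\<close>

lemma measurable_loss_eval_joint [measurable]:
  "(\<lambda>(f, x). f x) \<in> borel_measurable (loss_space \<Otimes>\<^sub>M (borel :: (real ^ 'd) measure))"
proof -
  define r :: "nat \<Rightarrow> real ^ 'd \<Rightarrow> int ^ 'd" where "r n x = (\<chi> k. \<lfloor>real (Suc n) * x $ k\<rfloor>)" for n x
  define q :: "nat \<Rightarrow> int ^ 'd \<Rightarrow> real ^ 'd" where "q n v = (\<chi> k. real_of_int (v $ k) / real (Suc n))" for n v
  have r [measurable]: "r n \<in> measurable borel (count_space UNIV)" for n
    unfolding measurable_count_space_eq_countable[OF countableI_type]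
  proof safe
    fix v :: "int ^ 'd"
    have "r n -` {v} \<inter> space borel = (\<Inter>k\<in>UNIV. {x \<in> space borel. \<lfloor>real (Suc n) * x $ k\<rfloor> = v $ k})"
      by (auto simp: r_def vec_eq_iff)
    also have "\<dots> \<in> sets borel"
      by (intro sets.finite_INT) (simp_all, measurable)
    finally show "r n -` {v} \<inter> space borel \<in> sets borel" .
  qed simp
  have lim: "(\<lambda>n. q n (r n x)) \<longlonglongrightarrow> x" for x
  proof (rule vec_tendstoI)
    fix k
    have "\<bar>q n (r n x) $ k - x $ k\<bar> \<le> 1 / real (Suc n)" for n
    proof -
      have "\<bar>real_of_int \<lfloor>real (Suc n) * x $ k\<rfloor> - real (Suc n) * x $ k\<bar> \<le> 1" by linarith
      then have "\<bar>real_of_int \<lfloor>real (Suc n) * x $ k\<rfloor> - real (Suc n) * x $ k\<bar> / real (Suc n) \<le> 1 / real (Suc n)"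
        by (intro divide_right_mono) auto
      also have "\<bar>real_of_int \<lfloor>real (Suc n) * x $ k\<rfloor> - real (Suc n) * x $ k\<bar> / real (Suc n) =
          \<bar>(real_of_int \<lfloor>real (Suc n) * x $ k\<rfloor> - real (Suc n) * x $ k) / real (Suc n)\<bar>"
        by (simp only: abs_divide abs_of_nat)
      also have "(real_of_int \<lfloor>real (Suc n) * x $ k\<rfloor> - real (Suc n) * x $ k) / real (Suc n) = q n (r n x) $ k - x $ k"
        by (simp only: q_def r_def vec_lambda_beta diff_divide_distrib nonzero_mult_div_cancel_left of_nat_eq_0_iff)
      finally show ?thesis .
    qed
    then have "(\<lambda>n. q n (r n x) $ k - x $ k) \<longlonglongrightarrow> 0"
      by (intro tendsto_rabs_zero_cancel[OF tendsto_sandwich[OF _ _ tendsto_const LIMSEQ_inverse_real_of_nat]])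
         (auto simp: inverse_eq_divide)
    then show "(\<lambda>n. q n (r n x) $ k) \<longlonglongrightarrow> x $ k"
      by (simp add: LIM_zero_iff)
  qed
  show ?thesis
  proof (rule borel_measurable_LIMSEQ_real)
    fix z :: "(real ^ 'd \<Rightarrow> real) \<times> (real ^ 'd)"
    assume "z \<in> space (loss_space \<Otimes>\<^sub>M borel)"
    then obtain f x where z: "z = (f, x)" and f: "f \<in> convex_losses"
      by (cases z) (auto simp: space_pair_measure space_loss_space)
    from f have "continuous_on UNIV f"
      by (intro convex_on_continuous) (auto simp: convex_losses_def)
    then have "isCont f x" by (simp add: continuous_on_eq_continuous_at)
    then have "(\<lambda>n. f (q n (r n x))) \<longlonglongrightarrow> f x"
      by (rule isCont_tendsto_compose[OF _ lim])
    then show "(\<lambda>n. (\<lambda>(f, x). f (q n (r n x))) z) \<longlonglongrightarrow> (\<lambda>(f, x). f x) z"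
      by (simp add: z)
  next
    fix n
    have "(\<lambda>z. fst z (q n (r n (snd z)))) \<in>
        borel_measurable (loss_space \<Otimes>\<^sub>M borel :: ((real ^ 'd \<Rightarrow> real) \<times> (real ^ 'd)) measure)"
      by (rule measurable_compose_countable[where f = "\<lambda>v z. fst z (q n v)" and g = "\<lambda>z. r n (snd z)"])
         measurable
    then show "(\<lambda>(f, x). f (q n (r n x))) \<in> borel_measurable (loss_space \<Otimes>\<^sub>M borel)"
      by (simp add: split_beta)
  qed
qed

text \<open>A linear functional attains its maximum over the l1 ball at a vertex. With a subgradient
  at x this bounds f x from above by vertex values; the lower bound reflects x through 0, using a
  subgradient at 0. Only finitely many evaluations of f occur, which gives an integrable envelope
  for a loss at a random point of the ball.\<close>

lemma abs_convex_loss_le: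
  fixes f :: "real ^ 'd \<Rightarrow> real"
  assumes f: "f \<in> convex_losses" and x: "l1_norm x \<le> R"
  shows "\<bar>f x\<bar> \<le> 2 * \<bar>f 0\<bar> + (\<Sum>k\<in>UNIV. \<bar>f (R *\<^sub>R axis k 1)\<bar> + \<bar>f (- (R *\<^sub>R axis k 1))\<bar>)"
    (is "_ \<le> _ + ?K")
proof -
  have R: "R \<ge> 0" using l1_norm_nonneg[of x] x by linarith
  have ex: "\<exists>y. g \<bullet> y' \<le> g \<bullet> y \<and> \<bar>f y\<bar> \<le> ?K" if y': "l1_norm y' \<le> R" for g y' :: "real ^ 'd"
  proof -
    obtain k where k: "\<And>j. \<bar>g $ j\<bar> \<le> \<bar>g $ k\<bar>"
      using Max_in[of "range (\<lambda>j. \<bar>g $ j\<bar>)"] Max_ge[of "range (\<lambda>j. \<bar>g $ j\<bar>)"]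
      by (metis (no_types, lifting) UNIV_I empty_not_UNIV finite_class.finite_UNIV finite_imageI image_iff image_is_empty rangeI)
    define y where "y = (if g $ k \<ge> 0 then R *\<^sub>R axis k 1 else - (R *\<^sub>R axis k (1::real)))"
    have "g \<bullet> y' \<le> (\<Sum>j\<in>UNIV. \<bar>g $ j\<bar> * \<bar>y' $ j\<bar>)"
      unfolding inner_vec_def by (intro sum_mono) (simp flip: abs_mult)
    also have "\<dots> \<le> (\<Sum>j\<in>UNIV. \<bar>g $ k\<bar> * \<bar>y' $ j\<bar>)"
      by (intro sum_mono mult_right_mono k) auto
    also have "\<dots> = \<bar>g $ k\<bar> * l1_norm y'" by (simp add: l1_norm_def sum_distrib_left)
    also have "\<dots> \<le> \<bar>g $ k\<bar> * R" using y' by (intro mult_left_mono) auto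
    also have "\<dots> = g \<bullet> y" by (simp add: y_def inner_axis)
    finally have "g \<bullet> y' \<le> g \<bullet> y" .
    moreover have "\<bar>f y\<bar> \<le> \<bar>f (R *\<^sub>R axis k 1)\<bar> + \<bar>f (- (R *\<^sub>R axis k 1))\<bar>"
      by (simp add: y_def)
    moreover have "\<dots> \<le> ?K"
      by (rule member_le_sum[where f = "\<lambda>k. \<bar>f (R *\<^sub>R axis k 1)\<bar> + \<bar>f (- (R *\<^sub>R axis k 1))\<bar>"]) auto
    ultimately show ?thesis by (meson order.trans)
  qed
  have sub: "\<exists>g. \<forall>y. f z + g \<bullet> (y - z) \<le> f y" for z
    using f by (force simp: convex_losses_def subdifferential_def)
  obtain g where g: "\<And>y. f x + g \<bullet> (y - x) \<le> f y" using sub by blast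
  obtain y where "g \<bullet> x \<le> g \<bullet> y" "\<bar>f y\<bar> \<le> ?K" using ex[OF x] by blast
  with g[of y] have up: "f x \<le> ?K" by (simp add: inner_diff_right)
  obtain g0 where g0: "\<And>y. f 0 + g0 \<bullet> y \<le> f y" using sub[of 0] by auto
  obtain y0 where "g0 \<bullet> (- x) \<le> g0 \<bullet> y0" "\<bar>f y0\<bar> \<le> ?K" using ex[of "- x"] x by auto
  with g0[of y0] g0[of x] have "f x \<ge> 2 * f 0 - ?K" by simp
  with up show ?thesis by linarith
qed

text \<open>Pointwise exp (- y - c * y^2) \<le> 1 - y, and after integration exp m * (1 - m) \<le>
  1. The correction uses the observed squares instead of their expectation, just as
  \<open>saew_err\<close> is built from observed gradients.\<close>

lemma nn_integral_exp_deviation_le: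
  fixes Y :: "'a \<Rightarrow> real"
  assumes "prob_space D" and [measurable]: "Y \<in> borel_measurable D" and Y: "AE x in D. \<bar>Y x\<bar> \<le> \<eta>"
    and c: "1/2 \<le> c" and \<eta>: "0 \<le> \<eta>" "\<eta> < 1" "0 \<le> ln (1 - \<eta>) + \<eta> + c * \<eta>\<^sup>2"
  shows "(\<integral>\<^sup>+x. ennreal (exp ((\<integral>x. Y x \<partial>D) - Y x - c * (Y x)\<^sup>2)) \<partial>D) \<le> 1"
proof -
  interpret prob_space D by fact
  have int: "integrable D Y"
    by (rule integrable_const_bound[where B = \<eta>]) (use Y in auto)
  define m where "m = (\<integral>x. Y x \<partial>D)"
  have "(\<integral>\<^sup>+x. ennreal (exp (m - Y x - c * (Y x)\<^sup>2)) \<partial>D) \<le> (\<integral>\<^sup>+x. ennreal (exp m * (1 - Y x)) \<partial>D)"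
  proof (rule nn_integral_mono_AE, use Y in eventually_elim)
    fix x assume "\<bar>Y x\<bar> \<le> \<eta>"
    then have le: "Y x \<le> \<eta>" "Y x < 1" using \<eta> by auto
    have "- Y x - c * (Y x)\<^sup>2 \<le> ln (1 - Y x)"
      using ln_quadratic_lower[OF c \<eta> le(1)] by linarith
    then have "exp (- Y x - c * (Y x)\<^sup>2) \<le> 1 - Y x"
      using le(2) by (simp add: ln_ge_iff)
    then have "exp m * exp (- Y x - c * (Y x)\<^sup>2) \<le> exp m * (1 - Y x)"
      by (intro mult_left_mono) auto
    moreover have "m - Y x - c * (Y x)\<^sup>2 = m + (- Y x - c * (Y x)\<^sup>2)" by simp
    ultimately show "ennreal (exp (m - Y x - c * (Y x)\<^sup>2)) \<le> ennreal (exp m * (1 - Y x))"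
      by (intro ennreal_leI) (simp only: exp_add)
  qed
  also have "\<dots> = ennreal (\<integral>x. exp m * (1 - Y x) \<partial>D)"
    by (rule nn_integral_eq_integral) (use int Y \<eta> in auto)
  also have "(\<integral>x. exp m * (1 - Y x) \<partial>D) = exp m * (1 - m)"
    using int by (simp add: m_def prob_space)
  also have "ennreal (exp m * (1 - m)) \<le> ennreal (exp m * exp (- m))"
    using exp_ge_add_one_self[of "- m"] by (intro ennreal_leI mult_left_mono) auto
  also have "exp m * exp (- m) = 1" by (rule exp_minus_inverse)
  finally show ?thesis by (simp add: m_def)
qed

locale iid_losses = prob_space M for M :: "'w measure" +
  fixes loss :: "nat \<Rightarrow> 'w \<Rightarrow> real ^ 'd \<Rightarrow> real"
  assumes indep: "indep_vars (\<lambda>_. loss_space) loss {1..}"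
    and ident: "\<And>t. t \<ge> 1 \<Longrightarrow> distr M loss_space (loss t) = distr M loss_space (loss 1)"
begin

section \<open>The filtration of the losses and independence of the next loss\<close>

abbreviation "F \<equiv> past M loss"
abbreviation "D \<equiv> distr M loss_space (loss 1)"

lemma measurable_loss [measurable]: "t \<ge> 1 \<Longrightarrow> loss t \<in> measurable M loss_space"
  using indep by (auto simp: indep_vars_def2)

lemma prob_space_D: "prob_space D"
  by (rule prob_space_distr) simp

lemma past_vec [measurable]: "(\<lambda>\<omega>. \<lambda>t\<in>{1..n}. loss t \<omega>) \<in> measurable M (\<Pi>\<^sub>M t\<in>{1..n}. loss_space)"
  by (rule measurable_restrict) auto

lemma space_F [simp]: "space (F n) = space M"
  by (simp add: past_def)

lemma subalgebra_F: "subalgebra M (F n)"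
  unfolding subalgebra_def past_def using sets_image_in_sets[OF refl past_vec[of n]] by simp

lemma measurable_F: "f \<in> measurable (F n) N \<Longrightarrow> f \<in> measurable M N"
  by (rule measurable_from_subalg[OF subalgebra_F])

lemma measurable_F_vec: "(\<lambda>\<omega>. \<lambda>t\<in>{1..n}. loss t \<omega>) \<in> measurable (F n) (\<Pi>\<^sub>M t\<in>{1..n}. loss_space)"
  unfolding past_def using measurable_space[OF past_vec[of n]] by (intro measurable_vimage_algebra1) auto

lemma measurable_loss_F: "1 \<le> t \<Longrightarrow> t \<le> n \<Longrightarrow> loss t \<in> measurable (F n) loss_space"
  using measurable_compose[OF measurable_F_vec[of n] measurable_component_singleton[of t "{1..n}"]] by simp

lemma measurable_F_mono:
  assumes "f \<in> measurable (F m) N" "m \<le> n"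
  shows "f \<in> measurable (F n) N"
proof -
  have "(\<lambda>\<omega>. \<omega>) \<in> measurable (F n) (F m)"
    unfolding past_def[of _ _ m] using assms(2)
    by (intro measurable_vimage_algebra2 measurable_restrict) (auto intro: measurable_loss_F)
  from measurable_compose[OF this assms(1)] show ?thesis .
qed

lemma measurable_id_F: "(\<lambda>\<omega>. \<omega>) \<in> measurable M (F n)"
  by (rule measurable_F) (rule measurable_ident_sets, simp)

text \<open>Independence of past and present as a product law. Rectangles suffice, and an event of
  \<open>past\<close> is by construction the preimage of an event for the losses 1, ..., n, a block
  that is independent of the block consisting of loss n + 1.\<close>

lemma distr_past_loss:
  "distr M (F n) (\<lambda>\<omega>. \<omega>) \<Otimes>\<^sub>M D = distr M (F n \<Otimes>\<^sub>M loss_space) (\<lambda>\<omega>. (\<omega>, loss (Suc n) \<omega>))"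
proof -
  interpret D: prob_space D by (rule prob_space_D)
  interpret P: prob_space "distr M (F n) (\<lambda>\<omega>. \<omega>)" by (rule prob_space_distr[OF measurable_id_F])
  let ?past = "\<lambda>\<omega>. \<lambda>t\<in>{1..n}. loss t \<omega>" and ?now = "\<lambda>\<omega>. \<lambda>t\<in>{Suc n}. loss t \<omega>"
  have ind: "indep_var (\<Pi>\<^sub>M t\<in>{1..n}. loss_space) ?past (\<Pi>\<^sub>M t\<in>{Suc n}. loss_space) ?now"
    by (rule indep_var_restrict[OF indep]) auto
  have pair: "(\<lambda>\<omega>. (\<omega>, loss (Suc n) \<omega>)) \<in> measurable M (F n \<Otimes>\<^sub>M loss_space)"
    by (intro measurable_Pair measurable_id_F measurable_loss) simp
  show ?thesis
  proof (rule pair_measure_eqI)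
    show "sets (distr M (F n) (\<lambda>\<omega>. \<omega>) \<Otimes>\<^sub>M D) =
        sets (distr M (F n \<Otimes>\<^sub>M loss_space) (\<lambda>\<omega>. (\<omega>, loss (Suc n) \<omega>)))"
      by (simp cong: sets_pair_measure_cong)
    fix A B assume "A \<in> sets (distr M (F n) (\<lambda>\<omega>. \<omega>))" "B \<in> sets D"
    then have A: "A \<in> sets (F n)" and B: "B \<in> sets loss_space" by simp_all
    have "?past \<in> space M \<rightarrow> space (\<Pi>\<^sub>M t\<in>{1..n}. loss_space)"
      using measurable_space[OF past_vec[of n]] by auto
    then obtain A' where A': "A' \<in> sets (\<Pi>\<^sub>M t\<in>{1..n}. loss_space)" "A = ?past -` A' \<inter> space M"
      using A unfolding past_def by (subst (asm) sets_vimage_algebra2) auto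
    define B' where "B' = (\<lambda>f. f (Suc n)) -` B \<inter> space (\<Pi>\<^sub>M t\<in>{Suc n}. loss_space :: (real ^ 'd \<Rightarrow> real) measure)"
    have B': "B' \<in> sets (\<Pi>\<^sub>M t\<in>{Suc n}. loss_space)"
      unfolding B'_def by (rule measurable_sets[OF _ B]) simp
    have now: "?now -` B' \<inter> space M = loss (Suc n) -` B \<inter> space M"
      using measurable_space[OF measurable_loss[of "Suc n"]]
      by (auto simp: B'_def space_PiM)
    have "(\<lambda>\<omega>. (?past \<omega>, ?now \<omega>)) -` (A' \<times> B') \<inter> space M =
        (\<lambda>\<omega>. (\<omega>, loss (Suc n) \<omega>)) -` (A \<times> B) \<inter> space M"
      using now unfolding A'(2) by auto
    then have "prob ((\<lambda>\<omega>. (\<omega>, loss (Suc n) \<omega>)) -` (A \<times> B) \<inter> space M) =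
        prob A * prob (loss (Suc n) -` B \<inter> space M)"
      using indep_varD[OF ind A'(1) B'] now A'(2) by simp
    moreover have "emeasure D B = emeasure M (loss (Suc n) -` B \<inter> space M)"
      using B by (simp add: ident[of "Suc n", symmetric] emeasure_distr del: One_nat_def)
    moreover have "A \<inter> space M = A"
      using sets.sets_into_space[OF A] by auto
    ultimately show "emeasure (distr M (F n) (\<lambda>\<omega>. \<omega>)) A * emeasure D B =
        emeasure (distr M (F n \<Otimes>\<^sub>M loss_space) (\<lambda>\<omega>. (\<omega>, loss (Suc n) \<omega>))) (A \<times> B)"
      using A B pair measurable_id_F
      by (simp add: emeasure_distr emeasure_eq_measure ennreal_mult')
  qed (unfold_locales)
qed

text \<open>Freezing: the next loss is integrated out while the past is held fixed.\<close>

lemma nn_integral_past: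
  assumes "(\<lambda>(\<omega>, x). h \<omega> x) \<in> borel_measurable (F n \<Otimes>\<^sub>M loss_space)"
  shows "(\<integral>\<^sup>+\<omega>. h \<omega> (loss (Suc n) \<omega>) \<partial>M) = (\<integral>\<^sup>+\<omega>. (\<integral>\<^sup>+x. h \<omega> x \<partial>D) \<partial>M)"
proof -
  interpret D: prob_space D by (rule prob_space_D)
  have sets: "sets (distr M (F n) (\<lambda>\<omega>. \<omega>) \<Otimes>\<^sub>M D) = sets (F n \<Otimes>\<^sub>M loss_space)"
    by (intro sets_pair_measure_cong) auto
  have meas: "(\<lambda>(\<omega>, x). h \<omega> x) \<in> borel_measurable (distr M (F n) (\<lambda>\<omega>. \<omega>) \<Otimes>\<^sub>M D)"
    using assms by (simp add: measurable_cong_sets[OF sets refl])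
  have pair: "(\<lambda>\<omega>. (\<omega>, loss (Suc n) \<omega>)) \<in> measurable M (F n \<Otimes>\<^sub>M loss_space)"
    by (intro measurable_Pair measurable_id_F measurable_loss) simp
  have "(\<integral>\<^sup>+\<omega>. h \<omega> (loss (Suc n) \<omega>) \<partial>M) =
      (\<integral>\<^sup>+z. (\<lambda>(\<omega>, x). h \<omega> x) z \<partial>distr M (F n \<Otimes>\<^sub>M loss_space) (\<lambda>\<omega>. (\<omega>, loss (Suc n) \<omega>)))"
    using pair assms by (subst nn_integral_distr) auto
  also have "\<dots> = (\<integral>\<^sup>+\<omega>. (\<integral>\<^sup>+x. h \<omega> x \<partial>D) \<partial>distr M (F n) (\<lambda>\<omega>. \<omega>))"
    unfolding distr_past_loss[symmetric] using D.nn_integral_fst[OF meas] by simp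
  also have "\<dots> = (\<integral>\<^sup>+\<omega>. (\<integral>\<^sup>+x. h \<omega> x \<partial>D) \<partial>M)"
    using D.borel_measurable_nn_integral_fst[OF meas] measurable_id_F by (subst nn_integral_distr) auto
  finally show ?thesis .
qed

lemma measurable_past_loss:
  assumes "(\<lambda>(\<omega>, x). h \<omega> x) \<in> borel_measurable (F m \<Otimes>\<^sub>M loss_space)" "m < n"
  shows "(\<lambda>\<omega>. h \<omega> (loss (Suc m) \<omega>)) \<in> borel_measurable (F n)"
proof -
  have "(\<lambda>\<omega>. \<omega>) \<in> measurable (F n) (F m)"
    using assms(2) by (intro measurable_F_mono[OF measurable_ident_sets]) auto
  then have "(\<lambda>\<omega>. (\<omega>, loss (Suc m) \<omega>)) \<in> measurable (F n) (F m \<Otimes>\<^sub>M loss_space)"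
    using assms(2) by (intro measurable_Pair measurable_loss_F) auto
  from measurable_compose[OF this assms(1)] show ?thesis by simp
qed

text \<open>
  The product of the exponentials is stopped as soon as it reaches \<open>exp \<Lambda>\<close>, so that Markov's
  inequality at the final time controls all times at once.
\<close>

lemma exponential_maximal_inequality:
  fixes h :: "nat \<Rightarrow> 'w \<Rightarrow> (real ^ 'd \<Rightarrow> real) \<Rightarrow> real"
  assumes meas: "\<And>n. (\<lambda>(\<omega>, x). h n \<omega> x) \<in> borel_measurable (F n \<Otimes>\<^sub>M loss_space)"
    and le: "\<And>n \<omega>. \<omega> \<in> space M \<Longrightarrow> (\<integral>\<^sup>+x. ennreal (exp (h n \<omega> x)) \<partial>D) \<le> 1"
  defines "Z \<equiv> \<lambda>n \<omega>. \<Sum>m<n. h m \<omega> (loss (Suc m) \<omega>)"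
  shows "{\<omega> \<in> space M. \<exists>n\<le>N. \<Lambda> \<le> Z n \<omega>} \<in> sets M"
    and "prob {\<omega> \<in> space M. \<exists>n\<le>N. \<Lambda> \<le> Z n \<omega>} \<le> exp (- \<Lambda>)"
proof -
  interpret D: prob_space D by (rule prob_space_D)
  note hF = measurable_past_loss[OF meas]
  have ZF: "Z m \<in> borel_measurable (F n)" if "m \<le> n" for m n
    unfolding Z_def using that by (intro borel_measurable_sum hF) auto
  have ZM [measurable]: "Z n \<in> borel_measurable M" for n
    by (rule measurable_F[OF ZF[OF order_refl]])
  show "{\<omega> \<in> space M. \<exists>n\<le>N. \<Lambda> \<le> Z n \<omega>} \<in> sets M" by measurable
  \<comment> \<open>No crossing up to time n: this is known before loss n + 1 arrives, so the
    stopped increments inherit the one-step bound.\<close>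
  define A where "A n \<omega> \<longleftrightarrow> (\<forall>m\<le>n. Z m \<omega> < \<Lambda>)" for n \<omega>
  define h' where "h' n \<omega> x = (if A n \<omega> then h n \<omega> x else 0)" for n \<omega> x
  define Z' where "Z' n \<omega> = (\<Sum>m<n. h' m \<omega> (loss (Suc m) \<omega>))" for n \<omega>
  have A: "Measurable.pred (F n) (A n)" for n
  proof -
    have "{\<omega> \<in> space (F n). \<forall>m\<in>{..n}. Z m \<omega> < \<Lambda>} \<in> sets (F n)"
    proof (rule sets.sets_Collect_finite_All)
      fix m assume "m \<in> {..n}"
      then have "Z m \<in> borel_measurable (F n)" by (intro ZF) simp
      then show "{\<omega> \<in> space (F n). Z m \<omega> < \<Lambda>} \<in> sets (F n)"
        by (rule borel_measurable_less) (rule borel_measurable_const)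
    qed (rule finite_atMost)
    then show ?thesis unfolding A_def pred_def Ball_def atMost_iff .
  qed
  have h' [measurable]: "(\<lambda>(\<omega>, x). h' n \<omega> x) \<in> borel_measurable (F n \<Otimes>\<^sub>M loss_space)" for n
  proof -
    have "Measurable.pred (F n \<Otimes>\<^sub>M loss_space) (\<lambda>z. A n (fst z))"
      by (rule measurable_compose[OF measurable_fst A])
    moreover have "(\<lambda>z. h n (fst z) (snd z)) \<in> borel_measurable (F n \<Otimes>\<^sub>M loss_space)"
      using meas[of n] unfolding case_prod_unfold .
    ultimately have "(\<lambda>z. if A n (fst z) then h n (fst z) (snd z) else 0) \<in> borel_measurable (F n \<Otimes>\<^sub>M loss_space)"
      by (intro measurable_If) (simp_all add: pred_def)
    then show ?thesis unfolding h'_def case_prod_unfold .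
  qed
  note h'F = measurable_past_loss[OF h']
  have Z'F [measurable]: "Z' n \<in> borel_measurable (F n)" for n
    unfolding Z'_def by (intro borel_measurable_sum h'F) auto
  have Z'M [measurable]: "Z' n \<in> borel_measurable M" for n
    by (rule measurable_F[OF Z'F])
  have exp_le: "(\<integral>\<^sup>+\<omega>. ennreal (exp (Z' n \<omega>)) \<partial>M) \<le> 1" for n
  proof (induction n)
    case 0
    then show ?case by (simp add: Z'_def emeasure_space_1)
  next
    case (Suc n)
    have "(\<integral>\<^sup>+\<omega>. ennreal (exp (Z' (Suc n) \<omega>)) \<partial>M) =
        (\<integral>\<^sup>+\<omega>. (\<lambda>\<omega> x. ennreal (exp (Z' n \<omega>) * exp (h' n \<omega> x))) \<omega> (loss (Suc n) \<omega>) \<partial>M)"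
      by (simp add: Z'_def exp_add)
    also have "\<dots> = (\<integral>\<^sup>+\<omega>. \<integral>\<^sup>+x. ennreal (exp (Z' n \<omega>) * exp (h' n \<omega> x)) \<partial>D \<partial>M)"
    proof (rule nn_integral_past)
      have "(\<lambda>z. ennreal (exp (Z' n (fst z)) * exp (h' n (fst z) (snd z)))) \<in> borel_measurable (F n \<Otimes>\<^sub>M loss_space)"
        using h'[of n] unfolding case_prod_unfold
        by (intro measurable_compose[OF _ measurable_ennreal] borel_measurable_times
            measurable_compose[OF _ borel_measurable_exp]
            measurable_compose[OF measurable_fst Z'F])
      then show "(\<lambda>(\<omega>, x). ennreal (exp (Z' n \<omega>) * exp (h' n \<omega> x))) \<in> borel_measurable (F n \<Otimes>\<^sub>M loss_space)"
        unfolding case_prod_unfold .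
    qed
    also have "\<dots> \<le> (\<integral>\<^sup>+\<omega>. ennreal (exp (Z' n \<omega>)) \<partial>M)"
    proof (rule nn_integral_mono)
      fix \<omega> assume \<omega>: "\<omega> \<in> space M"
      have [measurable]: "(\<lambda>x. h' n \<omega> x) \<in> borel_measurable loss_space"
        using measurable_compose_Pair1[OF _ h'[of n], of \<omega>] \<omega> by simp
      have "(\<integral>\<^sup>+x. ennreal (exp (Z' n \<omega>) * exp (h' n \<omega> x)) \<partial>D) =
          ennreal (exp (Z' n \<omega>)) * (\<integral>\<^sup>+x. ennreal (exp (h' n \<omega> x)) \<partial>D)"
        by (simp add: ennreal_mult nn_integral_cmult)
      also have "\<dots> \<le> ennreal (exp (Z' n \<omega>)) * 1"
      proof (rule mult_left_mono)
        show "(\<integral>\<^sup>+x. ennreal (exp (h' n \<omega> x)) \<partial>D) \<le> 1"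
          using le[OF \<omega>, of n] D.emeasure_space_1 by (cases "A n \<omega>") (simp_all add: h'_def)
      qed simp
      finally show "(\<integral>\<^sup>+x. ennreal (exp (Z' n \<omega>) * exp (h' n \<omega> x)) \<partial>D) \<le> ennreal (exp (Z' n \<omega>))"
        by (simp only: mult_1_right)
    qed
    finally show ?case using Suc by (rule order.trans)
  qed
  \<comment> \<open>Let k be the first crossing time. The increments before k are unchanged and
    those from k on vanish, so the stopped sum stays at its value Z k.\<close>
  have stop: "\<Lambda> \<le> Z' N \<omega>" if "n \<le> N" "\<Lambda> \<le> Z n \<omega>" for n \<omega>
  proof -
    define k where "k = (LEAST n. \<Lambda> \<le> Z n \<omega>)"
    have k: "\<Lambda> \<le> Z k \<omega>" "k \<le> n" "\<And>m. m < k \<Longrightarrow> Z m \<omega> < \<Lambda>"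
      unfolding k_def using that(2) by (auto intro: LeastI Least_le dest: not_less_Least)
    have "Z' N \<omega> = (\<Sum>m<k. h' m \<omega> (loss (Suc m) \<omega>))"
      unfolding Z'_def
    proof (rule sum.mono_neutral_right)
      show "\<forall>m\<in>{..<N} - {..<k}. h' m \<omega> (loss (Suc m) \<omega>) = 0"
      proof
        fix m assume "m \<in> {..<N} - {..<k}"
        then have "\<not> A m \<omega>" using k(1) unfolding A_def by (auto intro!: exI[of _ k])
        then show "h' m \<omega> (loss (Suc m) \<omega>) = 0" by (simp add: h'_def)
      qed
    qed (use k(2) that(1) in auto)
    also have "\<dots> = Z k \<omega>"
      unfolding Z_def using k(3) by (intro sum.cong) (auto simp: h'_def A_def Z_def)
    finally show ?thesis using k(1) by simp
  qed
  have "{\<omega> \<in> space M. \<exists>n\<le>N. \<Lambda> \<le> Z n \<omega>} \<subseteq> {\<omega> \<in> space M. \<Lambda> \<le> Z' N \<omega>}"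
    using stop by auto
  then have "emeasure M {\<omega> \<in> space M. \<exists>n\<le>N. \<Lambda> \<le> Z n \<omega>} \<le> emeasure M {\<omega> \<in> space M. \<Lambda> \<le> Z' N \<omega>}"
    by (intro emeasure_mono) measurable
  also have "\<dots> = (\<integral>\<^sup>+\<omega>. indicator {\<omega> \<in> space M. \<Lambda> \<le> Z' N \<omega>} \<omega> \<partial>M)" by simp
  also have "\<dots> \<le> (\<integral>\<^sup>+\<omega>. ennreal (exp (- \<Lambda>)) * ennreal (exp (Z' N \<omega>)) \<partial>M)"
    by (intro nn_integral_mono)
       (auto simp: indicator_def ennreal_mult[symmetric] exp_add[symmetric] simp flip: ennreal_1 intro!: ennreal_leI)
  also have "\<dots> = ennreal (exp (- \<Lambda>)) * (\<integral>\<^sup>+\<omega>. ennreal (exp (Z' N \<omega>)) \<partial>M)"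
    by (rule nn_integral_cmult) measurable
  also have "\<dots> \<le> ennreal (exp (- \<Lambda>)) * 1" by (intro mult_left_mono exp_le) simp
  finally show "prob {\<omega> \<in> space M. \<exists>n\<le>N. \<Lambda> \<le> Z n \<omega>} \<le> exp (- \<Lambda>)"
    by (simp add: emeasure_eq_measure)
qed

text \<open>On the product law of past and next loss, Fubini's theorem identifies the integrals over
  all events of the past. The envelope K depends on the loss alone, which gives integrability
  however G varies with the past.\<close>

lemma real_cond_exp_past:
  assumes [measurable]: "(\<lambda>(\<omega>, x). G \<omega> x) \<in> borel_measurable (F n \<Otimes>\<^sub>M loss_space)"
    and K: "integrable D K" "\<And>\<omega> x. \<omega> \<in> space M \<Longrightarrow> x \<in> convex_losses \<Longrightarrow> \<bar>G \<omega> x\<bar> \<le> K x"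
  shows "AE \<omega> in M. real_cond_exp M (F n) (\<lambda>\<omega>. G \<omega> (loss (Suc n) \<omega>)) \<omega> = (\<integral>x. G \<omega> x \<partial>D)"
proof -
  interpret D: prob_space D by (rule prob_space_D)
  define P where "P = distr M (F n) (\<lambda>\<omega>. \<omega>)"
  interpret P: prob_space P unfolding P_def by (rule prob_space_distr[OF measurable_id_F])
  interpret PD: pair_prob_space P D ..
  interpret sigma_finite_subalgebra M "F n"
    by (rule finite_measure_subalgebra_is_sigma_finite)
       (simp add: finite_measure_subalgebra_def finite_measure_axioms finite_measure_subalgebra_axioms_def subalgebra_F)
  have sets: "sets (P \<Otimes>\<^sub>M D) = sets (F n \<Otimes>\<^sub>M loss_space)"
    unfolding P_def by (intro sets_pair_measure_cong) auto
  have pair: "(\<lambda>\<omega>. (\<omega>, loss (Suc n) \<omega>)) \<in> measurable M (F n \<Otimes>\<^sub>M loss_space)"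
    by (intro measurable_Pair measurable_id_F measurable_loss) simp
  have Km [measurable]: "K \<in> borel_measurable loss_space"
    using borel_measurable_integrable[OF K(1)] by simp
  have intM: "integrable M (\<lambda>\<omega>. H \<omega> (loss (Suc n) \<omega>))"
    if H: "(\<lambda>(\<omega>, x). H \<omega> x) \<in> borel_measurable (F n \<Otimes>\<^sub>M loss_space)"
      and HK: "\<And>\<omega> x. \<omega> \<in> space M \<Longrightarrow> x \<in> convex_losses \<Longrightarrow> \<bar>H \<omega> x\<bar> \<le> K x" for H
  proof (rule Bochner_Integration.integrable_bound)
    have "integrable (distr M loss_space (loss (Suc n))) K" using K(1) ident[of "Suc n"] by simp
    then show "integrable M (\<lambda>\<omega>. K (loss (Suc n) \<omega>))" by (subst (asm) integrable_distr_eq) auto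
    show "(\<lambda>\<omega>. H \<omega> (loss (Suc n) \<omega>)) \<in> borel_measurable M"
      using measurable_compose[OF pair H] by simp
    show "AE \<omega> in M. norm (H \<omega> (loss (Suc n) \<omega>)) \<le> norm (K (loss (Suc n) \<omega>))"
    proof (rule AE_I2)
      fix \<omega> assume "\<omega> \<in> space M"
      moreover from this have "loss (Suc n) \<omega> \<in> convex_losses"
        using measurable_space[OF measurable_loss[of "Suc n"]] by (simp add: space_loss_space)
      ultimately show "norm (H \<omega> (loss (Suc n) \<omega>)) \<le> norm (K (loss (Suc n) \<omega>))"
        using HK[of \<omega> "loss (Suc n) \<omega>"] by simp
    qed
  qed
  have fubini: "(\<integral>\<omega>. H \<omega> (loss (Suc n) \<omega>) \<partial>M) = (\<integral>\<omega>. (\<integral>x. H \<omega> x \<partial>D) \<partial>M)"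
      "integrable M (\<lambda>\<omega>. \<integral>x. H \<omega> x \<partial>D)" "(\<lambda>\<omega>. \<integral>x. H \<omega> x \<partial>D) \<in> borel_measurable (F n)"
    if H: "(\<lambda>(\<omega>, x). H \<omega> x) \<in> borel_measurable (F n \<Otimes>\<^sub>M loss_space)"
      and HK: "\<And>\<omega> x. \<omega> \<in> space M \<Longrightarrow> x \<in> convex_losses \<Longrightarrow> \<bar>H \<omega> x\<bar> \<le> K x" for H
  proof -
    have H': "(\<lambda>(\<omega>, x). H \<omega> x) \<in> borel_measurable (F n \<Otimes>\<^sub>M D)"
      using H by (simp add: measurable_cong_sets[OF sets_pair_measure_cong[OF refl sets_distr] refl])
    show Fn: "(\<lambda>\<omega>. \<integral>x. H \<omega> x \<partial>D) \<in> borel_measurable (F n)"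
      using D.borel_measurable_lebesgue_integral[OF H'] .
    have "integrable (distr M (F n \<Otimes>\<^sub>M loss_space) (\<lambda>\<omega>. (\<omega>, loss (Suc n) \<omega>))) (\<lambda>(\<omega>, x). H \<omega> x)"
      using intM[OF H HK] H pair by (subst integrable_distr_eq) auto
    then have int: "integrable (P \<Otimes>\<^sub>M D) (\<lambda>(\<omega>, x). H \<omega> x)"
      unfolding P_def distr_past_loss .
    have "(\<integral>\<omega>. H \<omega> (loss (Suc n) \<omega>) \<partial>M) =
        (\<integral>z. (\<lambda>(\<omega>, x). H \<omega> x) z \<partial>distr M (F n \<Otimes>\<^sub>M loss_space) (\<lambda>\<omega>. (\<omega>, loss (Suc n) \<omega>)))"
      using H pair by (subst integral_distr) auto
    also have "\<dots> = (\<integral>\<omega>. (\<integral>x. H \<omega> x \<partial>D) \<partial>P)"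
      unfolding distr_past_loss[symmetric] P_def[symmetric] using PD.integral_fst'[OF int] by simp
    also have "\<dots> = (\<integral>\<omega>. (\<integral>x. H \<omega> x \<partial>D) \<partial>M)"
      unfolding P_def using Fn measurable_id_F by (subst integral_distr) auto
    finally show "(\<integral>\<omega>. H \<omega> (loss (Suc n) \<omega>) \<partial>M) = (\<integral>\<omega>. (\<integral>x. H \<omega> x \<partial>D) \<partial>M)" .
    have "integrable P (\<lambda>\<omega>. \<integral>x. H \<omega> x \<partial>D)" using PD.integrable_fst'[OF int] by simp
    then show "integrable M (\<lambda>\<omega>. \<integral>x. H \<omega> x \<partial>D)"
      unfolding P_def using Fn measurable_id_F by (subst (asm) integrable_distr_eq) auto
  qed
  show ?thesis
  proof (rule real_cond_exp_charact)
    fix A assume A [measurable]: "A \<in> sets (F n)"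
    have "(\<lambda>(\<omega>, x). indicator A \<omega> * G \<omega> x) \<in> borel_measurable (F n \<Otimes>\<^sub>M loss_space)"
      unfolding split_beta' by measurable
    moreover have "\<bar>indicator A \<omega> * G \<omega> x\<bar> \<le> K x" if "\<omega> \<in> space M" "x \<in> convex_losses" for \<omega> x
      using K(2)[OF that] by (auto simp: indicator_def)
    ultimately have "(\<integral>\<omega>. indicator A \<omega> * G \<omega> (loss (Suc n) \<omega>) \<partial>M) = (\<integral>\<omega>. (\<integral>x. indicator A \<omega> * G \<omega> x \<partial>D) \<partial>M)"
      by (rule fubini(1))
    then show "(\<integral>\<omega>\<in>A. G \<omega> (loss (Suc n) \<omega>) \<partial>M) = (\<integral>\<omega>\<in>A. (\<integral>x. G \<omega> x \<partial>D) \<partial>M)"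
      by (simp add: set_lebesgue_integral_def)
  qed (use intM[OF assms(1) K(2)] fubini[OF assms(1) K(2)] in auto)
qed

end

section \<open>The risk\<close>

locale loss_model = iid_losses M loss
  for M :: "'w measure" and loss :: "nat \<Rightarrow> 'w \<Rightarrow> real ^ 'd \<Rightarrow> real" +
  fixes grad :: "(real ^ 'd \<Rightarrow> real) \<Rightarrow> real ^ 'd \<Rightarrow> real ^ 'd"
    and \<theta>s :: "real ^ 'd" and \<alpha> U B :: real
  assumes subgradient: "subgradient_oracle grad"
    and risk_finite: "\<And>\<theta>. integrable M (\<lambda>\<omega>. loss 1 \<omega> \<theta>)"
    and \<alpha>_pos: "\<alpha> > 0" and U_pos: "U > 0" and B_pos: "B > 0"
    and strong_convexity: "\<And>\<theta>1 \<theta>2. (\<integral>\<omega>. loss 1 \<omega> \<theta>1 - loss 1 \<omega> \<theta>2 \<partial>M)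
           \<le> (\<integral>\<omega>. grad (loss 1 \<omega>) \<theta>1 \<partial>M) \<bullet> (\<theta>1 - \<theta>2) - \<alpha> * (norm (\<theta>1 - \<theta>2))\<^sup>2"
    and minimizer: "\<And>\<theta>. (\<integral>\<omega>. loss 1 \<omega> \<theta>s \<partial>M) \<le> (\<integral>\<omega>. loss 1 \<omega> \<theta> \<partial>M)"
    and \<theta>s_l1: "l1_norm \<theta>s \<le> U"
    and grad_bounded: "AE \<omega> in M. \<forall>t\<ge>1. \<forall>\<theta>. l1_norm \<theta> \<le> 2 * U \<longrightarrow> infnorm (grad (loss t \<omega>) \<theta>) \<le> B"
begin

definition risk :: "real ^ 'd \<Rightarrow> real" where
  "risk \<theta> = (\<integral>x. x \<theta> \<partial>D)"

text \<open>On the ball of radius 2 * U this is the expected gradient applied to v; as a scalar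
  integral it fits the deviation inequality directly.\<close>

definition slope :: "real ^ 'd \<Rightarrow> real ^ 'd \<Rightarrow> real" where
  "slope \<theta> v = (\<integral>x. grad x \<theta> \<bullet> v \<partial>D)"

lemma measurable_loss_1: "loss 1 \<in> measurable M loss_space"
  by (rule measurable_loss) simp

lemma measurable_grad_joint:
  assumes "f \<in> measurable N loss_space" "g \<in> borel_measurable N"
  shows "(\<lambda>x. grad (f x) (g x)) \<in> borel_measurable N"
proof -
  have "(\<lambda>(f, x). grad f x) \<in> borel_measurable (loss_space \<Otimes>\<^sub>M borel)"
    using subgradient by (simp add: subgradient_oracle_def)
  from measurable_compose[OF measurable_Pair[OF assms] this] show ?thesis by simp
qed

lemma measurable_grad: "(\<lambda>x. grad x \<theta>) \<in> borel_measurable loss_space"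
  by (rule measurable_grad_joint) simp_all

lemma measurable_grad_inner: "(\<lambda>x. grad x \<theta> \<bullet> v) \<in> borel_measurable loss_space"
  by (intro borel_measurable_inner measurable_grad borel_measurable_const)

lemma integral_D: "f \<in> borel_measurable loss_space \<Longrightarrow> (\<integral>x. f x \<partial>D) = (\<integral>\<omega>. f (loss 1 \<omega>) \<partial>M)"
  for f :: "(real ^ 'd \<Rightarrow> real) \<Rightarrow> real"
  by (rule integral_distr[OF measurable_loss_1])

lemma risk_eq: "risk \<theta> = (\<integral>\<omega>. loss 1 \<omega> \<theta> \<partial>M)"
  unfolding risk_def by (rule integral_D) (rule measurable_loss_eval)

lemma risk_eq_t: "t \<ge> 1 \<Longrightarrow> (\<integral>\<omega>. loss t \<omega> \<theta> \<partial>M) = risk \<theta>"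
  unfolding risk_def using integral_distr[OF measurable_loss measurable_loss_eval, of t \<theta>] ident[of t]
  by simp

lemma integrable_eval: "integrable D (\<lambda>x. x \<theta>)"
  using risk_finite[of \<theta>] by (simp only: integrable_distr_eq[OF measurable_loss_1 measurable_loss_eval])

lemma AE_grad_le:
  assumes "l1_norm \<theta> \<le> 2 * U"
  shows "AE x in D. infnorm (grad x \<theta>) \<le> B"
proof -
  have "{x \<in> space loss_space. infnorm (grad x \<theta>) \<le> B} \<in> sets loss_space"
    using measurable_compose[OF measurable_grad borel_measurable_infnorm]
    by (intro borel_measurable_le borel_measurable_const)
  moreover have "AE \<omega> in M. infnorm (grad (loss 1 \<omega>) \<theta>) \<le> B"
    using grad_bounded by eventually_elim (use assms in auto)
  ultimately show ?thesis
    by (simp only: AE_distr_iff[OF measurable_loss_1])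
qed

lemma AE_grad_inner_le:
  assumes "l1_norm \<theta> \<le> 2 * U"
  shows "AE x in D. \<bar>grad x \<theta> \<bullet> v\<bar> \<le> B * l1_norm v"
  using AE_grad_le[OF assms]
proof eventually_elim
  fix x assume "infnorm (grad x \<theta>) \<le> B"
  then have "infnorm (grad x \<theta>) * l1_norm v \<le> B * l1_norm v" by (rule mult_right_mono) simp
  then show "\<bar>grad x \<theta> \<bullet> v\<bar> \<le> B * l1_norm v"
    using abs_inner_le_infnorm_l1_norm[of "grad x \<theta>" v] by linarith
qed

lemma slope_le:
  assumes "l1_norm \<theta> \<le> 2 * U"
  shows "slope \<theta> v \<le> B * l1_norm v"
proof -
  interpret D: prob_space D by (rule prob_space_D)
  have int: "integrable D (\<lambda>x. grad x \<theta> \<bullet> v)"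
    by (rule D.integrable_const_bound[where B = "B * l1_norm v"])
       (use AE_grad_inner_le[OF assms, of v] measurable_grad_inner in auto)
  have "slope \<theta> v \<le> (\<integral>x. B * l1_norm v \<partial>D)"
    unfolding slope_def
  proof (rule integral_mono_AE[OF int])
    show "AE x in D. grad x \<theta> \<bullet> v \<le> B * l1_norm v"
      using AE_grad_inner_le[OF assms, of v] by eventually_elim auto
  qed (rule D.integrable_const)
  then show ?thesis using D.prob_space by simp
qed

lemma slope_scaleR: "slope \<theta> (c *\<^sub>R v) = c * slope \<theta> v"
  unfolding slope_def by simp

lemma strong:
  assumes "l1_norm \<theta> \<le> 2 * U"
  shows "risk \<theta> - risk \<theta>' + \<alpha> * (norm (\<theta> - \<theta>'))\<^sup>2 \<le> slope \<theta> (\<theta> - \<theta>')"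
proof -
  have "integrable M (\<lambda>\<omega>. grad (loss 1 \<omega>) \<theta>)"
  proof (rule integrable_const_bound)
    show "(\<lambda>\<omega>. grad (loss 1 \<omega>) \<theta>) \<in> borel_measurable M"
      by (rule measurable_compose[OF measurable_loss_1 measurable_grad])
    show "AE \<omega> in M. norm (grad (loss 1 \<omega>) \<theta>) \<le> sqrt DIM(real ^ 'd) * B"
      using grad_bounded
    proof eventually_elim
      fix \<omega> assume "\<forall>t\<ge>1. \<forall>\<theta>. l1_norm \<theta> \<le> 2 * U \<longrightarrow> infnorm (grad (loss t \<omega>) \<theta>) \<le> B"
      then have "infnorm (grad (loss 1 \<omega>) \<theta>) \<le> B" using assms by simp
      then have "sqrt DIM(real ^ 'd) * infnorm (grad (loss 1 \<omega>) \<theta>) \<le> sqrt DIM(real ^ 'd) * B"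
        by (rule mult_left_mono) simp
      with norm_le_infnorm[of "grad (loss 1 \<omega>) \<theta>"]
      show "norm (grad (loss 1 \<omega>) \<theta>) \<le> sqrt DIM(real ^ 'd) * B" by (rule order.trans)
    qed
  qed
  then have "(\<integral>\<omega>. grad (loss 1 \<omega>) \<theta> \<partial>M) \<bullet> (\<theta> - \<theta>') = (\<integral>\<omega>. grad (loss 1 \<omega>) \<theta> \<bullet> (\<theta> - \<theta>') \<partial>M)"
    by (rule integral_inner_left[symmetric])
  also have "\<dots> = slope \<theta> (\<theta> - \<theta>')"
    unfolding slope_def by (rule integral_D[symmetric]) (rule measurable_grad_inner)
  finally show ?thesis
    using strong_convexity[of \<theta> \<theta>'] risk_finite[of \<theta>] risk_finite[of \<theta>'] unfolding risk_eq by simp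
qed

text \<open>Strong convexity between the antipodal points 2 * U * e and - 2 * U * e, used in both
  directions and added: the risks cancel, leaving 2 * \<alpha> * (4 * U)^2 on the left and at most 2
  * B * 4 * U on the right.\<close>

lemma \<alpha>_le: "4 * \<alpha> * U \<le> B"
proof -
  define e :: "real ^ 'd" where "e = axis undefined 1"
  have e: "l1_norm e = 1" "norm e = 1"
    by (simp_all add: e_def l1_norm_def axis_def if_distrib cong: if_cong) (simp flip: axis_def)
  have l1: "l1_norm ((2 * U) *\<^sub>R e) \<le> 2 * U" "l1_norm ((- 2 * U) *\<^sub>R e) \<le> 2 * U"
    using U_pos e by (simp_all add: l1_norm_scaleR)
  have diff: "(2 * U) *\<^sub>R e - (- 2 * U) *\<^sub>R e = (4 * U) *\<^sub>R e"
      "(- 2 * U) *\<^sub>R e - (2 * U) *\<^sub>R e = (- 4 * U) *\<^sub>R e"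
    by (simp_all only: scaleR_left_diff_distrib[symmetric]) simp_all
  have "slope ((2 * U) *\<^sub>R e) ((4 * U) *\<^sub>R e) \<le> B * (4 * U)"
      "slope ((- 2 * U) *\<^sub>R e) ((- 4 * U) *\<^sub>R e) \<le> B * (4 * U)"
    using slope_le[OF l1(1), of "(4 * U) *\<^sub>R e"] slope_le[OF l1(2), of "(- 4 * U) *\<^sub>R e"] U_pos e
    by (simp_all add: l1_norm_scaleR)
  moreover have norms: "(norm ((4 * U) *\<^sub>R e))\<^sup>2 = 16 * U\<^sup>2" "(norm ((- 4 * U) *\<^sub>R e))\<^sup>2 = 16 * U\<^sup>2"
    using e by (simp_all add: power_mult_distrib)
  ultimately have "\<alpha> * (16 * U\<^sup>2) + \<alpha> * (16 * U\<^sup>2) \<le> B * (4 * U) + B * (4 * U)"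
    using strong[OF l1(1), of "(- 2 * U) *\<^sub>R e"] strong[OF l1(2), of "(2 * U) *\<^sub>R e"]
    unfolding diff norms by linarith
  then have "(8 * U) * (4 * \<alpha> * U) \<le> (8 * U) * B"
    by (simp add: power2_eq_square algebra_simps)
  then show ?thesis using U_pos by (simp add: mult_ac)
qed

text \<open>
  The quadratic growth at the minimizer is not a consequence of the first-order condition, since the
  chosen subgradient there may be non-zero. It follows from strong convexity at intermediate
  points, which tend to the minimizer.
\<close>

lemma risk_growth:
  assumes "l1_norm \<theta> \<le> 2 * U"
  shows "\<alpha> * (norm (\<theta> - \<theta>s))\<^sup>2 \<le> risk \<theta> - risk \<theta>s"
proof (rule field_le_mult_one_interval)
  fix z :: real assume z: "0 < z" "z < 1"
  define d where "d = \<theta> - \<theta>s"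
  define p where "p = z *\<^sub>R \<theta>s + (1 - z) *\<^sub>R \<theta>"
  have "l1_norm p \<le> z * l1_norm \<theta>s + (1 - z) * l1_norm \<theta>"
    unfolding p_def using l1_norm_triangle[of "z *\<^sub>R \<theta>s" "(1 - z) *\<^sub>R \<theta>"] z by (simp add: l1_norm_scaleR)
  also have "\<dots> \<le> z * (2 * U) + (1 - z) * (2 * U)"
    using z assms \<theta>s_l1 U_pos by (intro add_mono mult_left_mono) auto
  finally have p: "l1_norm p \<le> 2 * U" by (simp add: algebra_simps)
  have d: "p - \<theta> = (- z) *\<^sub>R d" "p - \<theta>s = (1 - z) *\<^sub>R d"
    by (simp_all add: p_def d_def algebra_simps)
  \<comment> \<open>Strong convexity at p towards both endpoints: the weights 1 - z and z make the
    two slopes cancel, and the coefficients of the quadratic terms add up to z * (1 - z) *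
    \<alpha>.\<close>
  have "risk p - risk \<theta> + \<alpha> * (z\<^sup>2 * (norm d)\<^sup>2) \<le> - z * slope p d"
    using strong[OF p, of \<theta>] unfolding d slope_scaleR by (simp add: power_mult_distrib)
  then have 1: "(1 - z) * (risk p - risk \<theta> + \<alpha> * (z\<^sup>2 * (norm d)\<^sup>2)) \<le> (1 - z) * (- z * slope p d)"
    using z by (intro mult_left_mono) auto
  have "risk p - risk \<theta>s + \<alpha> * ((1 - z)\<^sup>2 * (norm d)\<^sup>2) \<le> (1 - z) * slope p d"
    using strong[OF p, of \<theta>s] unfolding d slope_scaleR by (simp add: power_mult_distrib)
  then have 2: "z * (risk p - risk \<theta>s + \<alpha> * ((1 - z)\<^sup>2 * (norm d)\<^sup>2)) \<le> z * ((1 - z) * slope p d)"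
    using z by (intro mult_left_mono) auto
  have "risk \<theta>s \<le> risk p" unfolding risk_eq by (rule minimizer)
  moreover have "risk p - (1 - z) * risk \<theta> - z * risk \<theta>s + (1 - z) * (z * (\<alpha> * (norm d)\<^sup>2)) \<le> 0"
    using add_mono[OF 1 2] by (simp add: algebra_simps power2_eq_square)
  ultimately have "(1 - z) * (z * (\<alpha> * (norm d)\<^sup>2)) \<le> (1 - z) * (risk \<theta> - risk \<theta>s)"
    by (simp add: algebra_simps)
  then show "z * (\<alpha> * (norm (\<theta> - \<theta>s))\<^sup>2) \<le> risk \<theta> - risk \<theta>s"
    using z by (simp add: d_def)
qed

lemma slope_ge:
  assumes "l1_norm \<theta> \<le> 2 * U"
  shows "risk \<theta> - risk \<theta>s \<le> slope \<theta> (\<theta> - \<theta>s)" "2 * \<alpha> * (norm (\<theta> - \<theta>s))\<^sup>2 \<le> slope \<theta> (\<theta> - \<theta>s)"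
proof -
  have "0 \<le> \<alpha> * (norm (\<theta> - \<theta>s))\<^sup>2" using \<alpha>_pos by simp
  then show "risk \<theta> - risk \<theta>s \<le> slope \<theta> (\<theta> - \<theta>s)" "2 * \<alpha> * (norm (\<theta> - \<theta>s))\<^sup>2 \<le> slope \<theta> (\<theta> - \<theta>s)"
    using strong[OF assms, of \<theta>s] risk_growth[OF assms] by linarith+
qed

text \<open>The weights \<rho> are random but predictable. Where \<rho> vanishes the increment is 0,
  so bounds on prediction and increment are required only where it is switched on.\<close>

lemma deviation:
  fixes \<theta>h :: "nat \<Rightarrow> 'w \<Rightarrow> real ^ 'd" and \<rho> :: "nat \<Rightarrow> 'w \<Rightarrow> real"
  assumes \<theta>h: "\<And>n. \<theta>h n \<in> borel_measurable (F n)" and \<rho>: "\<And>n. \<rho> n \<in> borel_measurable (F n)"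
    and bound: "\<And>n \<omega>. \<omega> \<in> space M \<Longrightarrow> \<rho> n \<omega> \<noteq> 0 \<Longrightarrow>
      l1_norm (\<theta>h n \<omega>) \<le> 2 * U \<and> \<bar>\<rho> n \<omega>\<bar> * (B * l1_norm (\<theta>h n \<omega> - \<theta>s)) \<le> \<eta>"
    and c: "1/2 \<le> c" and \<eta>: "0 \<le> \<eta>" "\<eta> < 1" "0 \<le> ln (1 - \<eta>) + \<eta> + c * \<eta>\<^sup>2"
  defines "X \<equiv> \<lambda>n \<omega>. grad (loss (Suc n) \<omega>) (\<theta>h n \<omega>) \<bullet> (\<theta>h n \<omega> - \<theta>s)"
  defines "Z \<equiv> \<lambda>n \<omega>. \<Sum>m<n. \<rho> m \<omega> * (slope (\<theta>h m \<omega>) (\<theta>h m \<omega> - \<theta>s) - X m \<omega>) - c * (\<rho> m \<omega> * X m \<omega>)\<^sup>2"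
  shows "{\<omega> \<in> space M. \<exists>n\<le>N. \<Lambda> \<le> Z n \<omega>} \<in> sets M"
    and "prob {\<omega> \<in> space M. \<exists>n\<le>N. \<Lambda> \<le> Z n \<omega>} \<le> exp (- \<Lambda>)"
proof -
  interpret D: prob_space D by (rule prob_space_D)
  define Y where "Y n \<omega> x = \<rho> n \<omega> * (grad x (\<theta>h n \<omega>) \<bullet> (\<theta>h n \<omega> - \<theta>s))" for n \<omega> x
  define h where "h n \<omega> x = (\<integral>x. Y n \<omega> x \<partial>D) - Y n \<omega> x - c * (Y n \<omega> x)\<^sup>2" for n \<omega> x
  have Y_int: "(\<integral>x. Y n \<omega> x \<partial>D) = \<rho> n \<omega> * slope (\<theta>h n \<omega>) (\<theta>h n \<omega> - \<theta>s)" for n \<omega>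
    unfolding Y_def slope_def by simp
  have Y: "(\<lambda>z. Y n (fst z) (snd z)) \<in> borel_measurable (F n \<Otimes>\<^sub>M loss_space)" for n
    unfolding Y_def
    by (intro borel_measurable_times borel_measurable_inner borel_measurable_diff borel_measurable_const
        measurable_grad_joint measurable_snd measurable_compose[OF measurable_fst \<rho>]
        measurable_compose[OF measurable_fst \<theta>h])
  have Y': "(\<lambda>(\<omega>, x). Y n \<omega> x) \<in> borel_measurable (F n \<Otimes>\<^sub>M D)" for n
    unfolding case_prod_unfold measurable_cong_sets[OF sets_pair_measure_cong[OF refl sets_distr] refl]
    by (rule Y)
  have YI: "(\<lambda>\<omega>. \<integral>x. Y n \<omega> x \<partial>D) \<in> borel_measurable (F n)" for n
    by (rule D.borel_measurable_lebesgue_integral[OF Y'])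
  have "(\<lambda>z. h n (fst z) (snd z)) \<in> borel_measurable (F n \<Otimes>\<^sub>M loss_space)" for n
    unfolding h_def
    by (intro borel_measurable_diff borel_measurable_times borel_measurable_const borel_measurable_power Y
        measurable_compose[OF measurable_fst YI])
  then have h_meas: "(\<lambda>(\<omega>, x). h n \<omega> x) \<in> borel_measurable (F n \<Otimes>\<^sub>M loss_space)" for n
    unfolding case_prod_unfold .
  have h_le: "(\<integral>\<^sup>+x. ennreal (exp (h n \<omega> x)) \<partial>D) \<le> 1" if \<omega>: "\<omega> \<in> space M" for n \<omega>
  proof -
    have "AE x in D. \<bar>Y n \<omega> x\<bar> \<le> \<eta>"
    proof (cases "\<rho> n \<omega> = 0")
      case True
      then show ?thesis using \<eta> by (simp add: Y_def)
    next
      case False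
      note b = bound[OF \<omega> False]
      show ?thesis
        using AE_grad_inner_le[OF b[THEN conjunct1], of "\<theta>h n \<omega> - \<theta>s"]
      proof eventually_elim
        fix x assume "\<bar>grad x (\<theta>h n \<omega>) \<bullet> (\<theta>h n \<omega> - \<theta>s)\<bar> \<le> B * l1_norm (\<theta>h n \<omega> - \<theta>s)"
        then have "\<bar>\<rho> n \<omega>\<bar> * \<bar>grad x (\<theta>h n \<omega>) \<bullet> (\<theta>h n \<omega> - \<theta>s)\<bar> \<le> \<bar>\<rho> n \<omega>\<bar> * (B * l1_norm (\<theta>h n \<omega> - \<theta>s))"
          by (rule mult_left_mono) simp
        then show "\<bar>Y n \<omega> x\<bar> \<le> \<eta>"
          unfolding Y_def abs_mult using b[THEN conjunct2] by (rule order.trans)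
      qed
    qed
    moreover have "(\<lambda>x. Y n \<omega> x) \<in> borel_measurable D"
      using measurable_compose[OF measurable_Pair1'[of \<omega> "F n" loss_space] Y[of n]] \<omega> by simp
    ultimately show ?thesis
      unfolding h_def by (intro nn_integral_exp_deviation_le[OF prob_space_D _ _ c \<eta>])
  qed
  have "Z = (\<lambda>n \<omega>. \<Sum>m<n. h m \<omega> (loss (Suc m) \<omega>))"
    unfolding Z_def h_def Y_int by (intro ext sum.cong refl) (simp add: Y_def X_def algebra_simps)
  note Z = this
  show "{\<omega> \<in> space M. \<exists>n\<le>N. \<Lambda> \<le> Z n \<omega>} \<in> sets M"
    unfolding Z by (rule exponential_maximal_inequality(1)[OF h_meas h_le])
  show "prob {\<omega> \<in> space M. \<exists>n\<le>N. \<Lambda> \<le> Z n \<omega>} \<le> exp (- \<Lambda>)"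
    unfolding Z by (rule exponential_maximal_inequality(2)[OF h_meas h_le])
qed

text \<open>The prediction is a function of the past, so conditioning freezes it. The deterministic
  bound R makes the envelope for convex losses available.\<close>

lemma excess_risk_eq:
  assumes \<theta>h: "\<theta>h \<in> borel_measurable (F n)" and R: "\<And>\<omega>. \<omega> \<in> space M \<Longrightarrow> l1_norm (\<theta>h \<omega>) \<le> R"
  shows "AE \<omega> in M. excess_risk M loss \<theta>s (Suc n) \<theta>h \<omega> = risk (\<theta>h \<omega>) - risk \<theta>s"
proof -
  have "(\<lambda>z. (snd z, \<theta>h (fst z))) \<in> measurable (F n \<Otimes>\<^sub>M loss_space) (loss_space \<Otimes>\<^sub>M borel)"
    by (intro measurable_Pair measurable_snd measurable_compose[OF measurable_fst \<theta>h])
  from measurable_compose[OF this measurable_loss_eval_joint]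
  have meas: "(\<lambda>(\<omega>, x). x (\<theta>h \<omega>)) \<in> borel_measurable (F n \<Otimes>\<^sub>M loss_space)"
    unfolding case_prod_unfold by simp
  have "AE \<omega> in M. real_cond_exp M (F n) (\<lambda>\<omega>. loss (Suc n) \<omega> (\<theta>h \<omega>)) \<omega> = (\<integral>x. x (\<theta>h \<omega>) \<partial>D)"
  proof (rule real_cond_exp_past[OF meas])
    show "integrable D (\<lambda>x. 2 * \<bar>x 0\<bar> + (\<Sum>k\<in>UNIV. \<bar>x (R *\<^sub>R axis k 1)\<bar> + \<bar>x (- (R *\<^sub>R axis k 1))\<bar>))"
      by (intro Bochner_Integration.integrable_add integrable_mult_right integrable_abs
          Bochner_Integration.integrable_sum integrable_eval)
    show "\<bar>x (\<theta>h \<omega>)\<bar> \<le> 2 * \<bar>x 0\<bar> + (\<Sum>k\<in>UNIV. \<bar>x (R *\<^sub>R axis k 1)\<bar> + \<bar>x (- (R *\<^sub>R axis k 1))\<bar>)"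
      if "\<omega> \<in> space M" "x \<in> convex_losses" for \<omega> x
      by (rule abs_convex_loss_le[OF that(2) R[OF that(1)]])
  qed
  then show ?thesis
    by eventually_elim (use risk_eq_t[of "Suc n" \<theta>s] in \<open>simp add: excess_risk_def risk_def\<close>)
qed

end

section \<open>Runs with controlled deviations\<close>

lemma is_truncation_0:
  assumes "is_truncation d0 0 y"
  shows "y = 0"
  using assms by (auto simp: is_truncation_def vec_eq_iff)

lemma inner_in_convex_losses: "(\<lambda>x. g \<bullet> x) \<in> convex_losses" and inner_subgradient: "g \<in> subdifferential (\<lambda>x. g \<bullet> x) y"
proof -
  show sub: "g \<in> subdifferential (\<lambda>x. g \<bullet> x) y" for y
    by (simp add: subdifferential_def inner_diff_right)
  have "convex_on UNIV (\<lambda>x. g \<bullet> x)"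
    by (intro convex_onI) (simp_all add: inner_add_right)
  then show "(\<lambda>x. g \<bullet> x) \<in> convex_losses"
    using sub by (auto simp: convex_losses_def)
qed

context saew
begin

text \<open>The regret guarantee covers all losses with the given subgradients, in particular the
  linear ones x \<mapsto> g t \<bullet> x. These yield exactly the inner products that are compared
  with their conditional means.\<close>

lemma linear_regret:
  assumes pred: "\<And>n. s \<le> Suc n \<Longrightarrow> n \<le> m \<Longrightarrow> \<theta> n = S B s c (radius i) (map g [s..<Suc n])"
    and s: "1 \<le> s" "s \<le> Suc m" and y: "l1_norm (y - c) \<le> radius i"
  shows "(\<Sum>r=s..Suc m. g r \<bullet> (\<theta> (r - 1) - y))
           \<le> a * radius i * sqrt (\<Sum>r=s..Suc m. (infnorm (g r))\<^sup>2) + b * radius i * B"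
proof -
  let ?p = "\<lambda>t. S B s c (radius i) (map g [s..<t])"
  have "\<forall>f g. let pred = (\<lambda>t. S B s c (radius i) (map g [s..<t])) in
         (\<forall>t\<ge>s. f t \<in> convex_losses \<and> g t \<in> subdifferential (f t) (pred t)) \<longrightarrow>
         (\<forall>e\<ge>s. \<forall>\<theta>\<in>l1_cball c (radius i).
            (\<Sum>t=s..e. f t (pred t) - f t \<theta>)
              \<le> a * radius i * sqrt (\<Sum>t=s..e. (infnorm (g t))\<^sup>2) + b * radius i * B)"
    using regret B s(1) radius_pos[of i] unfolding regret_bound_def by blast
  from this[rule_format, of g "\<lambda>t x. g t \<bullet> x"] have
    "(\<Sum>t=s..Suc m. g t \<bullet> ?p t - g t \<bullet> y)
       \<le> a * radius i * sqrt (\<Sum>t=s..Suc m. (infnorm (g t))\<^sup>2) + b * radius i * B"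
    using s(2) y inner_in_convex_losses inner_subgradient unfolding Let_def l1_cball_def by blast
  also have "(\<Sum>t=s..Suc m. g t \<bullet> ?p t - g t \<bullet> y) = (\<Sum>r=s..Suc m. g r \<bullet> (\<theta> (r - 1) - y))"
  proof (rule sum.cong[OF refl])
    fix r assume r: "r \<in> {s..Suc m}"
    then have "\<theta> (r - 1) = ?p r"
      using pred[of "r - 1"] s(1) by (cases r) auto
    then show "g r \<bullet> ?p r - g r \<bullet> y = g r \<bullet> (\<theta> (r - 1) - y)"
      by (simp only: inner_diff_right)
  qed
  finally show ?thesis .
qed

end

locale saew_run_path = saew +
  fixes g \<theta> :: "nat \<Rightarrow> real ^ 'a" and c \<theta>a :: "nat \<Rightarrow> real ^ 'a"
  assumes \<theta>a_0: "\<theta>a 0 = 0"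
    and center: "\<And>n i s. sess g n = (i, s) \<Longrightarrow> is_truncation d0 (\<theta>a (s - 1)) (c i)"
    and prediction: "\<And>n i s. sess g n = (i, s) \<Longrightarrow> \<theta> n = S B s (c i) (radius i) (map g [s..<Suc n])"
    and average: "\<And>n i s. sess g n = (i, s) \<Longrightarrow>
       \<theta>a (Suc n) = (1 / real (Suc n - s + 1)) *\<^sub>R (\<Sum>r=s..Suc n. \<theta> (r - 1))"
begin

lemma prediction_ball:
  assumes "sess g n = (i, s)"
  shows "l1_norm (\<theta> n - c i) \<le> radius i"
proof -
  have "1 \<le> s" using sess_start[of g n] assms by simp
  then have "S B s (c i) (radius i) (map g [s..<Suc n]) \<in> l1_cball (c i) (radius i)"
    using regret B radius_pos[of i] unfolding regret_bound_def by blast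
  then show ?thesis unfolding prediction[OF assms] l1_cball_def by simp
qed

lemma center_le:
  assumes n: "sess g n = (i, s)" and "1 < s"
    and C: "\<And>r. sess g r = sess g (s - 2) \<Longrightarrow> r < n \<Longrightarrow> l1_norm (\<theta> r) \<le> C"
  shows "l1_norm (c i) \<le> C"
proof -
  obtain m where s: "s = Suc (Suc m)" using that[of "s - 2"] assms(2) by simp
  obtain j s' where m: "sess g m = (j, s')" by force
  have s': "1 \<le> s'" "s' \<le> Suc m" using sess_start[of g m] m by simp_all
  have "s \<le> Suc n" using sess_start[of g n] n by simp
  then have mn: "m < n" using s by simp
  have "l1_norm (c i) \<le> l1_norm (\<theta>a (Suc m))"
    using l1_norm_truncation_le[OF center[OF n]] s by simp
  also have "\<dots> \<le> C"
    unfolding average[OF m]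
  proof (rule l1_norm_average)
    fix r assume r: "r \<in> {s'..Suc m}"
    then have "sess g (r - 1) = (j, s')" using s'(1) by (intro sess_same[OF m]) auto
    then show "l1_norm (\<theta> (r - 1)) \<le> C" using r mn m s by (intro C) auto
  qed (rule s')
  finally show ?thesis .
qed

lemma center_first:
  assumes n: "sess g n = (i, s)" and "\<not> 1 < s"
  shows "c i = 0" "i = 0"
  using center[OF n] assms(2) \<theta>a_0 is_truncation_0 sess_first[OF n] by auto

text \<open>Each prediction lies within U of its centre, and a centre is 0 or a truncated average of
  earlier predictions. The bound is crude but holds on every run, also outside the good event, where
  the conditional expectations must be identified as well.\<close>

lemma prediction_le: "l1_norm (\<theta> n) \<le> U * (real n + 1)"
proof (induction n rule: less_induct)
  case (less n)
  obtain i s where n: "sess g n = (i, s)" by force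
  have "l1_norm (c i) \<le> U * real n"
  proof (cases "1 < s")
    case True
    show ?thesis
    proof (rule center_le[OF n True])
      fix r assume "r < n"
      then have "U * (real r + 1) \<le> U * real n" using U by (intro mult_left_mono) auto
      then show "l1_norm (\<theta> r) \<le> U * real n" using less.IH[OF \<open>r < n\<close>] by linarith
    qed
  next
    case False
    then show ?thesis using center_first[OF n] U by simp
  qed
  moreover have "l1_norm (\<theta> n) \<le> l1_norm (\<theta> n - c i) + l1_norm (c i)"
    using l1_norm_triangle[of "\<theta> n - c i" "c i"] by simp
  ultimately show ?case
    using prediction_ball[OF n] radius_le_U[of i] by (simp add: algebra_simps)
qed

end

text \<open>
  A run along which the deviation inequalities hold. The guard in \<open>deviation\<close> is predictable; by
  \<open>path_invariant\<close> below it is true in all rounds.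
\<close>

locale saew_good_path = saew_run_path +
  fixes \<theta>s :: "real ^ 'a" and mean :: "nat \<Rightarrow> real" and T :: nat
  assumes sparse: "l0_norm \<theta>s \<le> d0" and \<theta>s_le: "l1_norm \<theta>s \<le> U"
    and gradient_le: "\<And>n. n < T \<Longrightarrow> l1_norm (\<theta> n) \<le> 2 * U \<Longrightarrow> infnorm (g (Suc n)) \<le> B"
    and mean_ge: "\<And>n. n < T \<Longrightarrow> l1_norm (\<theta> n) \<le> 2 * U \<Longrightarrow> 2 * \<alpha> * (norm (\<theta> n - \<theta>s))\<^sup>2 \<le> mean n"
    and deviation: "\<And>i k n. i \<le> T \<Longrightarrow> k \<le> T \<Longrightarrow> n \<le> T \<Longrightarrow>
      (\<Sum>m<n. if fst (sess g m) = i \<and> l1_norm (\<theta> m) \<le> 2 * U \<and> l1_norm (\<theta> m - \<theta>s) \<le> 2 * radius i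
         then rate k / (2 * radius i * B) * (mean m - g (Suc m) \<bullet> (\<theta> m - \<theta>s))
           - curv k * (rate k / (2 * radius i * B) * (g (Suc m) \<bullet> (\<theta> m - \<theta>s)))\<^sup>2
         else 0)
      \<le> penalty k - ln (\<delta> / (real i + 2)\<^sup>2)"
begin

text \<open>The preceding session takes at least 63 * 2^(i/2) \<ge> i rounds. Hence a union bound
  over the indices up to T covers every session reached.\<close>

lemma session_index_le:
  assumes "sess g m = (j, s)" "m < T" "acc g j s (Suc m) \<le> radius i" "j < i"
  shows "i \<le> T"
proof -
  have s: "1 \<le> s" "s \<le> Suc m" using sess_start[of g m] assms(1) by simp_all
  have "1 + real i / 2 * ln 2 \<le> exp (real i / 2 * ln 2)" by (rule exp_ge_add_one_self)
  then have "1 + real i / 2 * ln 2 \<le> 2 powr (real i / 2)" by (simp add: powr_def)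
  moreover have "real i / 2 * (2/3) \<le> real i / 2 * ln 2"
    using ln2_ge_two_thirds by (intro mult_left_mono) auto
  ultimately have "real i / 3 \<le> 2 powr (real i / 2)" by linarith
  moreover have "45 * (14/10) * 2 powr (real i / 2) \<le> 45 * (b + 14/10) * 2 powr (real i / 2)"
    using b by (intro mult_right_mono) auto
  ultimately have "real i \<le> real (Suc m - s + 1)"
    using session_length_ge(1)[OF s(2) assms(3,4)] by linarith
  also have "\<dots> \<le> real T" using s assms(2) by simp
  finally show ?thesis by simp
qed

text \<open>The induction step of the invariant: the curvature summed over a completed session
  controls its average, truncation passes to the 1-norm, and the constants meet those of
  \<open>acc_sq\<close>. The guard conditions enter as \<open>inv\<close>, for the rounds of this
  session only.\<close>

lemma session_center:
  assumes m: "sess g m = (j, s)" "m < T" and stop: "acc g j s (Suc m) \<le> radius i" "j < i"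
    and y: "is_truncation d0 (\<theta>a (Suc m)) y"
    and inv: "\<And>r. sess g r = (j, s) \<Longrightarrow> r \<le> m \<Longrightarrow>
      l1_norm (\<theta> r) \<le> 2 * U \<and> l1_norm (\<theta> r - \<theta>s) \<le> 2 * radius j"
    and cj: "l1_norm (\<theta>s - c j) \<le> radius j"
  shows "l1_norm (y - \<theta>s) \<le> acc g j s (Suc m)"
proof -
  define r where "r = radius j"
  define nn where "nn = Suc m - s + 1"
  define n where "n = real nn"
  define V where "V = (\<Sum>t=s..Suc m. (infnorm (g t))\<^sup>2)"
  define v where "v = V / B\<^sup>2"
  define X where "X t = g t \<bullet> (\<theta> (t - 1) - \<theta>s)" for t
  define p where "p = - ln (\<delta> / (real j + 2)\<^sup>2)"
  define L where "L = p + ln (1 + 1/2 * ln (n / 2))"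
  define W where "W = (\<Sum>t=s..Suc m. mean (t - 1) - X t)"
  define Err where "Err = saew_err a b B \<delta> j g s (Suc m)"
  have r: "r > 0" by (simp add: r_def radius_pos)
  have s: "1 \<le> s" "s \<le> Suc m" using sess_start[of g m] m(1) by simp_all
  have n: "n \<ge> 89" unfolding n_def nn_def by (rule session_length_ge(2)[OF s(2) stop])
  have nT: "nn \<le> T" using s m(2) by (simp add: nn_def)
  have jT: "j \<le> T" using session_index_le[OF m stop] stop(2) by simp
  have round: "sess g (t - 1) = (j, s)" "t - 1 < T" "Suc (t - 1) = t" "t - 1 \<le> m"
    if "t \<in> {s..Suc m}" for t
    using that s m(2) by (auto intro!: sess_same[OF m(1)])
  have bounds: "l1_norm (\<theta> (t - 1)) \<le> 2 * U" "l1_norm (\<theta> (t - 1) - \<theta>s) \<le> 2 * r" "infnorm (g t) \<le> B"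
    if "t \<in> {s..Suc m}" for t
    using inv[OF round(1,4)[OF that]] gradient_le[OF round(2)[OF that]] round(3)[OF that] by (auto simp: r_def)
  have L_eq: "L = saew_log \<delta> j nn"
    by (simp add: L_def p_def n_def saew_log_def)
  have L_pos: "L \<ge> 9/10" unfolding L_eq by (rule saew_log_ge) (simp add: nn_def)
  have V: "0 \<le> V" "V \<le> n * B\<^sup>2"
  proof -
    show "0 \<le> V" by (simp add: V_def sum_nonneg)
    have "V \<le> (\<Sum>t=s..Suc m. B\<^sup>2)"
      unfolding V_def using bounds(3) by (intro sum_mono power_mono infnorm_pos_le) auto
    also have "\<dots> = n * B\<^sup>2" using s by (simp add: n_def nn_def Suc_diff_le)
    finally show "V \<le> n * B\<^sup>2" .
  qed
  have v: "0 \<le> v" "v \<le> n" using V B by (simp_all add: v_def pos_divide_le_eq)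
  have sqrtV: "sqrt V = B * sqrt v" using B V by (simp add: v_def real_sqrt_divide)
  have p: "p \<ge> ln 4"
  proof -
    have "\<delta> / (real j + 2)\<^sup>2 \<le> 1 / 4"
      using \<delta> power_mono[of 2 "real j + 2" 2] by (simp add: field_simps)
    then have "ln (\<delta> / (real j + 2)\<^sup>2) \<le> ln (1 / 4)" using \<delta> by (subst ln_le_cancel_iff) auto
    then show ?thesis by (simp add: p_def ln_div)
  qed
  have grid: "W / (2 * r * B) \<le> curv k * rate k * v + (p + penalty k) / rate k" if "real k \<le> ln n" for k
  proof -
    define \<kappa> where "\<kappa> = rate k / (2 * r * B)"
    \<comment> \<open>The rates with k \<le> ln n lie in the range k \<le> T of the union
      bound.\<close>
    have "real k \<le> n" using that ln_le_minus_one[of n] n by linarith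
    then have "k \<le> T" using nT by (simp add: n_def)
    have "(\<Sum>q<Suc m. if fst (sess g q) = j \<and> l1_norm (\<theta> q) \<le> 2 * U \<and> l1_norm (\<theta> q - \<theta>s) \<le> 2 * radius j
         then rate k / (2 * radius j * B) * (mean q - g (Suc q) \<bullet> (\<theta> q - \<theta>s))
           - curv k * (rate k / (2 * radius j * B) * (g (Suc q) \<bullet> (\<theta> q - \<theta>s)))\<^sup>2
         else 0) = (\<Sum>t=s..Suc m. \<kappa> * (mean (t - 1) - X t) - curv k * (\<kappa> * X t)\<^sup>2)"
      (is "?lhs = ?rhs")
    proof -
      \<comment> \<open>By \<open>inv\<close> the guard holds throughout the session, so the guarded
        sum runs over exactly its rounds, with indices shifted by one.\<close>
      have eq: "{q \<in> {..<Suc m}. fst (sess g q) = j \<and> l1_norm (\<theta> q) \<le> 2 * U \<and> l1_norm (\<theta> q - \<theta>s) \<le> 2 * radius j}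
          = (\<lambda>t. t - 1) ` {s..Suc m}"
      proof (intro equalityI subsetI)
        fix q assume q: "q \<in> {q \<in> {..<Suc m}. fst (sess g q) = j \<and> l1_norm (\<theta> q) \<le> 2 * U \<and> l1_norm (\<theta> q - \<theta>s) \<le> 2 * radius j}"
        then have "sess g q = (j, s)" using sess_fst_inj[of q m g] m(1) by simp
        then have "s \<le> Suc q" using sess_start[of g q] by simp
        then show "q \<in> (\<lambda>t. t - 1) ` {s..Suc m}" using q by (intro image_eqI[of _ _ "Suc q"]) auto
      next
        fix q assume "q \<in> (\<lambda>t. t - 1) ` {s..Suc m}"
        then obtain t where t: "t \<in> {s..Suc m}" "q = t - 1" by blast
        then show "q \<in> {q \<in> {..<Suc m}. fst (sess g q) = j \<and> l1_norm (\<theta> q) \<le> 2 * U \<and> l1_norm (\<theta> q - \<theta>s) \<le> 2 * radius j}"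
          using round[OF t(1)] bounds[OF t(1)] by (simp add: r_def)
      qed
      have "?lhs = (\<Sum>q\<in>(\<lambda>t. t - 1) ` {s..Suc m}. \<kappa> * (mean q - g (Suc q) \<bullet> (\<theta> q - \<theta>s))
           - curv k * (\<kappa> * (g (Suc q) \<bullet> (\<theta> q - \<theta>s)))\<^sup>2)"
        unfolding eq[symmetric] \<kappa>_def r_def by (rule sum.inter_filter[symmetric]) simp
      also have "\<dots> = ?rhs"
        using s(1) by (subst sum.reindex) (auto simp: X_def inj_on_def intro!: sum.cong)
      finally show ?thesis .
    qed
    also have "\<dots> = \<kappa> * W - curv k * \<kappa>\<^sup>2 * (\<Sum>t=s..Suc m. (X t)\<^sup>2)"
      unfolding W_def sum_distrib_left sum_subtractf[of "\<lambda>t. \<kappa> * (mean (t - 1) - X t)"]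
      by (simp only: power_mult_distrib mult.assoc)
    finally have "\<kappa> * W - curv k * \<kappa>\<^sup>2 * (\<Sum>t=s..Suc m. (X t)\<^sup>2) \<le> penalty k + p"
      using deviation[OF jT \<open>k \<le> T\<close>, of "Suc m"] m(2) by (simp add: p_def)
    moreover have "curv k * \<kappa>\<^sup>2 * (\<Sum>t=s..Suc m. (X t)\<^sup>2) \<le> curv k * \<kappa>\<^sup>2 * ((2 * r)\<^sup>2 * V)"
    proof (rule mult_left_mono)
      have "(X t)\<^sup>2 \<le> (2 * r)\<^sup>2 * (infnorm (g t))\<^sup>2" if t: "t \<in> {s..Suc m}" for t
      proof -
        have "\<bar>X t\<bar> \<le> infnorm (g t) * l1_norm (\<theta> (t - 1) - \<theta>s)"
          unfolding X_def by (rule abs_inner_le_infnorm_l1_norm)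
        also have "\<dots> \<le> infnorm (g t) * (2 * r)"
          using bounds(2)[OF t] by (intro mult_left_mono infnorm_pos_le)
        finally have "\<bar>X t\<bar>\<^sup>2 \<le> (infnorm (g t) * (2 * r))\<^sup>2" by (intro power_mono) auto
        then show ?thesis by (simp add: power_mult_distrib mult.commute)
      qed
      then show "(\<Sum>t=s..Suc m. (X t)\<^sup>2) \<le> (2 * r)\<^sup>2 * V"
        unfolding V_def sum_distrib_left by (rule sum_mono)
    qed (use curv_ge[of k] in simp)
    moreover have "\<kappa>\<^sup>2 * ((2 * r)\<^sup>2 * V) = (rate k)\<^sup>2 * v"
      using r B by (simp add: \<kappa>_def v_def power_divide power_mult_distrib)
    ultimately have "\<kappa> * W \<le> curv k * ((rate k)\<^sup>2 * v) + (p + penalty k)"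
      by (simp add: mult.assoc)
    moreover have "\<kappa> * W = rate k * (W / (2 * r * B))" by (simp add: \<kappa>_def)
    moreover have "rate k * (curv k * rate k * v + (p + penalty k) / rate k) =
        curv k * ((rate k)\<^sup>2 * v) + (p + penalty k)"
    proof -
      have "rate k * ((p + penalty k) / rate k) = p + penalty k" using rate_pos[of k] by simp
      moreover have "rate k * (curv k * rate k * v) = curv k * ((rate k)\<^sup>2 * v)"
        by (simp add: power2_eq_square)
      ultimately show ?thesis unfolding distrib_left by (rule arg_cong2[of _ _ _ _ "(+)", rotated])
    qed
    ultimately have "rate k * (W / (2 * r * B)) \<le> rate k * (curv k * rate k * v + (p + penalty k) / rate k)"
      by linarith
    then show ?thesis using rate_pos[of k] by (rule mult_left_le_imp_le)
  qed
  have "W / (2 * r * B) \<le> 16/10 * sqrt 2 * sqrt (L * v) + 8/10 + 16/10 * L"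
    unfolding L_def by (rule grid_bound[OF p n v grid])
  then have W: "W \<le> 2 * r * B * (16/10 * sqrt 2 * sqrt (L * v) + 8/10 + 16/10 * L)"
    using r B by (simp add: pos_divide_le_eq mult_ac)
  have X: "(\<Sum>t=s..Suc m. X t) \<le> a * r * sqrt V + b * r * B"
    unfolding X_def V_def r_def
  proof (rule linear_regret[OF _ s cj])
    fix q assume "s \<le> Suc q" "q \<le> m"
    then show "\<theta> q = S B s (c j) (radius j) (map g [s..<Suc q])"
      by (intro prediction sess_same[OF m(1)])
  qed
  have Err: "Err = (a + sqrt 2 * sqrt L) * sqrt V + (b + 1/2 + L) * B"
    by (simp add: Err_def saew_err_def L_eq V_def nn_def)
  have "(\<Sum>t=s..Suc m. mean (t - 1)) = (\<Sum>t=s..Suc m. X t) + W"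
    by (simp only: W_def sum_subtractf)
  also have "\<dots> \<le> (a * r * sqrt V + b * r * B) +
      2 * r * B * (16/10 * sqrt 2 * sqrt (L * v) + 8/10 + 16/10 * L)"
    using X W by linarith
  \<comment> \<open>The constants of \<open>grid_bound\<close> are 16/10 times those of
    \<open>saew_err\<close>, including 8/10 = 16/10 * 1/2, and the diameter contributes the factor
    2. The regret terms occur once on the left but 32/10 times in \<open>32/10 * r * Err\<close>,
    whence the surplus 22/10.\<close>
  also have "\<dots> = 32/10 * r * Err - 22/10 * (r * (a * sqrt V + b * B))"
    unfolding Err sqrtV using L_pos by (simp add: real_sqrt_mult algebra_simps)
  also have "\<dots> \<le> 32/10 * r * Err"
    using r a b B V(1) by simp
  finally have mean_le: "(\<Sum>t=s..Suc m. mean (t - 1)) \<le> 32/10 * r * Err" .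
  have "(\<Sum>t=s..Suc m. 2 * \<alpha> * (norm (\<theta> (t - 1) - \<theta>s))\<^sup>2) \<le> (\<Sum>t=s..Suc m. mean (t - 1))"
    using bounds(1) round(2) by (intro sum_mono mean_ge) auto
  then have "2 * \<alpha> * (\<Sum>t=s..Suc m. (norm (\<theta> (t - 1) - \<theta>s))\<^sup>2) \<le> 32/10 * r * Err"
    using mean_le by (simp only: sum_distrib_left)
  moreover have "2 * \<alpha> * (n * (norm (\<theta>a (Suc m) - \<theta>s))\<^sup>2) \<le> 2 * \<alpha> * (\<Sum>t=s..Suc m. (norm (\<theta> (t - 1) - \<theta>s))\<^sup>2)"
    unfolding average[OF m(1)] n_def nn_def
    using \<alpha> s by (intro mult_left_mono average_norm_le) auto
  ultimately have "2 * \<alpha> * (n * (norm (\<theta>a (Suc m) - \<theta>s))\<^sup>2) \<le> 32/10 * r * Err" by linarith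
  then have norm_le: "(norm (\<theta>a (Suc m) - \<theta>s))\<^sup>2 \<le> 16/10 * r * Err / (\<alpha> * n)"
    using \<alpha> n by (simp add: pos_le_divide_eq mult_ac)
  have "(l1_norm (y - \<theta>s))\<^sup>2 \<le> 5 * real d0 * (norm (\<theta>a (Suc m) - \<theta>s))\<^sup>2"
    by (rule l1_norm_truncation_sparse[OF y sparse])
  also have "\<dots> \<le> 5 * real d0 * (16/10 * r * Err / (\<alpha> * n))"
    using norm_le by (rule mult_left_mono) simp
  also have "\<dots> = (acc g j s (Suc m))\<^sup>2"
    unfolding acc_sq[OF s(2)] by (simp add: r_def Err_def n_def nn_def)
  finally show ?thesis
    by (rule power2_le_imp_le) (rule less_imp_le[OF acc_pos[OF s(2)]])
qed

text \<open>Strong induction over the rounds, as the centre of a session rests on all rounds of the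
  preceding one. The last clause serves session 1: there U + 2 * radius 1 exceeds 2 * U, so
  closeness to \<theta>s is not enough, and the centre is bounded instead as a truncated average of
  predictions of session 0. From session 2 on, 2 * radius i \<le> U.\<close>

lemma path_invariant:
  assumes "n < T" "sess g n = (i, s)"
  shows "l1_norm (\<theta> n) \<le> 2 * U \<and> l1_norm (\<theta> n - \<theta>s) \<le> 2 * radius i \<and>
    l1_norm (\<theta>s - c i) \<le> radius i \<and> (i = 0 \<longrightarrow> l1_norm (\<theta> n) \<le> U)"
  using assms
proof (induction n arbitrary: i s rule: less_induct)
  case (less n)
  note n = less.prems(2)
  have ball: "l1_norm (\<theta> n - c i) \<le> radius i" by (rule prediction_ball[OF n])
  show ?case
  proof (cases "1 < s")
    case False
    then have "c i = 0" "i = 0" using center_first[OF n] by auto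
    then show ?thesis
      using ball \<theta>s_le U l1_norm_triangle_sub[of "\<theta> n" \<theta>s 0] l1_norm_minus_commute[of 0 \<theta>s]
      by (auto intro: order.trans[OF l1_norm_triangle_sub[of _ _ 0]])
  next
    case True
    obtain m where s: "s = Suc (Suc m)" using that[of "s - 2"] True by simp
    obtain j s' where m: "sess g m = (j, s')" by force
    have new: "j < i" "acc g j s' (Suc m) \<le> radius i"
      using sess_new[OF n True, of j s'] m s by simp_all
    have "s \<le> Suc n" using sess_start[of g n] n by simp
    then have mn: "m < n" using s by simp
    have old: "l1_norm (\<theta> r) \<le> 2 * U \<and> l1_norm (\<theta> r - \<theta>s) \<le> 2 * radius j \<and>
        l1_norm (\<theta>s - c j) \<le> radius j \<and> (j = 0 \<longrightarrow> l1_norm (\<theta> r) \<le> U)"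
      if "sess g r = (j, s')" "r \<le> m" for r
      using less.IH[of r j s'] that mn less.prems(1) by simp
    have "l1_norm (c i - \<theta>s) \<le> acc g j s' (Suc m)"
    proof (rule session_center[OF m _ new(2,1)])
      show "m < T" using mn less.prems(1) by simp
      show "is_truncation d0 (\<theta>a (Suc m)) (c i)" using center[OF n] s by simp
    qed (use old m in auto)
    then have cs: "l1_norm (c i - \<theta>s) \<le> radius i" using new(2) by linarith
    have diff: "l1_norm (\<theta> n - \<theta>s) \<le> 2 * radius i"
      using l1_norm_triangle_sub[of "\<theta> n" \<theta>s "c i"] ball cs by simp
    have "l1_norm (\<theta> n) \<le> 2 * U"
    proof (cases "i = 1")
      case True
      then have "j = 0" using new(1) by simp
      have "l1_norm (c i) \<le> U"
      proof (rule center_le[OF n \<open>1 < s\<close>])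
        fix r assume r: "sess g r = sess g (s - 2)" "r < n"
        then have r': "sess g r = (j, s')" using m s by simp
        show "l1_norm (\<theta> r) \<le> U"
          using less.IH[OF r(2) _ r'] r(2) less.prems(1) \<open>j = 0\<close> by simp
      qed
      then show ?thesis
        using l1_norm_triangle[of "\<theta> n - c i" "c i"] ball radius_le_U[of i] by simp
    next
      case False
      then have "radius i \<le> radius 2" using new(1) by (intro radius_mono) simp
      also have "radius 2 = U / 2" by (simp add: radius_def powr_minus inverse_eq_divide)
      finally show ?thesis
        using l1_norm_triangle[of "\<theta> n - \<theta>s" \<theta>s] diff \<theta>s_le by simp
    qed
    then show ?thesis
      using diff cs new(1) by (simp add: l1_norm_minus_commute)
  qed
qed

end

section \<open>Summation over the sessions\<close>

lemma sum_geometric_le: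
  fixes q :: real
  assumes "0 \<le> q" "q < 1"
  shows "(\<Sum>i\<le>J. q ^ i) \<le> 1 / (1 - q)"
proof -
  have "(\<Sum>i\<le>J. q ^ i) = (1 - q ^ Suc J) / (1 - q)"
    using assms sum_gp0[of q J] by simp
  also have "\<dots> \<le> 1 / (1 - q)"
    using assms by (intro divide_right_mono) auto
  finally show ?thesis .
qed

text \<open>This is 2^(-1/4). Radii decay like the powers of its square, while terms of order sqrt
  (radius i) decay like the powers of \<open>root4\<close> itself.\<close>

definition root4 :: real where
  "root4 = 1 / sqrt (sqrt 2)"

lemma root4_sq: "root4\<^sup>2 = 1 / sqrt 2"
  by (simp add: root4_def power_divide)

lemma sqrt_half_le: "1 / sqrt 2 \<le> 70722/100000"
proof -
  have "1414/1000 \<le> sqrt 2" by (rule real_le_rsqrt) (simp add: power2_eq_square)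
  then have "1 / sqrt 2 \<le> 1 / (1414/1000)" by (intro divide_left_mono) auto
  then show ?thesis by simp
qed

lemma root4_le: "0 \<le> root4" "root4 \<le> 841/1000"
proof -
  show "0 \<le> root4" by (simp add: root4_def)
  have "root4\<^sup>2 \<le> (841/1000)\<^sup>2"
    unfolding root4_sq using sqrt_half_le by (simp add: power2_eq_square)
  then show "root4 \<le> 841/1000" by (rule power2_le_imp_le) simp
qed

lemma sum_root4: "(\<Sum>i\<le>J. root4 ^ i) \<le> 63/10"
proof -
  have "1 / (1 - root4) \<le> 1 / (1 - 841/1000)"
    using root4_le by (intro divide_left_mono) auto
  then show ?thesis using sum_geometric_le[of root4 J] root4_le by simp
qed

lemma sum_sqrt_half: "(\<Sum>i\<le>J. (root4\<^sup>2) ^ i) \<le> 342/100"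
proof -
  have r: "0 \<le> root4\<^sup>2" "root4\<^sup>2 \<le> 70722/100000" unfolding root4_sq using sqrt_half_le by auto
  then have "1 / (1 - root4\<^sup>2) \<le> 1 / (1 - 70722/100000)"
    by (intro divide_left_mono) auto
  then show ?thesis using sum_geometric_le[of "root4\<^sup>2" J] r by simp
qed

text \<open>
  Here \<open>z ^ 2\<close> measures the size of \<open>b'\<close>; the length of the sessions makes it small unless \<open>b\<close> is
  large, in which case the number of sessions is small.
\<close>

lemma session_count:
  fixes J m z u :: real
  assumes J: "0 \<le> J" and z: "0 \<le> z" and u: "0 \<le> u" "u \<le> 1/256"
    and cases: "2 * m \<ge> J + 11 \<and> z \<le> 33/100 \<or> 2 * m \<ge> J + 24"
  defines "Mz \<equiv> 2 * m + 58/100 * z\<^sup>2"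
  shows "J + 1 + 63/10 * (z + u) \<le> Mz"
    and "J + 1 + 126/10 * (z + u) + 342/100 * (z + u)\<^sup>2 \<le> Mz\<^sup>2 / 8"
proof -
  define y where "y = z + u"
  have "J + 1 + 63/10 * y \<le> Mz \<and> J + 1 + 126/10 * y + 342/100 * y\<^sup>2 \<le> Mz\<^sup>2 / 8"
    using cases
  proof
    assume *: "2 * m \<ge> J + 11 \<and> z \<le> 33/100"
    have zu: "0 \<le> y" "y \<le> 34/100" using * z u by (simp_all add: y_def)
    have "y\<^sup>2 \<le> (34/100)\<^sup>2" using zu by (intro power_mono) auto
    then have zu2: "y\<^sup>2 \<le> 12/100" by (simp add: power2_eq_square)
    have "0 \<le> z\<^sup>2" by simp
    then have M: "J + 11 \<le> Mz" using * unfolding Mz_def by linarith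
    then have "(J + 11)\<^sup>2 \<le> Mz\<^sup>2" using J by (intro power_mono) auto
    moreover have "(J + 11)\<^sup>2 = J\<^sup>2 + 22 * J + 121" by (simp add: power2_eq_square algebra_simps)
    moreover have "0 \<le> J\<^sup>2" by simp
    ultimately have "22 * J + 121 \<le> Mz\<^sup>2" by linarith
    with M zu zu2 J show ?thesis by (intro conjI; linarith)
  next
    assume *: "2 * m \<ge> J + 24"
    define w where "w = z\<^sup>2"
    have w: "0 \<le> w" by (simp add: w_def)
    have M: "J + 24 + 58/100 * w \<le> Mz" using * by (simp add: Mz_def w_def)
    have sq: "2 * t * z \<le> w + t\<^sup>2" for t
      using zero_le_power2[of "z - t"] by (simp add: w_def power2_eq_square algebra_simps)
    \<comment> \<open>The choices t = 5 and t = 630/116 trade the linear terms in z for multiples of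
      w; the second one gives exactly 58/100 * w, the term contained in Mz.\<close>
    have z6: "126/10 * z \<le> 63/50 * w + 315/10"
      using sq[of 5] by simp
    have z5: "63/10 * z \<le> 58/100 * w + 18"
      using sq[of "630/116"] by (simp add: power2_eq_square)
    have "(J + 24 + 58/100 * w)\<^sup>2 \<le> Mz\<^sup>2" using M J w by (intro power_mono) auto
    moreover have "(J + 24 + 58/100 * w)\<^sup>2 = J\<^sup>2 + 576 + 3364/10000 * w\<^sup>2 + 48 * J + 116/100 * (J * w) + 2784/100 * w"
      by (simp add: power2_eq_square algebra_simps)
    moreover have "0 \<le> J\<^sup>2" "0 \<le> J * w" using J w by auto
    moreover have "50 * w - 625 \<le> w\<^sup>2"
      using zero_le_power2[of "w - 25"] by (simp add: power2_eq_square algebra_simps)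
    ultimately have Mz2: "48 * J + 365 + 44 * w \<le> Mz\<^sup>2"
      using w by linarith
    have "y\<^sup>2 \<le> w + 1/100 * z + 1/1000"
    proof -
      have "u * z \<le> 1/256 * z" using u z by (intro mult_right_mono) auto
      moreover have "u * u \<le> 1/256 * (1/256)" using u by (intro mult_mono) auto
      moreover have "y\<^sup>2 = w + 2 * (u * z) + u * u" by (simp add: y_def w_def power2_eq_square algebra_simps)
      ultimately show ?thesis using z by linarith
    qed
    moreover have "y \<le> z + 1/256" using u by (simp add: y_def)
    ultimately show ?thesis using M Mz2 z5 z6 z w J by (intro conjI; linarith)
  qed
  then show "J + 1 + 63/10 * (z + u) \<le> Mz"
    "J + 1 + 126/10 * (z + u) + 342/100 * (z + u)\<^sup>2 \<le> Mz\<^sup>2 / 8" by (auto simp: y_def)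
qed

text \<open>The larger root of x^2 = A * x + A * W is at most A + sqrt (A * W): beyond this point x
  * (x - A) already exceeds A * W.\<close>

lemma sqrt_bound_from_quadratic:
  fixes x A W :: real
  assumes "x\<^sup>2 \<le> A * x + A * W" "0 \<le> A" "0 \<le> W"
  shows "x \<le> A + sqrt (A * W)"
proof (rule ccontr)
  define s where "s = sqrt (A * W)"
  have s: "0 \<le> s" "s\<^sup>2 = A * W" using assms by (simp_all add: s_def)
  assume "\<not> x \<le> A + sqrt (A * W)"
  then have x: "A + s < x" by (simp add: s_def)
  have "s * s < x * (x - A)"
  proof -
    have "s * s \<le> s * (x - A)" using x s by (intro mult_left_mono) auto
    also have "\<dots> < x * (x - A)"
      using x s assms(2) by (intro mult_strict_right_mono) (auto intro: le_less_trans)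
    finally show ?thesis .
  qed
  with s assms(1) show False by (simp add: power2_eq_square algebra_simps)
qed

text \<open>Cauchy-Schwarz, with squared radii summing to at most 2 * U^2, controls the regret;
  squared radii at most U^2 control the deviation. The value of \<nu> balances the two deviation
  terms, each being at most 2 * U * B * sqrt (\<Lambda> * T).\<close>

lemma first_bound:
  fixes U B a b \<Lambda> T :: real and n :: "nat \<Rightarrow> real"
  assumes pos: "0 < U" "0 < B" "0 \<le> a" "0 \<le> b" "0 < \<Lambda>" "0 < T"
    and n: "\<And>i. 0 \<le> n i" "(\<Sum>i\<le>J. n i) = T"
  defines "r \<equiv> \<lambda>i. U * (root4\<^sup>2) ^ i" and "\<nu> \<equiv> sqrt \<Lambda> / (2 * U * B * sqrt T)"
  shows "(\<Sum>i\<le>J. r i * (a * B * sqrt (n i) + b * B)) + \<Lambda> / \<nu> + \<nu> * (4 * B\<^sup>2 * (\<Sum>i\<le>J. (r i)\<^sup>2 * n i))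
    \<le> 4 * U * B * ((a + sqrt (2 * \<Lambda>)) * sqrt T + (b + 1/2 + \<Lambda>) + 1)"
proof -
  have q: "0 \<le> root4\<^sup>2" "(root4\<^sup>2)\<^sup>2 = 1/2" by (simp_all add: root4_sq power_divide)
  have r2: "(r i)\<^sup>2 = U\<^sup>2 * (1/2) ^ i" for i
  proof -
    have "((root4\<^sup>2) ^ i)\<^sup>2 = ((root4\<^sup>2)\<^sup>2) ^ i" by (simp only: power_mult[symmetric] mult_ac)
    then show ?thesis unfolding r_def power_mult_distrib q(2) by simp
  qed
  have r0: "0 \<le> r i" for i using pos q by (simp add: r_def)
  have sum_r: "(\<Sum>i\<le>J. r i) \<le> U * (342/100)"
    unfolding r_def sum_distrib_left[symmetric] using sum_sqrt_half[of J] pos by (intro mult_left_mono) auto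
  have "(\<Sum>i\<le>J. (r i)\<^sup>2) = U\<^sup>2 * (\<Sum>i\<le>J. (1/2) ^ i)" by (simp add: r2 sum_distrib_left)
  also have "\<dots> \<le> U\<^sup>2 * 2" using sum_geometric_le[of "1/2" J] by (intro mult_left_mono) auto
  finally have sum_r2: "(\<Sum>i\<le>J. (r i)\<^sup>2) \<le> U\<^sup>2 * 2" .
  have "(\<Sum>i\<le>J. r i * sqrt (n i))\<^sup>2 \<le> (\<Sum>i\<le>J. (r i)\<^sup>2) * (\<Sum>i\<le>J. (sqrt (n i))\<^sup>2)"
    by (rule Cauchy_Schwarz_ineq_sum)
  also have "(\<Sum>i\<le>J. (sqrt (n i))\<^sup>2) = T" using n by simp
  also have "(\<Sum>i\<le>J. (r i)\<^sup>2) * T \<le> U\<^sup>2 * 2 * T" using sum_r2 pos by (intro mult_right_mono) auto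
  also have "\<dots> \<le> (2 * U * sqrt T)\<^sup>2" using pos by (simp add: power_mult_distrib)
  finally have sum_rn: "(\<Sum>i\<le>J. r i * sqrt (n i)) \<le> 2 * U * sqrt T"
    by (rule power2_le_imp_le) (use pos in simp)
  have "(\<Sum>i\<le>J. (r i)\<^sup>2 * n i) \<le> (\<Sum>i\<le>J. U\<^sup>2 * n i)"
  proof (rule sum_mono)
    fix i
    have "(1/2 :: real) ^ i \<le> 1" by (rule power_le_one) auto
    then have "(r i)\<^sup>2 \<le> U\<^sup>2" unfolding r2 by (rule mult_left_le) simp
    then show "(r i)\<^sup>2 * n i \<le> U\<^sup>2 * n i" using n(1) by (rule mult_right_mono)
  qed
  also have "\<dots> = U\<^sup>2 * T" by (simp add: sum_distrib_left[symmetric] n(2))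
  finally have Q: "(\<Sum>i\<le>J. (r i)\<^sup>2 * n i) \<le> U\<^sup>2 * T" .
  have \<nu>: "0 < \<nu>" using pos by (simp add: \<nu>_def)
  define x where "x = sqrt \<Lambda>"
  define y where "y = sqrt T"
  have xy: "0 < x" "0 < y" "\<Lambda> = x\<^sup>2" "T = y\<^sup>2" using pos by (simp_all add: x_def y_def)
  have "\<Lambda> / \<nu> = 2 * U * B * (x * y)"
    using xy pos by (simp add: \<nu>_def x_def[symmetric] y_def[symmetric] power2_eq_square)
  moreover have "\<nu> * (4 * B\<^sup>2 * (\<Sum>i\<le>J. (r i)\<^sup>2 * n i)) \<le> \<nu> * (4 * B\<^sup>2 * (U\<^sup>2 * T))"
    using Q \<nu> by (intro mult_left_mono) auto
  moreover have "\<nu> * (4 * B\<^sup>2 * (U\<^sup>2 * T)) = 2 * U * B * (x * y)"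
    using xy pos by (simp add: \<nu>_def x_def[symmetric] y_def[symmetric] power2_eq_square)
  moreover have "(\<Sum>i\<le>J. r i * (a * B * sqrt (n i) + b * B)) =
      a * B * (\<Sum>i\<le>J. r i * sqrt (n i)) + b * B * (\<Sum>i\<le>J. r i)"
    by (simp add: sum_distrib_left sum.distrib[symmetric] algebra_simps)
  moreover have "a * B * (\<Sum>i\<le>J. r i * sqrt (n i)) \<le> a * B * (2 * U * y)"
    using sum_rn pos unfolding y_def by (intro mult_left_mono) auto
  moreover have "b * B * (\<Sum>i\<le>J. r i) \<le> b * B * (U * (342/100))"
    using sum_r pos by (intro mult_left_mono) auto
  ultimately have "(\<Sum>i\<le>J. r i * (a * B * sqrt (n i) + b * B)) + \<Lambda> / \<nu> + \<nu> * (4 * B\<^sup>2 * (\<Sum>i\<le>J. (r i)\<^sup>2 * n i))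
      \<le> a * B * (2 * U * y) + b * B * (U * (342/100)) + 4 * U * B * (x * y)"
    by linarith
  also have "\<dots> \<le> 4 * U * B * (a * y) + 4 * U * B * b + 4 * U * B * (x * y)"
  proof -
    have "0 \<le> U * B * (a * y)" "0 \<le> U * B * b" using pos xy by simp_all
    then show ?thesis by (simp add: algebra_simps)
  qed
  also have "\<dots> = 4 * U * B * (a * y + b + x * y)" by (simp add: algebra_simps)
  also have "\<dots> \<le> 4 * U * B * ((a + sqrt (2 * \<Lambda>)) * y + (b + 1/2 + \<Lambda>) + 1)"
  proof (rule mult_left_mono)
    have "x \<le> sqrt (2 * \<Lambda>)" unfolding x_def using pos by simp
    then have "x * y \<le> sqrt (2 * \<Lambda>) * y" using xy by (intro mult_right_mono) auto
    then show "a * y + b + x * y \<le> (a + sqrt (2 * \<Lambda>)) * y + (b + 1/2 + \<Lambda>) + 1"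
      using pos by (simp add: algebra_simps)
  qed (use pos in simp)
  finally show ?thesis unfolding y_def .
qed

text \<open>The length bound is quadratic in the root of n i and gives
  \<open>r i * sqrt (n i)\<close> at most A per session plus a geometric term. Their sum is at most
  A * Mz and the sum of their squares at most A^2 * Mz^2 / 8; \<nu> is the rate that balances the
  deviation terms for this value. The summand with 58/100 in Mz contributes 58/100 * U * B * b',
  which together with the regret constant 342/100 fills up 4 * U * B * b'.\<close>

lemma second_bound:
  fixes U B a b \<Lambda> H m :: real and n :: "nat \<Rightarrow> real"
  defines "a' \<equiv> a + sqrt (2 * \<Lambda>)" and "b' \<equiv> b + 1/2 + \<Lambda>"
  defines "r \<equiv> \<lambda>i. U * (root4\<^sup>2) ^ i" and "A \<equiv> H * a'"
  defines "Mz \<equiv> 2 * m + 58/100 * (b' * U / (a' * A))"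
  defines "\<nu> \<equiv> sqrt (2 * \<Lambda>) / (B * A * Mz)"
  assumes pos: "0 < U" "0 < B" "0 \<le> a" "0 \<le> b" "8 \<le> \<Lambda>" "64 * U \<le> H" "0 < m"
    and n: "\<And>i. n i = 0 \<or> 1 \<le> n i"
    and len: "\<And>i. i \<le> J \<Longrightarrow> 1 \<le> n i \<Longrightarrow> r i * (n i - 1) \<le> H * (a' * sqrt (n i - 1) + b')"
    and m: "2 * m \<ge> real J + 11" "b > 100 \<Longrightarrow> 2 * m \<ge> real J + 24"
  shows "(\<Sum>i\<le>J. r i * (a * B * sqrt (n i) + b * B)) + \<Lambda> / \<nu> + \<nu> * (4 * B\<^sup>2 * (\<Sum>i\<le>J. (r i)\<^sup>2 * n i))
    \<le> 2 * H * B * a'\<^sup>2 * m + 4 * U * B * b'"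
proof -
  define z where "z = sqrt (b' * U / (a' * A))"
  define u where "u = U / A"
  define Y where "Y = z + u"
  have s: "4 \<le> sqrt (2 * \<Lambda>)" using pos by (intro real_le_rsqrt) simp
  then have a': "4 \<le> a'" "sqrt (2 * \<Lambda>) \<le> a'" "a \<le> a'" using pos by (simp_all add: a'_def)
  have H: "0 < H" using pos by linarith
  have A: "0 < A" "256 * U \<le> A"
  proof -
    show "0 < A" using H a' by (simp add: A_def)
    have "64 * U * 4 \<le> H * a'" using pos a' by (intro mult_mono) auto
    then show "256 * U \<le> A" by (simp add: A_def)
  qed
  have b': "0 < b'" using pos by (simp add: b'_def)
  have z0: "0 \<le> z" unfolding z_def using b' pos a' A by simp
  have z2: "z\<^sup>2 = b' * U / (a' * A)" unfolding z_def using b' pos a' A by simp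
  have Mz: "Mz = 2 * m + 58/100 * z\<^sup>2" by (simp add: Mz_def z2)
  have u: "0 \<le> u" "u \<le> 1/256" using A pos by (simp_all add: u_def field_simps)
  have cases: "2 * m \<ge> real J + 11 \<and> z \<le> 33/100 \<or> 2 * m \<ge> real J + 24"
  proof (cases "b > 100")
    case False
    \<comment> \<open>As a'^2 \<ge> 2 * \<Lambda> \<ge> 16 and b \<le> 100, the ratio b' / a'^2 is
      small enough for z \<le> 33/100; a larger b comes with longer sessions, hence with fewer of
      them.\<close>
    have "z\<^sup>2 \<le> b' / (64 * a'\<^sup>2)"
    proof -
      have "b' * (64 * U) \<le> b' * H" using b' pos by (intro mult_left_mono) auto
      then have "b' * U * (64 * a'\<^sup>2) \<le> b' * (a' * A)"
        using mult_right_mono[of "b' * (64 * U)" "b' * H" "a'\<^sup>2"] by (simp add: A_def power2_eq_square mult_ac)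
      then show ?thesis unfolding z2 using a' A by (simp add: pos_divide_le_eq pos_le_divide_eq)
    qed
    also have "\<dots> \<le> (33/100)\<^sup>2"
    proof -
      have "2 * \<Lambda> \<le> a'\<^sup>2" using power_mono[OF a'(2), of 2] s pos by simp
      then have "b' \<le> (33/100)\<^sup>2 * (64 * a'\<^sup>2)"
        using False pos by (simp add: b'_def power2_eq_square)
      then show ?thesis using a' by (simp add: pos_divide_le_eq)
    qed
    finally have "z \<le> 33/100" by (rule power2_le_imp_le) simp
    then show ?thesis using m by simp
  qed (use m in simp)
  note count = session_count[OF _ z0 u cases, folded Mz Y_def]
  have MzJ: "real J + 1 + 63/10 * Y \<le> Mz" "real J + 1 + 126/10 * Y + 342/100 * Y\<^sup>2 \<le> Mz\<^sup>2 / 8"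
    using count by simp_all
  have Y0: "0 \<le> Y" using z0 u by (simp add: Y_def)
  have Mz0: "0 < Mz" using MzJ(1) Y0 by linarith
  have q: "0 \<le> root4" "root4 \<le> 1" using root4_le by auto
  have r0: "0 \<le> r i" for i using pos by (simp add: r_def)
  have rU: "r i \<le> U * root4 ^ i" for i
  proof -
    have "(root4\<^sup>2) ^ i \<le> root4 ^ i"
      using q by (intro power_mono) (auto simp: power2_eq_square mult_left_le)
    then show ?thesis unfolding r_def using pos by (intro mult_left_mono) auto
  qed
  have y: "r i * sqrt (n i) \<le> A * (1 + Y * root4 ^ i)" if "i \<le> J" for i
  proof (cases "n i = 0")
    case True
    then show ?thesis using A Y0 q by simp
  next
    case False
    then have n1: "1 \<le> n i" using n by blast
    define x where "x = sqrt (n i - 1)"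
    have x: "0 \<le> x" "x\<^sup>2 = n i - 1" using n1 by (simp_all add: x_def)
    define W where "W = b' * r i / a'"
    have W: "A * W = H * b' * r i" using a' by (simp add: W_def A_def)
    have "r i * (r i * x\<^sup>2) \<le> r i * (H * (a' * x + b'))"
      unfolding x(2) using len[OF that n1] r0 unfolding x_def by (intro mult_left_mono) auto
    then have "(r i * x)\<^sup>2 \<le> A * (r i * x) + A * W"
      unfolding W by (simp add: A_def power2_eq_square algebra_simps)
    then have rx: "r i * x \<le> A + sqrt (A * W)"
      by (rule sqrt_bound_from_quadratic) (use A a' b' r0 in \<open>auto simp: W_def\<close>)
    have "sqrt (A * W) = A * z * root4 ^ i"
    proof -
      have "A * W = (A * z * root4 ^ i)\<^sup>2"
        unfolding power_mult_distrib z2 W_def r_def using A a'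
        by (simp add: power2_eq_square power_mult_distrib)
      then show ?thesis using A z0 q by simp
    qed
    \<comment> \<open>The length bound concerns n i - 1 rounds. The last round adds at most r i,
      which is the contribution of u.\<close>
    moreover have "r i \<le> A * u * root4 ^ i" using rU[of i] A by (simp add: u_def)
    moreover have "sqrt (n i) \<le> x + 1"
      using sqrt_add_le_add_sqrt[of "n i - 1" 1] n1 by (simp add: x_def)
    then have "r i * sqrt (n i) \<le> r i * (x + 1)" using r0 by (intro mult_left_mono) auto
    ultimately show ?thesis using rx by (simp add: Y_def algebra_simps)
  qed
  have geo: "(\<Sum>i\<le>J. root4 ^ i) \<le> 63/10" "(\<Sum>i\<le>J. (root4 ^ i)\<^sup>2) \<le> 342/100"
    using sum_root4[of J] sum_sqrt_half[of J] by (simp_all add: power_mult[symmetric] mult.commute)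
  have sum_y: "(\<Sum>i\<le>J. r i * sqrt (n i)) \<le> A * Mz"
  proof -
    have "(\<Sum>i\<le>J. r i * sqrt (n i)) \<le> (\<Sum>i\<le>J. A * (1 + Y * root4 ^ i))"
      by (intro sum_mono y) simp
    also have "\<dots> = A * (real J + 1 + Y * (\<Sum>i\<le>J. root4 ^ i))"
      by (simp add: sum_distrib_left[symmetric] sum.distrib add.commute)
    also have "\<dots> \<le> A * Mz"
    proof (rule mult_left_mono)
      have "Y * (\<Sum>i\<le>J. root4 ^ i) \<le> Y * (63/10)" using geo(1) Y0 by (rule mult_left_mono)
      then show "real J + 1 + Y * (\<Sum>i\<le>J. root4 ^ i) \<le> Mz" using MzJ(1) by simp
    qed (use A in simp)
    finally show ?thesis .
  qed
  have sum_Q: "(\<Sum>i\<le>J. (r i)\<^sup>2 * n i) \<le> A\<^sup>2 * (Mz\<^sup>2 / 8)"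
  proof -
    have "(\<Sum>i\<le>J. (r i)\<^sup>2 * n i) \<le> (\<Sum>i\<le>J. A\<^sup>2 * (1 + Y * root4 ^ i)\<^sup>2)"
    proof (rule sum_mono)
      fix i assume "i \<in> {..J}"
      then have "(r i * sqrt (n i))\<^sup>2 \<le> (A * (1 + Y * root4 ^ i))\<^sup>2"
        using r0 n[of i] by (intro power_mono y) auto
      moreover have "0 \<le> n i" using n[of i] by auto
      ultimately show "(r i)\<^sup>2 * n i \<le> A\<^sup>2 * (1 + Y * root4 ^ i)\<^sup>2" by (simp add: power_mult_distrib)
    qed
    also have "\<dots> = A\<^sup>2 * (real J + 1 + 2 * Y * (\<Sum>i\<le>J. root4 ^ i) + Y\<^sup>2 * (\<Sum>i\<le>J. (root4 ^ i)\<^sup>2))"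
    proof -
      have "(1 + Y * root4 ^ i)\<^sup>2 = 1 + 2 * Y * root4 ^ i + Y\<^sup>2 * (root4 ^ i)\<^sup>2" for i
        by (simp add: power2_eq_square algebra_simps)
      then show ?thesis by (simp add: sum_distrib_left[symmetric] sum.distrib add.commute)
    qed
    also have "\<dots> \<le> A\<^sup>2 * (Mz\<^sup>2 / 8)"
    proof (rule mult_left_mono)
      have "2 * Y * (\<Sum>i\<le>J. root4 ^ i) \<le> 2 * Y * (63/10)" using geo(1) Y0 by (intro mult_left_mono) auto
      moreover have "Y\<^sup>2 * (\<Sum>i\<le>J. (root4 ^ i)\<^sup>2) \<le> Y\<^sup>2 * (342/100)" using geo(2) by (rule mult_left_mono) simp
      ultimately show "real J + 1 + 2 * Y * (\<Sum>i\<le>J. root4 ^ i) + Y\<^sup>2 * (\<Sum>i\<le>J. (root4 ^ i)\<^sup>2) \<le> Mz\<^sup>2 / 8"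
        using MzJ(2) by linarith
    qed simp
    finally show ?thesis .
  qed
  define x where "x = sqrt (2 * \<Lambda>)"
  have x: "0 < x" "\<Lambda> = x\<^sup>2 / 2" using s pos by (simp_all add: x_def)
  define G where "G = B * A * Mz"
  have G: "0 < G" using pos A Mz0 by (simp add: G_def)
  have \<nu>: "0 < \<nu>" "\<nu> = x / G" using x(1) G by (simp_all add: \<nu>_def x_def G_def)
  have "\<Lambda> / \<nu> = x\<^sup>2 / 2 / (x / G)" by (simp only: \<nu>(2) x(2)[symmetric])
  also have "\<dots> = x * G / 2" using x(1) G by (simp add: power2_eq_square)
  finally have "\<Lambda> / \<nu> = x * G / 2" .
  moreover have "\<nu> * (4 * B\<^sup>2 * (\<Sum>i\<le>J. (r i)\<^sup>2 * n i)) \<le> \<nu> * (4 * B\<^sup>2 * (A\<^sup>2 * (Mz\<^sup>2 / 8)))"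
    using sum_Q \<nu>(1) by (intro mult_left_mono) auto
  moreover have "\<nu> * (4 * B\<^sup>2 * (A\<^sup>2 * (Mz\<^sup>2 / 8))) = x * G / 2"
  proof -
    have "4 * B\<^sup>2 * (A\<^sup>2 * (Mz\<^sup>2 / 8)) = G * (G / 2)"
      by (simp add: G_def power2_eq_square)
    then show ?thesis unfolding \<nu>(2) using G by simp
  qed
  moreover have "(\<Sum>i\<le>J. r i * (a * B * sqrt (n i) + b * B)) =
      a * B * (\<Sum>i\<le>J. r i * sqrt (n i)) + b * B * (\<Sum>i\<le>J. r i)"
    by (simp add: sum_distrib_left sum.distrib[symmetric] algebra_simps)
  moreover have "a * B * (\<Sum>i\<le>J. r i * sqrt (n i)) \<le> a * B * (A * Mz)"
    using sum_y pos by (intro mult_left_mono) auto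
  moreover have "b * B * (\<Sum>i\<le>J. r i) \<le> b * B * (U * (342/100))"
    unfolding r_def sum_distrib_left[symmetric] using sum_sqrt_half[of J] pos
    by (intro mult_left_mono) auto
  ultimately have "(\<Sum>i\<le>J. r i * (a * B * sqrt (n i) + b * B)) + \<Lambda> / \<nu> + \<nu> * (4 * B\<^sup>2 * (\<Sum>i\<le>J. (r i)\<^sup>2 * n i))
      \<le> a * B * (A * Mz) + b * B * (U * (342/100)) + x * G"
    by linarith
  also have "\<dots> = a' * B * A * Mz + 342/100 * (U * B * b)"
    by (simp add: a'_def x_def G_def algebra_simps)
  also have "a' * B * A * Mz = 2 * H * B * a'\<^sup>2 * m + 58/100 * (U * B * b')"
  proof -
    have "a' * A * z\<^sup>2 = b' * U" unfolding z2 using a' A by simp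
    then have "B * (a' * A * z\<^sup>2) = B * (b' * U)" by simp
    then show ?thesis unfolding Mz by (simp add: A_def power2_eq_square algebra_simps)
  qed
  also have "2 * H * B * a'\<^sup>2 * m + 58/100 * (U * B * b') + 342/100 * (U * B * b)
      \<le> 2 * H * B * a'\<^sup>2 * m + 4 * U * B * b'"
  proof -
    have "U * B * b \<le> U * B * b'" using pos by (intro mult_left_mono) (auto simp: b'_def)
    then show ?thesis by simp
  qed
  finally show ?thesis .
qed

context saew_good_path
begin

section \<open>Regret and length of the sessions of a good run\<close>

definition rounds :: "nat \<Rightarrow> nat set" where
  "rounds i = {t \<in> {1..T}. fst (sess g (t - 1)) = i}"

lemma finite_rounds [simp]: "finite (rounds i)"
  by (simp add: rounds_def)

lemma rounds_interval:
  assumes "rounds i \<noteq> {}"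
  obtains n s where "sess g n = (i, s)" "n < T" "rounds i = {s..Suc n}" "1 \<le> s" "s \<le> Suc n"
proof -
  define n where "n = Max (rounds i) - 1"
  have max: "Max (rounds i) \<in> rounds i" using assms by (intro Max_in) auto
  obtain s where s: "sess g n = (i, s)"
    using max by (cases "sess g n") (auto simp: rounds_def n_def)
  have n: "n < T" using max by (auto simp: rounds_def n_def)
  have "m \<le> n" if "m < T" "fst (sess g m) = i" for m
  proof -
    have "Suc m \<in> rounds i" using that by (simp add: rounds_def)
    then have "Suc m \<le> Max (rounds i)" by (intro Max_ge) auto
    then show ?thesis by (simp add: n_def)
  qed
  then have "rounds i = {s..Suc n}"
    unfolding rounds_def by (intro sess_rounds[OF s n]) auto
  then show ?thesis using that[OF s n] sess_start[of g n] s by simp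
qed

lemma round_bounds:
  assumes "t \<in> rounds i"
  shows "l1_norm (\<theta> (t - 1)) \<le> 2 * U" "l1_norm (\<theta> (t - 1) - \<theta>s) \<le> 2 * radius i" "infnorm (g t) \<le> B"
    "\<bar>g t \<bullet> (\<theta> (t - 1) - \<theta>s)\<bar> \<le> 2 * radius i * B"
proof -
  obtain s where s: "sess g (t - 1) = (i, s)"
    using assms by (cases "sess g (t - 1)") (auto simp: rounds_def)
  have t: "t - 1 < T" "Suc (t - 1) = t" using assms by (auto simp: rounds_def)
  show 1: "l1_norm (\<theta> (t - 1)) \<le> 2 * U" and 2: "l1_norm (\<theta> (t - 1) - \<theta>s) \<le> 2 * radius i"
    using path_invariant[OF t(1) s] by auto
  show 3: "infnorm (g t) \<le> B" using gradient_le[OF t(1) 1] t(2) by simp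
  have "\<bar>g t \<bullet> (\<theta> (t - 1) - \<theta>s)\<bar> \<le> infnorm (g t) * l1_norm (\<theta> (t - 1) - \<theta>s)"
    by (rule abs_inner_le_infnorm_l1_norm)
  also have "\<dots> \<le> B * (2 * radius i)" using 2 3 B by (intro mult_mono) auto
  finally show "\<bar>g t \<bullet> (\<theta> (t - 1) - \<theta>s)\<bar> \<le> 2 * radius i * B" by (simp add: mult_ac)
qed

lemma sum_gradients_le:
  assumes "I \<subseteq> rounds i"
  shows "sqrt (\<Sum>t\<in>I. (infnorm (g t))\<^sup>2) \<le> B * sqrt (real (card I))"
proof -
  have "(\<Sum>t\<in>I. (infnorm (g t))\<^sup>2) \<le> (\<Sum>t\<in>I. B\<^sup>2)"
    using assms round_bounds(3) by (intro sum_mono power_mono infnorm_pos_le) auto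
  also have "\<dots> = B\<^sup>2 * real (card I)" by simp
  finally have "sqrt (\<Sum>t\<in>I. (infnorm (g t))\<^sup>2) \<le> sqrt (B\<^sup>2 * real (card I))" by simp
  also have "\<dots> = B * sqrt (real (card I))" using B by (simp add: real_sqrt_mult)
  finally show ?thesis .
qed

lemma session_regret:
  "(\<Sum>t\<in>rounds i. g t \<bullet> (\<theta> (t - 1) - \<theta>s)) \<le> radius i * (a * B * sqrt (real (card (rounds i))) + b * B)"
proof (cases "rounds i = {}")
  case True
  then show ?thesis using radius_pos[of i] b B by simp
next
  case False
  then obtain n s where n: "sess g n = (i, s)" "n < T" "rounds i = {s..Suc n}" "1 \<le> s" "s \<le> Suc n"
    by (rule rounds_interval)
  have "(\<Sum>t\<in>rounds i. g t \<bullet> (\<theta> (t - 1) - \<theta>s))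
      \<le> a * radius i * sqrt (\<Sum>t\<in>rounds i. (infnorm (g t))\<^sup>2) + b * radius i * B"
    unfolding n(3)
  proof (rule linear_regret[where \<theta> = \<theta> and c = "c i"])
    fix q assume "s \<le> Suc q" "q \<le> n"
    then show "\<theta> q = S B s (c i) (radius i) (map g [s..<Suc q])"
      by (intro prediction sess_same[OF n(1)])
  next
    show "l1_norm (\<theta>s - c i) \<le> radius i"
      using path_invariant[OF n(2,1)] by simp
  qed (use n in auto)
  also have "\<dots> \<le> a * radius i * (B * sqrt (real (card (rounds i)))) + b * radius i * B"
    using a radius_pos[of i] sum_gradients_le[of "rounds i" i]
    by (intro add_right_mono mult_left_mono) auto
  finally show ?thesis by (simp add: algebra_simps)
qed

text \<open>Session i was entered by completing another one within the horizon, and that one already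
  has the stated length.\<close>

lemma active_length:
  assumes "rounds i \<noteq> {}" "i \<ge> 1"
  shows "45 * (b + 14/10) * 2 powr (real i / 2) \<le> real T"
proof -
  obtain n s where n: "sess g n = (i, s)" "n < T" "s \<le> Suc n"
    using assms(1) by (rule rounds_interval) auto
  have s: "1 < s" using center_first(2)[OF n(1)] assms(2) by auto
  obtain j s' where j: "sess g (s - 2) = (j, s')" by force
  note new = sess_new[OF n(1) s j]
  have "45 * (b + 14/10) * 2 powr (real i / 2) \<le> real (s - 1 - s' + 1)"
    by (rule session_length_ge(1)[OF new(3,2,1)])
  also have "\<dots> \<le> real T" using n s by simp
  finally show ?thesis .
qed

text \<open>For i \<ge> 1, 2^5 * 2^(i/2) \<le> T gives i + 2 \<le> 1 + 3 * ln T. The confidence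
  level contributes 2 * ln (i + 2) and the iterated logarithm once more at most ln (1 + 3 * ln T),
  which explains the factor 3 in \<open>\<Lambda>\<close>.\<close>

lemma active_log_le:
  assumes "rounds i \<noteq> {}" "1 \<le> k" "k \<le> T" "2 \<le> T"
  shows "saew_log \<delta> i k \<le> 3 * ln (1 + 3 * ln (real T)) - ln \<delta>"
proof -
  define l where "l = 1 + 3 * ln (real T)"
  have ln2: "ln 2 \<le> ln (real T)" using assms(4) by (subst ln_le_cancel_iff) auto
  have i: "real i + 2 \<le> l"
  proof (cases "i \<ge> 1")
    case True
    have "(2::real) ^ 5 * 2 powr (real i / 2) \<le> 45 * (b + 14/10) * 2 powr (real i / 2)"
      using b by (intro mult_right_mono) auto
    also have "\<dots> \<le> real T" by (rule active_length[OF assms(1) True])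
    finally have "ln (2 ^ 5 * 2 powr (real i / 2)) \<le> ln (real T)"
      by (subst ln_le_cancel_iff) (use assms in auto)
    moreover have "ln (2 ^ 5 * 2 powr (real i / 2)) = 5 * ln 2 + real i / 2 * ln 2"
      by (subst ln_mult) (simp_all add: ln_powr ln_realpow del: power_numeral)
    moreover have "real i / 2 * (691/1000) \<le> real i / 2 * ln 2"
      using ln_2_bounds by (intro mult_left_mono) auto
    ultimately show ?thesis using ln_2_bounds unfolding l_def by linarith
  next
    case False
    then show ?thesis using ln2 ln_2_bounds by (simp add: l_def)
  qed
  have k: "ln (real k / 2) \<le> ln (real T)" "- ln 2 \<le> ln (real k / 2)"
  proof -
    show "ln (real k / 2) \<le> ln (real T)" using assms by (subst ln_le_cancel_iff) auto
    have "ln (1 / 2) \<le> ln (real k / 2)" using assms by (subst ln_le_cancel_iff) auto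
    then show "- ln 2 \<le> ln (real k / 2)" by (simp add: ln_div)
  qed
  have "ln (1 + 1/2 * ln (real k / 2)) \<le> ln l"
    using k ln2 ln_2_bounds unfolding l_def by (subst ln_le_cancel_iff) linarith+
  moreover have "ln (real i + 2) \<le> ln l"
    using i by (subst ln_le_cancel_iff) auto
  moreover have "ln (\<delta> / (real i + 2)\<^sup>2) = ln \<delta> - 2 * ln (real i + 2)"
    using \<delta> by (subst ln_div) (simp_all add: ln_realpow)
  ultimately show ?thesis unfolding saew_log_def l_def by linarith
qed

text \<open>The session went on after its last but one round, so the accuracy there exceeds
  \<open>radius (Suc i)\<close>; hence the length minus one. Squared, this compares (radius i)^2 / 2
  with \<open>acc_sq\<close>, and one factor radius i cancels.\<close>

lemma session_length_le:
  assumes "rounds i \<noteq> {}" and T: "2 \<le> T"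
  defines "\<Lambda> \<equiv> 3 * ln (1 + 3 * ln (real T)) - ln \<delta>" and "N \<equiv> real (card (rounds i)) - 1"
  shows "radius i * N \<le> 16 * real d0 * B / \<alpha> * ((a + sqrt (2 * \<Lambda>)) * sqrt N + (b + 1/2 + \<Lambda>))"
proof -
  obtain n s where n: "sess g n = (i, s)" "n < T" "rounds i = {s..Suc n}" "1 \<le> s" "s \<le> Suc n"
    using assms(1) by (rule rounds_interval)
  have \<Lambda>: "\<Lambda> \<ge> 9/10"
    using active_log_le[OF assms(1) order_refl _ T] saew_log_ge[of 1 i] T unfolding \<Lambda>_def by simp
  show ?thesis
  proof (cases "s \<le> n")
    case False
    then have "N = 0" using n by (simp add: N_def)
    then show ?thesis using \<Lambda> b B \<alpha> by simp
  next
    case True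
    define Err where "Err = saew_err a b B \<delta> i g s n"
    define k where "k = n - s + 1"
    have N: "N = real k" "N \<ge> 1" using True n(3) by (auto simp: N_def k_def Suc_diff_le)
    have k: "1 \<le> k" "k \<le> T" using True n(2,4) by (simp_all add: k_def)
    have L: "saew_log \<delta> i k \<le> \<Lambda>" "saew_log \<delta> i k \<ge> 9/10"
      unfolding \<Lambda>_def by (rule active_log_le[OF assms(1) k T], rule saew_log_ge[OF k(1)])
    have V: "sqrt (\<Sum>t=s..n. (infnorm (g t))\<^sup>2) \<le> B * sqrt N"
      using sum_gradients_le[of "{s..n}" i] n(3) N True by (simp add: k_def Suc_diff_le)
    have Err: "Err \<le> B * ((a + sqrt (2 * \<Lambda>)) * sqrt N + (b + 1/2 + \<Lambda>))"
    proof -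
      have "(a + sqrt 2 * sqrt (saew_log \<delta> i k)) * sqrt (\<Sum>t=s..n. (infnorm (g t))\<^sup>2)
          \<le> (a + sqrt (2 * \<Lambda>)) * (B * sqrt N)"
        using L V a \<Lambda> by (intro mult_mono) (auto simp: real_sqrt_mult sum_nonneg)
      moreover have "(b + 1/2 + saew_log \<delta> i k) * B \<le> (b + 1/2 + \<Lambda>) * B"
        using L B by (intro mult_right_mono) auto
      ultimately have "Err \<le> (a + sqrt (2 * \<Lambda>)) * (B * sqrt N) + (b + 1/2 + \<Lambda>) * B"
        unfolding Err_def saew_err_def k_def[symmetric] by linarith
      then show ?thesis by (simp add: algebra_simps)
    qed
    have "radius (Suc i) \<le> acc g i s n" using sess_continue[OF n(1) True] by simp
    then have "(radius (Suc i))\<^sup>2 \<le> (acc g i s n)\<^sup>2"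
      using radius_pos[of "Suc i"] by (intro power_mono) auto
    moreover have "(radius (Suc i))\<^sup>2 = (radius i)\<^sup>2 / 2" unfolding radius_sq by simp
    ultimately have "(radius i)\<^sup>2 / 2 \<le> 8 * real d0 * radius i * Err / (\<alpha> * N)"
      unfolding acc_sq[OF True] Err_def N(1) k_def by simp
    then have "(radius i)\<^sup>2 / 2 * (\<alpha> * N) \<le> 8 * real d0 * radius i * Err"
      using \<alpha> N(2) by (simp add: pos_le_divide_eq)
    then have "radius i * (radius i * N * \<alpha>) \<le> radius i * (16 * real d0 * Err)"
      by (simp add: power2_eq_square mult_ac)
    then have "radius i * N * \<alpha> \<le> 16 * real d0 * Err"
      using radius_pos[of i] by (rule mult_left_le_imp_le)
    also have "\<dots> \<le> 16 * real d0 * (B * ((a + sqrt (2 * \<Lambda>)) * sqrt N + (b + 1/2 + \<Lambda>)))"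
      using Err by (rule mult_left_mono) simp
    finally have "radius i * N \<le> 16 * real d0 * (B * ((a + sqrt (2 * \<Lambda>)) * sqrt N + (b + 1/2 + \<Lambda>))) / \<alpha>"
      using \<alpha> by (simp add: pos_le_divide_eq)
    then show ?thesis by (simp add: mult_ac)
  qed
qed

definition last_session :: nat where
  "last_session = fst (sess g (T - 1))"

lemma rounds_last_session: "T \<ge> 1 \<Longrightarrow> rounds last_session \<noteq> {}"
  by (auto simp: rounds_def last_session_def intro!: exI[of _ T])

lemma sum_over_sessions:
  fixes f :: "nat \<Rightarrow> real"
  shows "(\<Sum>i\<le>last_session. \<Sum>t\<in>rounds i. f t) = (\<Sum>t=1..T. f t)"
proof -
  have "(\<lambda>t. fst (sess g (t - 1))) ` {1..T} \<subseteq> {..last_session}"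
    unfolding last_session_def by (auto intro!: sess_fst_mono)
  then show ?thesis
    unfolding rounds_def by (intro sum.group) auto
qed

lemma card_over_sessions: "(\<Sum>i\<le>last_session. real (card (rounds i))) = real T"
  using sum_over_sessions[of "\<lambda>_. 1"] by simp

text \<open>A single deviation inequality covers all sessions, so the confidence is paid once and
  not per session. Its guard is true in every round of a good run, and division by \<nu> leaves the
  two terms that the choice of \<nu> has to balance.\<close>

lemma cumulative_mean_le:
  assumes \<nu>: "\<nu> > 0"
    and dev: "(\<Sum>m<T. if l1_norm (\<theta> m) \<le> 2 * U \<and> l1_norm (\<theta> m - \<theta>s) \<le> 2 * U
         then \<nu> * (mean m - g (Suc m) \<bullet> (\<theta> m - \<theta>s)) - (\<nu> * (g (Suc m) \<bullet> (\<theta> m - \<theta>s)))\<^sup>2 else 0) \<le> \<Lambda>"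
  shows "(\<Sum>n<T. mean n) \<le>
      (\<Sum>i\<le>last_session. radius i * (a * B * sqrt (real (card (rounds i))) + b * B))
      + \<Lambda> / \<nu> + \<nu> * (4 * B\<^sup>2 * (\<Sum>i\<le>last_session. (radius i)\<^sup>2 * real (card (rounds i))))"
proof -
  define X where "X t = g t \<bullet> (\<theta> (t - 1) - \<theta>s)" for t
  have shift: "(\<Sum>m<T. f (Suc m)) = (\<Sum>t=1..T. f t)" for f :: "nat \<Rightarrow> real"
    by (rule sum.reindex_bij_witness[of _ "\<lambda>t. t - 1" Suc]) auto
  have guard: "l1_norm (\<theta> m) \<le> 2 * U \<and> l1_norm (\<theta> m - \<theta>s) \<le> 2 * U" if "m < T" for m
  proof -
    have "Suc m \<in> rounds (fst (sess g m))" using that by (simp add: rounds_def)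
    from round_bounds(1,2)[OF this] show ?thesis
      using radius_le_U[of "fst (sess g m)"] by simp
  qed
  have "(\<Sum>m<T. if l1_norm (\<theta> m) \<le> 2 * U \<and> l1_norm (\<theta> m - \<theta>s) \<le> 2 * U
         then \<nu> * (mean m - g (Suc m) \<bullet> (\<theta> m - \<theta>s)) - (\<nu> * (g (Suc m) \<bullet> (\<theta> m - \<theta>s)))\<^sup>2 else 0)
      = (\<Sum>m<T. \<nu> * mean m - (\<nu> * X (Suc m) + \<nu>\<^sup>2 * (X (Suc m))\<^sup>2))"
    using guard by (intro sum.cong) (auto simp: X_def right_diff_distrib power_mult_distrib)
  also have "\<dots> = \<nu> * (\<Sum>m<T. mean m) - (\<nu> * (\<Sum>t=1..T. X t) + \<nu>\<^sup>2 * (\<Sum>t=1..T. (X t)\<^sup>2))"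
    unfolding sum_subtractf sum.distrib sum_distrib_left shift[of "\<lambda>t. \<nu> * X t"]
      shift[of "\<lambda>t. \<nu>\<^sup>2 * (X t)\<^sup>2"] ..
  finally have "\<nu> * (\<Sum>m<T. mean m) \<le> \<nu> * (\<Sum>t=1..T. X t) + \<nu>\<^sup>2 * (\<Sum>t=1..T. (X t)\<^sup>2) + \<Lambda>"
    using dev by linarith
  moreover have "\<nu> * (\<Sum>t=1..T. X t) + \<nu>\<^sup>2 * (\<Sum>t=1..T. (X t)\<^sup>2) + \<Lambda> =
      \<nu> * ((\<Sum>t=1..T. X t) + \<nu> * (\<Sum>t=1..T. (X t)\<^sup>2) + \<Lambda> / \<nu>)"
    using \<nu> by (simp add: algebra_simps power2_eq_square)
  ultimately have "\<nu> * (\<Sum>m<T. mean m) \<le> \<nu> * ((\<Sum>t=1..T. X t) + \<nu> * (\<Sum>t=1..T. (X t)\<^sup>2) + \<Lambda> / \<nu>)"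
    by simp
  then have "(\<Sum>m<T. mean m) \<le> (\<Sum>t=1..T. X t) + \<nu> * (\<Sum>t=1..T. (X t)\<^sup>2) + \<Lambda> / \<nu>"
    using \<nu> by (rule mult_left_le_imp_le)
  moreover have "(\<Sum>t=1..T. X t) \<le> (\<Sum>i\<le>last_session. radius i * (a * B * sqrt (real (card (rounds i))) + b * B))"
    unfolding sum_over_sessions[symmetric] X_def by (intro sum_mono session_regret)
  moreover have "(\<Sum>t=1..T. (X t)\<^sup>2) \<le> 4 * B\<^sup>2 * (\<Sum>i\<le>last_session. (radius i)\<^sup>2 * real (card (rounds i)))"
    unfolding sum_over_sessions[symmetric] sum_distrib_left
  proof (rule sum_mono)
    fix i
    have "(\<Sum>t\<in>rounds i. (X t)\<^sup>2) \<le> (\<Sum>t\<in>rounds i. (2 * radius i * B)\<^sup>2)"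
    proof (rule sum_mono)
      fix t assume "t \<in> rounds i"
      from power_mono[OF round_bounds(4)[OF this] abs_ge_zero, of 2]
      show "(X t)\<^sup>2 \<le> (2 * radius i * B)\<^sup>2" by (simp add: X_def)
    qed
    then show "(\<Sum>t\<in>rounds i. (X t)\<^sup>2) \<le> 4 * B\<^sup>2 * ((radius i)\<^sup>2 * real (card (rounds i)))"
      by (simp add: power_mult_distrib mult_ac)
  qed
  then have "\<nu> * (\<Sum>t=1..T. (X t)\<^sup>2) \<le> \<nu> * (4 * B\<^sup>2 * (\<Sum>i\<le>last_session. (radius i)\<^sup>2 * real (card (rounds i))))"
    using \<nu> by (intro mult_left_mono) auto
  ultimately show ?thesis by linarith
qed

end

text \<open>For short horizons the trivial risk bound, linear in T, is dominated by the leading term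
  of the second bound, because H \<ge> 64 * U and a'^2 \<ge> 2 * \<Lambda>. The split at 256 works
  since 128 * 3 * 691/1000 > 256, and with log 2 T \<ge> 8 the later bound exceeds 8192.\<close>

lemma small_horizon:
  fixes T :: real
  assumes "2 \<le> T" "T \<le> 8192"
  shows "T \<le> 128 * (3 * ln (1 + 3 * ln T)) * log 2 T"
proof -
  have ln2T: "ln 2 \<le> ln T" using assms by (subst ln_le_cancel_iff) auto
  show ?thesis
  proof (cases "T \<le> 256")
    case True
    have "log 2 2 \<le> log 2 T" using assms by (subst log_le_cancel_iff) auto
    then have log: "1 \<le> log 2 T" by simp
    have "ln 2 \<le> ln (1 + 3 * ln T)" using ln2T ln_2_bounds by (subst ln_le_cancel_iff) linarith+
    then have "128 * (3 * (691/1000)) * 1 \<le> 128 * (3 * ln (1 + 3 * ln T)) * log 2 T"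
      using ln_2_bounds log by (intro mult_mono) auto
    then show ?thesis using True by linarith
  next
    case False
    have "log 2 (2 ^ 8) \<le> log 2 T" using False by (subst log_le_cancel_iff) auto
    then have log: "8 \<le> log 2 T" by (simp add: log_nat_power del: power_numeral)
    have "ln (2 ^ 8) \<le> ln T" using False by (subst ln_le_cancel_iff) auto
    then have "8 * ln 2 \<le> ln T" by (simp add: ln_realpow del: power_numeral)
    then have "2 ^ 4 \<le> 1 + 3 * ln T" using ln_2_bounds by simp
    then have "ln (2 ^ 4) \<le> ln (1 + 3 * ln T)" by (subst ln_le_cancel_iff) auto
    then have "4 * ln 2 \<le> ln (1 + 3 * ln T)" by (simp add: ln_realpow del: power_numeral)
    then have "128 * (3 * (4 * (691/1000))) * 8 \<le> 128 * (3 * ln (1 + 3 * ln T)) * log 2 T"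
      using ln_2_bounds log by (intro mult_mono) auto
    then show ?thesis using assms by linarith
  qed
qed

text \<open>Squaring turns a length of order 2^(J/2) into 2^J, hence the factor 2 before the
  logarithm; k is the margin gained from C^2.\<close>

lemma log_length_ge:
  fixes T C :: real
  assumes "C * 2 powr (real J / 2) \<le> T" "2 ^ k \<le> C\<^sup>2" "0 \<le> C" "0 < T"
  shows "real J + real k \<le> 2 * log 2 T"
proof -
  have "2 powr (real J + real k) = 2 powr real J * 2 ^ k"
    by (simp add: powr_add powr_realpow)
  also have "\<dots> \<le> 2 powr real J * C\<^sup>2" using assms by (intro mult_left_mono) auto
  also have "\<dots> = (C * 2 powr (real J / 2))\<^sup>2"
  proof -
    have "2 powr real J = 2 powr (real J / 2) * 2 powr (real J / 2)"
      by (simp only: powr_add[symmetric]) simp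
    then show ?thesis by (simp add: power2_eq_square)
  qed
  also have "\<dots> \<le> T\<^sup>2" using assms by (intro power_mono) auto
  finally have "log 2 (2 powr (real J + real k)) \<le> log 2 (T\<^sup>2)"
    using assms by (subst log_le_cancel_iff) auto
  then show ?thesis using assms by (simp add: log_nat_power)
qed

lemma (in saew) radius_root4: "radius i = U * (root4\<^sup>2) ^ i"
proof (rule power2_eq_imp_eq)
  have "((root4\<^sup>2) ^ i)\<^sup>2 = ((root4\<^sup>2)\<^sup>2) ^ i" by (simp only: power_mult[symmetric] mult_ac)
  also have "(root4\<^sup>2)\<^sup>2 = 1 / 2" by (simp add: root4_sq power_divide)
  finally show "(radius i)\<^sup>2 = (U * (root4\<^sup>2) ^ i)\<^sup>2"
    unfolding radius_sq power_mult_distrib by (simp add: power_divide)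
qed (use radius_pos[of i] U in auto)

section \<open>Learning rates for the total deviation\<close>

context saew
begin

text \<open>The common logarithmic term: a' = a + sqrt (2 * conf T) and b' = b + 1/2 + conf T. It
  dominates \<open>saew_log\<close> in every active session and is also the threshold of the total
  deviation.\<close>

definition conf :: "nat \<Rightarrow> real" where
  "conf T = 3 * ln (1 + 3 * ln (real T)) - ln \<delta>"

text \<open>
  The learning rates of the deviation inequality for all sessions together; each one balances the two
  deviation terms of one of the two claimed bounds. The minimum in \<open>rate1\<close> only matters for horizons
  where the first bound is trivial.
\<close>

definition rate1 :: "nat \<Rightarrow> real" where
  "rate1 T = min (sqrt (conf T) / (2 * U * B * sqrt (real T))) (1 / (4 * U * B))"

definition rate2 :: "nat \<Rightarrow> real" where
  "rate2 T = (let a' = a + sqrt (2 * conf T); b' = b + 1/2 + conf T; A = 16 * real d0 * B / \<alpha> * a'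
     in sqrt (2 * conf T) / (B * A * (2 * log 2 (real T) + 58/100 * (b' * U / (a' * A)))))"

lemma conf_pos:
  assumes "T \<ge> 1"
  shows "conf T > 0"
proof -
  have "0 \<le> ln (real T)" using assms by simp
  then have "0 \<le> ln (1 + 3 * ln (real T))" by simp
  moreover have "ln \<delta> < 0" using \<delta> by simp
  ultimately show ?thesis unfolding conf_def by linarith
qed

lemma H_ge: "64 * U \<le> 16 * real d0 * B / \<alpha>"
proof -
  have "64 * U * \<alpha> \<le> 16 * B" using \<alpha>_le by (simp add: mult_ac)
  also have "\<dots> \<le> 16 * real d0 * B" using d0 B by simp
  finally show ?thesis using \<alpha> by (simp add: pos_le_divide_eq)
qed

lemma rate1_bounds:
  assumes "T \<ge> 1"
  shows "0 < rate1 T" "rate1 T * (B * (2 * U)) \<le> 1/2"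
proof -
  show "0 < rate1 T" using conf_pos[OF assms] U B assms by (simp add: rate1_def)
  have "rate1 T * (B * (2 * U)) \<le> 1 / (4 * U * B) * (B * (2 * U))"
    using U B by (intro mult_right_mono) (auto simp: rate1_def)
  also have "\<dots> = 1/2" using U B by simp
  finally show "rate1 T * (B * (2 * U)) \<le> 1/2" .
qed

lemma rate2_bounds:
  assumes "T \<ge> 2"
  shows "0 < rate2 T" "rate2 T * (B * (2 * U)) \<le> 1/2"
proof -
  define x where "x = sqrt (2 * conf T)"
  define a' where "a' = a + x"
  define A where "A = 16 * real d0 * B / \<alpha> * a'"
  define X where "X = (b + 1/2 + conf T) * U / (a' * A)"
  define Mz where "Mz = 2 * log 2 (real T) + 58/100 * X"
  have c: "conf T > 0" using conf_pos assms by simp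
  then have x: "0 < x" by (simp add: x_def)
  have a': "x \<le> a'" using a by (simp add: a'_def)
  have "64 * U * x \<le> 16 * real d0 * B / \<alpha> * a'"
    using H_ge a' x U by (intro mult_mono) (auto intro: order.trans)
  then have A: "64 * U * x \<le> A" by (simp add: A_def)
  have "0 < 64 * U * x" using U x by simp
  then have A0: "0 < A" using A by linarith
  have "log 2 2 \<le> log 2 (real T)" using assms by (subst log_le_cancel_iff) auto
  then have "1 \<le> log 2 (real T)" by simp
  moreover have "0 \<le> X"
    unfolding X_def using b c U a' x A0 by (intro divide_nonneg_nonneg mult_nonneg_nonneg) auto
  ultimately have Mz: "2 \<le> Mz" unfolding Mz_def by linarith
  have r: "rate2 T = x / (B * A * Mz)"
    by (simp add: rate2_def Let_def x_def a'_def A_def Mz_def X_def)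
  show "0 < rate2 T" unfolding r using x B A0 Mz by simp
  have "64 * U * x * 2 \<le> A * Mz" using A Mz A0 by (intro mult_mono) auto
  moreover have "rate2 T * (B * (2 * U)) = 2 * U * x / (A * Mz)"
    unfolding r using B by simp
  moreover have "0 \<le> U * x" using U x by simp
  ultimately show "rate2 T * (B * (2 * U)) \<le> 1/2"
    using A0 Mz by (simp add: pos_divide_le_eq)
qed

text \<open>For T \<ge> 2 the cube of 1 + 3 * ln T is at least 8, so the probability is at most
  \<delta> / 8. At T = 1 it would be \<delta> itself.\<close>

lemma exp_conf_le:
  assumes "T \<ge> 2"
  shows "exp (- conf T) \<le> 175/1000 * \<delta>"
proof -
  have "ln 2 \<le> ln (real T)" using assms by (subst ln_le_cancel_iff) auto
  then have l: "2 \<le> 1 + 3 * ln (real T)" using ln_2_bounds by simp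
  then have "ln 2 \<le> ln (1 + 3 * ln (real T))" by (subst ln_le_cancel_iff) auto
  then have "3 * ln 2 \<le> 3 * ln (1 + 3 * ln (real T))" by simp
  moreover have "ln (8::real) = 3 * ln 2" using ln_realpow[of 2 3] by simp
  ultimately have "- conf T \<le> ln \<delta> - ln 8" unfolding conf_def by linarith
  also have "\<dots> = ln (\<delta> / 8)" using \<delta> by (simp add: ln_div)
  finally have "exp (- conf T) \<le> exp (ln (\<delta> / 8))" by simp
  also have "\<dots> = \<delta> / 8" using \<delta> by simp
  finally show ?thesis using \<delta> by simp
qed

end

lemma (in saew_good_path) cumulative_bounds:
  assumes T: "1 \<le> T"
    and mean_le: "\<And>n. n < T \<Longrightarrow> l1_norm (\<theta> n) \<le> 2 * U \<Longrightarrow> mean n \<le> B * l1_norm (\<theta> n - \<theta>s)"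
    and dev1: "2 \<le> T \<Longrightarrow> (\<Sum>m<T. if l1_norm (\<theta> m) \<le> 2 * U \<and> l1_norm (\<theta> m - \<theta>s) \<le> 2 * U
         then rate1 T * (mean m - g (Suc m) \<bullet> (\<theta> m - \<theta>s)) - (rate1 T * (g (Suc m) \<bullet> (\<theta> m - \<theta>s)))\<^sup>2 else 0) \<le> conf T"
    and dev2: "2 \<le> T \<Longrightarrow> (\<Sum>m<T. if l1_norm (\<theta> m) \<le> 2 * U \<and> l1_norm (\<theta> m - \<theta>s) \<le> 2 * U
         then rate2 T * (mean m - g (Suc m) \<bullet> (\<theta> m - \<theta>s)) - (rate2 T * (g (Suc m) \<bullet> (\<theta> m - \<theta>s)))\<^sup>2 else 0) \<le> conf T"
  shows "(\<Sum>n<T. mean n) \<le> 4 * U * B * ((a + sqrt (2 * conf T)) * sqrt (real T) + (b + 1/2 + conf T) + 1)"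
    and "(\<Sum>n<T. mean n) \<le> 2 * (16 * real d0 * B / \<alpha>) * B * (a + sqrt (2 * conf T))\<^sup>2 * log 2 (real T)
      + 4 * U * B * (1 + (b + 1/2 + conf T))"
proof -
  define \<Lambda> where "\<Lambda> = conf T"
  define a' where "a' = a + sqrt (2 * \<Lambda>)"
  define b' where "b' = b + 1/2 + \<Lambda>"
  define H where "H = 16 * real d0 * B / \<alpha>"
  define m where "m = log 2 (real T)"
  have \<Lambda>: "\<Lambda> > 0" using conf_pos[OF T] by (simp add: \<Lambda>_def)
  have a': "sqrt (2 * \<Lambda>) \<le> a'" "0 < a'" unfolding a'_def using a \<Lambda> by (simp, intro add_nonneg_pos) auto
  have b': "1/2 \<le> b'" using b \<Lambda> by (simp add: b'_def)
  have UB: "0 < U * B" using U B by simp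
  have H: "64 * U \<le> H" using H_ge by (simp add: H_def)
  have trivial: "(\<Sum>n<T. mean n) \<le> 2 * (U * B) * real T"
  proof -
    have "mean n \<le> 2 * (U * B)" if "n < T" for n
    proof -
      have "Suc n \<in> rounds (fst (sess g n))" using that by (simp add: rounds_def)
      from round_bounds(1,2)[OF this] have l: "l1_norm (\<theta> n) \<le> 2 * U" "l1_norm (\<theta> n - \<theta>s) \<le> 2 * U"
        using radius_le_U[of "fst (sess g n)"] by simp_all
      have "mean n \<le> B * l1_norm (\<theta> n - \<theta>s)" by (rule mean_le[OF that l(1)])
      also have "\<dots> \<le> B * (2 * U)" using l(2) B by (intro mult_left_mono) auto
      finally show ?thesis by (simp add: mult_ac)
    qed
    then have "(\<Sum>n<T. mean n) \<le> (\<Sum>n<T. 2 * (U * B))" by (intro sum_mono) simp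
    then show ?thesis by (simp add: mult_ac)
  qed
  have "(\<Sum>n<T. mean n) \<le> 4 * U * B * (a' * sqrt (real T) + b' + 1)"
  \<comment> \<open>\<open>4 * \<Lambda> \<le> T\<close> lets the balancing rate respect the cap 1 /
    (4 * U * B). If it fails, T \<le> 2 * sqrt \<Lambda> * sqrt T, and the trivial bound 2 * U * B
    per round is below the claim.\<close>
  proof (cases "2 \<le> T \<and> 4 * \<Lambda> \<le> real T")
    case True
    have "sqrt \<Lambda> / (2 * U * B * sqrt (real T)) \<le> 1 / (4 * U * B)"
    proof -
      have "sqrt (4 * \<Lambda>) \<le> sqrt (real T)" using True by simp
      then have "2 * sqrt \<Lambda> \<le> sqrt (real T)" by (simp add: real_sqrt_mult)
      then have "sqrt \<Lambda> / sqrt (real T) \<le> 1 / 2" using T by (simp add: pos_divide_le_eq)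
      then have "1 / (2 * (U * B)) * (sqrt \<Lambda> / sqrt (real T)) \<le> 1 / (2 * (U * B)) * (1 / 2)"
        using UB by (intro mult_left_mono) auto
      then show ?thesis by (simp add: mult.assoc)
    qed
    then have r: "rate1 T = sqrt \<Lambda> / (2 * U * B * sqrt (real T))" by (simp add: rate1_def \<Lambda>_def)
    have "2 \<le> T" using True by simp
    have T0: "0 < real T" using T by simp
    have "(\<Sum>n<T. mean n) \<le> 4 * U * B * ((a + sqrt (2 * \<Lambda>)) * sqrt (real T) + (b + 1/2 + \<Lambda>) + 1)"
    proof (rule order.trans[OF cumulative_mean_le[OF rate1_bounds(1)[OF T] dev1[OF \<open>2 \<le> T\<close>]]],
        unfold r radius_root4 \<Lambda>_def[symmetric], rule first_bound[OF U B a b \<Lambda> T0 _ card_over_sessions])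
      show "0 \<le> real (card (rounds i))" for i by simp
    qed
    then show ?thesis by (simp add: a'_def b'_def)
  next
    case False
    have "real T \<le> 2 * (a' * sqrt (real T) + b' + 1)"
    proof (cases "2 \<le> T")
      case True
      then have "real T \<le> 4 * \<Lambda>" using False by simp
      then have "real T * real T \<le> 4 * \<Lambda> * real T" by (rule mult_right_mono) simp
      also have "\<dots> = (sqrt 2 * (sqrt (2 * \<Lambda>) * sqrt (real T)))\<^sup>2"
      proof -
        have "(sqrt (2 * \<Lambda>))\<^sup>2 = 2 * \<Lambda>" "(sqrt (real T))\<^sup>2 = real T" "(sqrt 2)\<^sup>2 = (2::real)"
          using \<Lambda> by simp_all
        then show ?thesis unfolding power_mult_distrib by simp
      qed
      finally have "(real T)\<^sup>2 \<le> (sqrt 2 * (sqrt (2 * \<Lambda>) * sqrt (real T)))\<^sup>2"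
        unfolding power2_eq_square[of "real T"] .
      then have "real T \<le> sqrt 2 * (sqrt (2 * \<Lambda>) * sqrt (real T))"
        by (rule power2_le_imp_le) (use \<Lambda> in simp)
      also have "\<dots> \<le> 2 * (a' * sqrt (real T))"
        using a' \<Lambda> sqrt2_less_2 by (intro mult_mono) auto
      finally show ?thesis using b' by simp
    next
      case False
      then have "T = 1" using T by simp
      then show ?thesis using a' b' by simp
    qed
    then have "2 * (U * B) * real T \<le> 2 * (U * B) * (2 * (a' * sqrt (real T) + b' + 1))"
      using UB by (intro mult_left_mono) auto
    then show ?thesis using trivial by (simp add: mult_ac)
  qed
  then show "(\<Sum>n<T. mean n) \<le> 4 * U * B * ((a + sqrt (2 * conf T)) * sqrt (real T) + (b + 1/2 + conf T) + 1)"
    by (simp add: a'_def b'_def \<Lambda>_def)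
  have "(\<Sum>n<T. mean n) \<le> 2 * H * B * a'\<^sup>2 * m + 4 * U * B * (1 + b')"
  \<comment> \<open>Beyond 8192 = 2^13 one has log 2 T \<ge> 13 and \<Lambda> \<ge> 8, as
    \<open>second_bound\<close> demands. At T = 1 the logarithm vanishes and the term with 1 + b'
    carries the trivial bound.\<close>
  proof (cases "real T \<le> 8192")
    case True
    have "2 * (U * B) * real T \<le> 2 * H * B * a'\<^sup>2 * m + 4 * U * B * (1 + b')"
    proof (cases "2 \<le> T")
      case True
      have m: "0 \<le> m" using True by (simp add: m_def)
      have "ln \<delta> < 0" using \<delta> by simp
      then have "3 * ln (1 + 3 * ln (real T)) \<le> \<Lambda>" by (simp add: \<Lambda>_def conf_def)
      then have "128 * (3 * ln (1 + 3 * ln (real T))) * m \<le> 128 * \<Lambda> * m"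
        using m by (intro mult_right_mono mult_left_mono) auto
      moreover have "real T \<le> 128 * (3 * ln (1 + 3 * ln (real T))) * m"
        unfolding m_def using True \<open>real T \<le> 8192\<close> by (intro small_horizon) simp_all
      ultimately have "real T \<le> 128 * \<Lambda> * m" by (rule order.trans[rotated])
      then have "2 * (U * B) * real T \<le> 2 * (U * B) * (128 * \<Lambda> * m)"
        using UB by (intro mult_left_mono) auto
      also have "\<dots> = 2 * (64 * U) * B * (2 * \<Lambda>) * m" by simp
      also have "\<dots> \<le> 2 * H * B * a'\<^sup>2 * m"
      proof -
        have "2 * \<Lambda> \<le> a'\<^sup>2" using power_mono[OF a'(1), of 2] \<Lambda> by simp
        then show ?thesis using H U B \<Lambda> m by (intro mult_mono) auto
      qed
      also have "2 * H * B * a'\<^sup>2 * m \<le> 2 * H * B * a'\<^sup>2 * m + 4 * U * B * (1 + b')"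
        using U B b' by simp
      finally show ?thesis .
    next
      case False
      then have "T = 1" using T by simp
      have "2 * (U * B) * 1 \<le> 2 * (U * B) * (2 * (1 + b'))"
        using UB b' by (intro mult_left_mono) auto
      then show ?thesis using \<open>T = 1\<close> by (simp add: m_def mult_ac)
    qed
    then show ?thesis using trivial by linarith
  next
    case False
    then have T2: "2 \<le> T" by simp
    have "log 2 (2 ^ 13) \<le> log 2 (real T)" using False by (subst log_le_cancel_iff) auto
    then have m13: "13 \<le> m" by (simp add: m_def log_nat_power del: power_numeral)
    have \<Lambda>8: "8 \<le> \<Lambda>"
    proof -
      have "ln (2 ^ 13) \<le> ln (real T)" using False by (subst ln_le_cancel_iff) auto
      then have "13 * ln 2 \<le> ln (real T)" by (simp add: ln_realpow del: power_numeral)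
      then have "2 ^ 4 \<le> 1 + 3 * ln (real T)" using ln_2_bounds by simp
      then have "ln (2 ^ 4) \<le> ln (1 + 3 * ln (real T))" by (subst ln_le_cancel_iff) auto
      then have "4 * ln 2 \<le> ln (1 + 3 * ln (real T))" by (simp add: ln_realpow del: power_numeral)
      moreover have "ln \<delta> < 0" using \<delta> by simp
      ultimately show ?thesis using ln_2_bounds unfolding \<Lambda>_def conf_def by linarith
    qed
    \<comment> \<open>63 = 45 * 14/10 and 63^2 \<ge> 2^11; for b > 100 the factor exceeds 4096 =
      2^12, whose square is 2^24. If the last session is session 0, m \<ge> 13 gives both.\<close>
    have J: "2 * m \<ge> real last_session + 11" "b > 100 \<Longrightarrow> 2 * m \<ge> real last_session + 24"
    proof -
      have len: "C * 2 powr (real last_session / 2) \<le> real T" if "last_session \<ge> 1" "C \<le> 45 * (b + 14/10)" for C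
      proof -
        have "C * 2 powr (real last_session / 2) \<le> 45 * (b + 14/10) * 2 powr (real last_session / 2)"
          using that(2) by (rule mult_right_mono) simp
        also have "\<dots> \<le> real T" by (rule active_length[OF rounds_last_session[OF T] that(1)])
        finally show ?thesis .
      qed
      show "2 * m \<ge> real last_session + 11"
      proof (cases "last_session \<ge> 1")
        case True
        have "63 * 2 powr (real last_session / 2) \<le> real T" using len[OF True, of 63] b by simp
        from log_length_ge[OF this, of 11] T show ?thesis by (simp add: m_def)
      qed (use m13 in simp)
      show "2 * m \<ge> real last_session + 24" if "b > 100"
      proof (cases "last_session \<ge> 1")
        case True
        have "4096 * 2 powr (real last_session / 2) \<le> real T" using len[OF True, of 4096] that by simp
        from log_length_ge[OF this, of 24] T show ?thesis by (simp add: m_def)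
      qed (use m13 in simp)
    qed
    have r: "rate2 T = sqrt (2 * \<Lambda>) / (B * (H * (a + sqrt (2 * \<Lambda>))) *
        (2 * m + 58/100 * ((b + 1/2 + \<Lambda>) * U / ((a + sqrt (2 * \<Lambda>)) * (H * (a + sqrt (2 * \<Lambda>)))))))"
      by (simp add: rate2_def Let_def \<Lambda>_def H_def m_def)
    have "(\<Sum>n<T. mean n) \<le> 2 * H * B * (a + sqrt (2 * \<Lambda>))\<^sup>2 * m + 4 * U * B * (b + 1/2 + \<Lambda>)"
    proof (rule order.trans[OF cumulative_mean_le[OF rate2_bounds(1)[OF T2] dev2[OF T2]]], unfold r radius_root4 \<Lambda>_def[symmetric],
        rule second_bound[OF U B a b \<Lambda>8 H])
      show "0 < m" using m13 by simp
      show "real (card (rounds i)) = 0 \<or> 1 \<le> real (card (rounds i))" for i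
        by (cases "card (rounds i)") auto
      show "U * (root4\<^sup>2) ^ i * (real (card (rounds i)) - 1)
          \<le> H * ((a + sqrt (2 * \<Lambda>)) * sqrt (real (card (rounds i)) - 1) + (b + 1/2 + \<Lambda>))"
        if "1 \<le> real (card (rounds i))" for i
      proof -
        have "rounds i \<noteq> {}" using that by auto
        from session_length_le[OF this T2] show ?thesis
          unfolding radius_root4 H_def \<Lambda>_def conf_def .
      qed
    qed (use J in auto)
    then show ?thesis using UB by (simp add: a'_def b'_def algebra_simps)
  qed
  then show "(\<Sum>n<T. mean n) \<le> 2 * (16 * real d0 * B / \<alpha>) * B * (a + sqrt (2 * conf T))\<^sup>2 * log 2 (real T)
      + 4 * U * B * (1 + (b + 1/2 + conf T))"
    by (simp add: a'_def b'_def \<Lambda>_def H_def m_def)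
qed

section \<open>Probability of the controlled runs\<close>

locale saew_losses = loss_model M loss grad \<theta>s \<alpha> U B + saew S a b \<alpha> U B \<delta> d0
  for M :: "'w measure" and loss :: "nat \<Rightarrow> 'w \<Rightarrow> real ^ 'd \<Rightarrow> real" and grad \<theta>s \<alpha> U B
    and S :: "('d::finite) subroutine" and a b \<delta> d0 +
  fixes \<theta>h :: "nat \<Rightarrow> 'w \<Rightarrow> real ^ 'd"
  assumes sparse: "l0_norm \<theta>s \<le> d0"
    and adapted: "\<And>t. \<theta>h t \<in> borel_measurable (F t)"
    and run: "\<And>\<omega>. \<omega> \<in> space M \<Longrightarrow>
      saew_run S a b d0 \<alpha> U B \<delta> (\<lambda>t. grad (loss t \<omega>) (\<theta>h (t - 1) \<omega>)) (\<lambda>t. \<theta>h t \<omega>)"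
begin

section \<open>Measurability of sessions and guards\<close>

definition G :: "'w \<Rightarrow> nat \<Rightarrow> real ^ 'd" where
  "G \<omega> t = grad (loss t \<omega>) (\<theta>h (t - 1) \<omega>)"

lemma measurable_G: "1 \<le> t \<Longrightarrow> t \<le> n \<Longrightarrow> (\<lambda>\<omega>. G \<omega> t) \<in> borel_measurable (F n)"
  unfolding G_def by (intro measurable_grad_joint measurable_loss_F measurable_F_mono[OF adapted]) auto

lemma measurable_acc:
  assumes "1 \<le> s"
  shows "(\<lambda>\<omega>. acc (G \<omega>) i s n) \<in> borel_measurable (F n)"
proof -
  have "(\<lambda>\<omega>. \<Sum>r=s..n. (infnorm (G \<omega> r))\<^sup>2) \<in> borel_measurable (F n)"
    using assms
    by (intro borel_measurable_sum borel_measurable_power measurable_compose[OF measurable_G borel_measurable_infnorm])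
       auto
  then show ?thesis
    unfolding acc_def saew_err_def
    by (intro borel_measurable_times borel_measurable_const borel_measurable_add
        measurable_compose[OF _ borel_measurable_sqrt])
qed

text \<open>The state takes countably many values, so the recursion step can be checked for each
  fixed previous state p.\<close>

lemma measurable_sess: "(\<lambda>\<omega>. sess (G \<omega>) n) \<in> measurable (F n) (count_space UNIV)"
proof (induction n)
  case (Suc n)
  define st where "st p e = (if radius (Suc (fst p)) < e then p else (LEAST j. radius (Suc j) < e, Suc (Suc n)))"
    for p :: "nat \<times> nat" and e :: real
  have st: "st p \<in> measurable borel (count_space UNIV)" for p
  proof -
    have "(\<lambda>e :: real. LEAST j. radius (Suc j) < e) \<in> measurable borel (count_space UNIV)"
      by measurable
    from measurable_compose[OF this measurable_count_space, of "\<lambda>j. (j, Suc (Suc n))"]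
    have "(\<lambda>e :: real. (LEAST j. radius (Suc j) < e, Suc (Suc n))) \<in> measurable borel (count_space UNIV)"
      by simp
    then show ?thesis
      unfolding st_def by (intro measurable_If measurable_const) auto
  qed
  \<comment> \<open>\<open>max 1\<close> keeps the start positive for values p that never occur, as
    \<open>measurable_acc\<close> demands; on actual states it changes nothing.\<close>
  have "(\<lambda>\<omega>. st p (acc (G \<omega>) (fst p) (max 1 (snd p)) (Suc n))) \<in> measurable (F (Suc n)) (count_space UNIV)" for p
    by (rule measurable_compose[OF measurable_acc st]) simp
  from measurable_compose_countable[OF this measurable_F_mono[OF Suc.IH, of "Suc n"]]
  have "(\<lambda>\<omega>. st (sess (G \<omega>) n) (acc (G \<omega>) (fst (sess (G \<omega>) n)) (max 1 (snd (sess (G \<omega>) n))) (Suc n)))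
      \<in> measurable (F (Suc n)) (count_space UNIV)" by simp
  moreover have "st (sess (G \<omega>) n) (acc (G \<omega>) (fst (sess (G \<omega>) n)) (max 1 (snd (sess (G \<omega>) n))) (Suc n)) =
      sess (G \<omega>) (Suc n)" for \<omega>
  proof -
    have "max 1 (snd (sess (G \<omega>) n)) = snd (sess (G \<omega>) n)" using sess_start[of "G \<omega>" n] by simp
    then show ?thesis by (simp add: st_def sess.simps(2) Let_def split_beta)
  qed
  ultimately show ?case by simp
qed simp

text \<open>Predictable: it depends on the gradients up to round m, whereas the increment that it
  guards uses loss m + 1.\<close>

definition guard :: "(nat \<Rightarrow> bool) \<Rightarrow> real \<Rightarrow> nat \<Rightarrow> 'w \<Rightarrow> bool" where
  "guard P R m \<omega> \<longleftrightarrow> P (fst (sess (G \<omega>) m)) \<and> l1_norm (\<theta>h m \<omega>) \<le> 2 * U \<and> l1_norm (\<theta>h m \<omega> - \<theta>s) \<le> R"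

definition guarded_sum :: "(nat \<Rightarrow> bool) \<Rightarrow> real \<Rightarrow> real \<Rightarrow> real \<Rightarrow> nat \<Rightarrow> 'w \<Rightarrow> real" where
  "guarded_sum P R \<kappa> C n \<omega> = (\<Sum>m<n. if guard P R m \<omega>
     then \<kappa> * (slope (\<theta>h m \<omega>) (\<theta>h m \<omega> - \<theta>s) - G \<omega> (Suc m) \<bullet> (\<theta>h m \<omega> - \<theta>s))
       - C * (\<kappa> * (G \<omega> (Suc m) \<bullet> (\<theta>h m \<omega> - \<theta>s)))\<^sup>2
     else 0)"

lemma guarded_deviation:
  assumes \<kappa>: "0 \<le> \<kappa>" "\<kappa> * (B * R) \<le> \<eta>"
    and C: "1/2 \<le> C" and \<eta>: "0 \<le> \<eta>" "\<eta> < 1" "0 \<le> ln (1 - \<eta>) + \<eta> + C * \<eta>\<^sup>2"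
  shows "{\<omega> \<in> space M. \<exists>n\<le>N. \<Lambda> \<le> guarded_sum P R \<kappa> C n \<omega>} \<in> sets M"
    and "prob {\<omega> \<in> space M. \<exists>n\<le>N. \<Lambda> \<le> guarded_sum P R \<kappa> C n \<omega>} \<le> exp (- \<Lambda>)"
proof -
  define \<rho> where "\<rho> m \<omega> = (if guard P R m \<omega> then \<kappa> else 0)" for m \<omega>
  have \<rho>: "\<rho> m \<in> borel_measurable (F m)" for m
  proof -
    have 1: "(\<lambda>\<omega>. sess (G \<omega>) m) -` {p. P (fst p)} \<inter> space (F m) \<in> sets (F m)"
      by (rule measurable_sets[OF measurable_sess]) simp
    have 2: "{\<omega> \<in> space (F m). l1_norm (\<theta>h m \<omega>) \<le> 2 * U} \<in> sets (F m)"
      by (intro borel_measurable_le borel_measurable_const measurable_compose[OF adapted borel_measurable_l1_norm])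
    have 3: "{\<omega> \<in> space (F m). l1_norm (\<theta>h m \<omega> - \<theta>s) \<le> R} \<in> sets (F m)"
      by (intro borel_measurable_le borel_measurable_const borel_measurable_diff adapted
          measurable_compose[OF _ borel_measurable_l1_norm])
    note sets.Int[OF sets.Int[OF 1 2] 3]
    moreover have "(\<lambda>\<omega>. sess (G \<omega>) m) -` {p. P (fst p)} \<inter> space (F m) \<inter>
        {\<omega> \<in> space (F m). l1_norm (\<theta>h m \<omega>) \<le> 2 * U} \<inter>
        {\<omega> \<in> space (F m). l1_norm (\<theta>h m \<omega> - \<theta>s) \<le> R} = {\<omega> \<in> space (F m). guard P R m \<omega>}"
      by (auto simp: guard_def)
    ultimately show ?thesis
      unfolding \<rho>_def by (intro measurable_If borel_measurable_const) simp_all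
  qed
  have bound: "l1_norm (\<theta>h m \<omega>) \<le> 2 * U \<and> \<bar>\<rho> m \<omega>\<bar> * (B * l1_norm (\<theta>h m \<omega> - \<theta>s)) \<le> \<eta>"
    if "\<rho> m \<omega> \<noteq> 0" for m \<omega>
  proof -
    have g: "guard P R m \<omega>" using that by (auto simp: \<rho>_def split: if_splits)
    then have "\<kappa> * (B * l1_norm (\<theta>h m \<omega> - \<theta>s)) \<le> \<kappa> * (B * R)"
      using \<kappa>(1) B by (intro mult_left_mono) (auto simp: guard_def)
    then have "\<kappa> * (B * l1_norm (\<theta>h m \<omega> - \<theta>s)) \<le> \<eta>" using \<kappa>(2) by linarith
    then show ?thesis using g \<kappa>(1) by (simp add: \<rho>_def guard_def)
  qed
  have eq: "guarded_sum P R \<kappa> C n \<omega> =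
      (\<Sum>m<n. \<rho> m \<omega> * (slope (\<theta>h m \<omega>) (\<theta>h m \<omega> - \<theta>s) - grad (loss (Suc m) \<omega>) (\<theta>h m \<omega>) \<bullet> (\<theta>h m \<omega> - \<theta>s))
        - C * (\<rho> m \<omega> * (grad (loss (Suc m) \<omega>) (\<theta>h m \<omega>) \<bullet> (\<theta>h m \<omega> - \<theta>s)))\<^sup>2)" for n \<omega>
    unfolding guarded_sum_def by (intro sum.cong refl) (simp add: \<rho>_def G_def)
  show "{\<omega> \<in> space M. \<exists>n\<le>N. \<Lambda> \<le> guarded_sum P R \<kappa> C n \<omega>} \<in> sets M"
    unfolding eq by (rule deviation(1)[OF adapted \<rho> bound C \<eta>])
  show "prob {\<omega> \<in> space M. \<exists>n\<le>N. \<Lambda> \<le> guarded_sum P R \<kappa> C n \<omega>} \<le> exp (- \<Lambda>)"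
    unfolding eq by (rule deviation(2)[OF adapted \<rho> bound C \<eta>])
qed

section \<open>The exceptional events and their probability\<close>

definition session_event :: "nat \<Rightarrow> nat \<times> nat \<Rightarrow> 'w set" where
  "session_event T p = (case p of (i, k) \<Rightarrow>
     {\<omega> \<in> space M. \<exists>n\<le>T. penalty k - ln (\<delta> / (real i + 2)\<^sup>2) \<le>
        guarded_sum (\<lambda>j. j = i) (2 * radius i) (rate k / (2 * radius i * B)) (curv k) n \<omega>})"

text \<open>At T = 1, \<open>conf T\<close> is - ln \<delta> and the event might consume all of
  \<delta>; it is empty there, and horizon 1 rests on the trivial bound.\<close>

definition total_event :: "nat \<Rightarrow> real \<Rightarrow> 'w set" where
  "total_event T \<nu> = {\<omega> \<in> space M. 2 \<le> T \<and> (\<exists>n\<le>T. conf T \<le> guarded_sum (\<lambda>_. True) (2 * U) \<nu> 1 n \<omega>)}"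

definition bad_event :: "nat \<Rightarrow> 'w set" where
  "bad_event T = (\<Union>p\<in>{..<Suc T} \<times> {..<Suc T}. session_event T p)
     \<union> total_event T (rate1 T) \<union> total_event T (rate2 T)"

lemma session_event:
  "session_event T (i, k) \<in> sets M" "prob (session_event T (i, k)) \<le> \<delta> * (1 / (real i + 2)\<^sup>2 * exp (- penalty k))"
proof -
  have \<kappa>: "0 \<le> rate k / (2 * radius i * B)" "rate k / (2 * radius i * B) * (B * (2 * radius i)) \<le> rate k"
    using rate_pos[of k] radius_pos[of i] B by simp_all
  note dev = guarded_deviation[OF \<kappa> curv_ge less_imp_le[OF rate_pos] rate_less_1 rate_curv]
  show "session_event T (i, k) \<in> sets M"
    unfolding session_event_def prod.case by (rule dev(1))
  have "prob (session_event T (i, k)) \<le> exp (- (penalty k - ln (\<delta> / (real i + 2)\<^sup>2)))"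
    unfolding session_event_def prod.case by (rule dev(2))
  also have "\<dots> = exp (- penalty k) * exp (ln (\<delta> / (real i + 2)\<^sup>2))"
  proof -
    have "- (penalty k - ln (\<delta> / (real i + 2)\<^sup>2)) = - penalty k + ln (\<delta> / (real i + 2)\<^sup>2)" by simp
    then show ?thesis by (simp only: exp_add)
  qed
  also have "\<dots> = \<delta> * (1 / (real i + 2)\<^sup>2 * exp (- penalty k))"
    using \<delta> by (subst exp_ln) auto
  finally show "prob (session_event T (i, k)) \<le> \<delta> * (1 / (real i + 2)\<^sup>2 * exp (- penalty k))" .
qed

text \<open>The condition on the quadratic bound with \<eta> = 1/2 and curvature constant 1 amounts
  to ln 2 \<le> 3/4.\<close>

lemma total_event:
  assumes "0 \<le> \<nu>" "\<nu> * (B * (2 * U)) \<le> 1/2"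
  shows "total_event T \<nu> \<in> sets M" "prob (total_event T \<nu>) \<le> 175/1000 * \<delta>"
proof -
  have "ln (1 - 1/2 :: real) = - ln 2" by (simp add: ln_div)
  then have half: "0 \<le> ln (1 - 1/2) + 1/2 + 1 * (1/2 :: real)\<^sup>2"
    using ln_2_bounds by (simp add: power2_eq_square)
  have bounds: "(1/2 :: real) \<le> 1" "(0 :: real) \<le> 1/2" "(1/2 :: real) < 1" by simp_all
  note dev = guarded_deviation[OF assms bounds half]
  have eq: "total_event T \<nu> = (if 2 \<le> T
      then {\<omega> \<in> space M. \<exists>n\<le>T. conf T \<le> guarded_sum (\<lambda>_. True) (2 * U) \<nu> 1 n \<omega>} else {})"
    unfolding total_event_def by (cases "2 \<le> T") simp_all
  show "total_event T \<nu> \<in> sets M"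
    unfolding eq by (cases "2 \<le> T") (simp_all only: if_True if_False dev(1) sets.empty_sets)
  show "prob (total_event T \<nu>) \<le> 175/1000 * \<delta>"
  proof (cases "2 \<le> T")
    case True
    have "prob (total_event T \<nu>) \<le> exp (- conf T)"
      unfolding eq if_P[OF True] by (rule dev(2))
    also have "\<dots> \<le> 175/1000 * \<delta>" by (rule exp_conf_le[OF True])
    finally show ?thesis .
  next
    case False
    then show ?thesis unfolding eq if_not_P[OF False] using \<delta> by simp
  qed
qed

text \<open>The sum over pairs of session and rate factors into at most 65/100 times 1, which leaves
  175/1000 for each of the two total deviations.\<close>

lemma bad_event:
  assumes T: "1 \<le> T"
  shows "bad_event T \<in> sets M" "prob (bad_event T) \<le> \<delta>"
proof -
  have \<nu>: "0 \<le> rate1 T" "rate1 T * (B * (2 * U)) \<le> 1/2" using rate1_bounds[OF T] by auto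
  have E2: "total_event T (rate2 T) \<in> sets M" "prob (total_event T (rate2 T)) \<le> 175/1000 * \<delta>"
  proof -
    have "total_event T (rate2 T) \<in> sets M \<and> prob (total_event T (rate2 T)) \<le> 175/1000 * \<delta>"
    proof (cases "2 \<le> T")
      case True
      then show ?thesis using total_event[of "rate2 T" T] rate2_bounds[OF True] by simp
    qed (use \<delta> in \<open>simp add: total_event_def\<close>)
    then show "total_event T (rate2 T) \<in> sets M" "prob (total_event T (rate2 T)) \<le> 175/1000 * \<delta>" by auto
  qed
  note E1 = total_event[OF \<nu>, of T]
  define I where "I = {..<Suc T} \<times> {..<Suc T}"
  have fin: "finite I" by (simp add: I_def)
  have sets: "session_event T ` I \<subseteq> sets M" using session_event(1) by auto
  have E0: "(\<Union>p\<in>I. session_event T p) \<in> sets M" using fin sets by (intro sets.finite_UN) auto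
  show "bad_event T \<in> sets M"
    unfolding bad_event_def I_def[symmetric] using E0 E1(1) E2(1) by (intro sets.Un)
  have "prob (\<Union>p\<in>I. session_event T p) \<le> (\<Sum>p\<in>I. prob (session_event T p))"
    by (rule finite_measure_subadditive_finite[OF fin sets])
  also have "\<dots> \<le> (\<Sum>p\<in>I. \<delta> * (1 / (real (fst p) + 2)\<^sup>2 * exp (- penalty (snd p))))"
    using session_event(2) by (intro sum_mono) auto
  also have "\<dots> = \<delta> * (\<Sum>p\<in>I. 1 / (real (fst p) + 2)\<^sup>2 * exp (- penalty (snd p)))"
    by (rule sum_distrib_left[symmetric])
  also have "(\<Sum>p\<in>I. 1 / (real (fst p) + 2)\<^sup>2 * exp (- penalty (snd p))) =
      (\<Sum>i<Suc T. 1 / (real i + 2)\<^sup>2) * (\<Sum>k<Suc T. exp (- penalty k))"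
    unfolding I_def sum_product sum.cartesian_product case_prod_unfold ..
  also have "\<delta> * ((\<Sum>i<Suc T. 1 / (real i + 2)\<^sup>2) * (\<Sum>k<Suc T. exp (- penalty k))) \<le> \<delta> * (65/100 * 1)"
  proof (rule mult_left_mono)
    show "(\<Sum>i<Suc T. 1 / (real i + 2)\<^sup>2) * (\<Sum>k<Suc T. exp (- penalty k)) \<le> 65/100 * 1"
      by (rule mult_mono[OF sum_inverse_squares sum_exp_penalty]) (simp, intro sum_nonneg, simp)
  qed (use \<delta> in simp)
  finally have E0': "prob (\<Union>p\<in>I. session_event T p) \<le> \<delta> * (65/100)" by simp
  have "prob (bad_event T) \<le> prob ((\<Union>p\<in>I. session_event T p) \<union> total_event T (rate1 T)) + prob (total_event T (rate2 T))"
    unfolding bad_event_def I_def[symmetric] using E0 E1(1) E2(1) by (intro measure_Un_le sets.Un)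
  also have "prob ((\<Union>p\<in>I. session_event T p) \<union> total_event T (rate1 T)) \<le>
      prob (\<Union>p\<in>I. session_event T p) + prob (total_event T (rate1 T))"
    using E0 E1(1) by (intro measure_Un_le sets.Un)
  finally show "prob (bad_event T) \<le> \<delta>" using E0' E1(2) E2(2) by linarith
qed

text \<open>The excess risk of each round is dominated by its directional mean \<open>slope\<close>,
  the quantity that the analysis of a good run bounds.\<close>

lemma good_path:
  assumes T: "1 \<le> T" and \<omega>: "\<omega> \<in> space M" "\<omega> \<notin> bad_event T"
    and B': "\<forall>t\<ge>1. \<forall>\<theta>. l1_norm \<theta> \<le> 2 * U \<longrightarrow> infnorm (grad (loss t \<omega>) \<theta>) \<le> B"
  shows "(\<Sum>n<T. risk (\<theta>h n \<omega>) - risk \<theta>s)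
    \<le> min (4 * U * B * ((a + sqrt (2 * conf T)) * sqrt (real T) + (b + 1/2 + conf T) + 1))
          (2 * (16 * real d0 * B / \<alpha>) * B * (a + sqrt (2 * conf T))\<^sup>2 * log 2 (real T)
            + 4 * U * B * (1 + (b + 1/2 + conf T)))"
proof -
  define mean where "mean n = slope (\<theta>h n \<omega>) (\<theta>h n \<omega> - \<theta>s)" for n
  have run': "saew_run S a b d0 \<alpha> U B \<delta> (G \<omega>) (\<lambda>t. \<theta>h t \<omega>)"
    using run[OF \<omega>(1)] unfolding G_def .
  obtain c \<theta>a where path: "\<theta>a 0 = 0"
    "\<And>n i s. sess (G \<omega>) n = (i, s) \<Longrightarrow> is_truncation d0 (\<theta>a (s - 1)) (c i)"
    "\<And>n i s. sess (G \<omega>) n = (i, s) \<Longrightarrow> \<theta>h n \<omega> = S B s (c i) (radius i) (map (G \<omega>) [s..<Suc n])"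
    "\<And>n i s. sess (G \<omega>) n = (i, s) \<Longrightarrow>
       \<theta>a (Suc n) = (1 / real (Suc n - s + 1)) *\<^sub>R (\<Sum>r=s..Suc n. \<theta>h (r - 1) \<omega>)"
    by (rule run_rounds[OF run']) blast
  interpret path: saew_good_path S a b \<alpha> U B \<delta> d0 "G \<omega>" "\<lambda>n. \<theta>h n \<omega>" c \<theta>a \<theta>s mean T
  proof (unfold_locales)
    show "infnorm (G \<omega> (Suc n)) \<le> B" if "l1_norm (\<theta>h n \<omega>) \<le> 2 * U" for n
      using B' that by (simp add: G_def)
    show "2 * \<alpha> * (norm (\<theta>h n \<omega> - \<theta>s))\<^sup>2 \<le> mean n" if "l1_norm (\<theta>h n \<omega>) \<le> 2 * U" for n
      unfolding mean_def by (rule slope_ge(2)[OF that])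
    fix i k n assume le: "i \<le> T" "k \<le> T" "n \<le> T"
    then have "\<omega> \<notin> session_event T (i, k)" using \<omega>(2) by (auto simp: bad_event_def)
    then have "\<not> penalty k - ln (\<delta> / (real i + 2)\<^sup>2) \<le>
        guarded_sum (\<lambda>j. j = i) (2 * radius i) (rate k / (2 * radius i * B)) (curv k) n \<omega>"
      using \<omega>(1) le(3) unfolding session_event_def prod.case by blast
    then have "guarded_sum (\<lambda>j. j = i) (2 * radius i) (rate k / (2 * radius i * B)) (curv k) n \<omega>
        \<le> penalty k - ln (\<delta> / (real i + 2)\<^sup>2)" by linarith
    then show "(\<Sum>m<n. if fst (sess (G \<omega>) m) = i \<and> l1_norm (\<theta>h m \<omega>) \<le> 2 * U \<and> l1_norm (\<theta>h m \<omega> - \<theta>s) \<le> 2 * radius i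
         then rate k / (2 * radius i * B) * (mean m - G \<omega> (Suc m) \<bullet> (\<theta>h m \<omega> - \<theta>s))
           - curv k * (rate k / (2 * radius i * B) * (G \<omega> (Suc m) \<bullet> (\<theta>h m \<omega> - \<theta>s)))\<^sup>2
         else 0) \<le> penalty k - ln (\<delta> / (real i + 2)\<^sup>2)"
      unfolding guarded_sum_def guard_def mean_def .
  qed (fact path sparse \<theta>s_l1)+
  have dev: "(\<Sum>m<T. if l1_norm (\<theta>h m \<omega>) \<le> 2 * U \<and> l1_norm (\<theta>h m \<omega> - \<theta>s) \<le> 2 * U
         then \<nu> * (mean m - G \<omega> (Suc m) \<bullet> (\<theta>h m \<omega> - \<theta>s)) - (\<nu> * (G \<omega> (Suc m) \<bullet> (\<theta>h m \<omega> - \<theta>s)))\<^sup>2 else 0) \<le> conf T"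
    if "\<omega> \<notin> total_event T \<nu>" "2 \<le> T" for \<nu>
  proof -
    have "\<not> conf T \<le> guarded_sum (\<lambda>_. True) (2 * U) \<nu> 1 T \<omega>"
      using that \<omega>(1) unfolding total_event_def by blast
    then have "guarded_sum (\<lambda>_. True) (2 * U) \<nu> 1 T \<omega> \<le> conf T" by linarith
    then show ?thesis unfolding guarded_sum_def guard_def mean_def simp_thms mult_1 .
  qed
  have risk_le: "(\<Sum>n<T. risk (\<theta>h n \<omega>) - risk \<theta>s) \<le> (\<Sum>n<T. mean n)"
  proof (rule sum_mono)
    fix n assume "n \<in> {..<T}"
    then have "Suc n \<in> path.rounds (fst (sess (G \<omega>) n))" by (simp add: path.rounds_def)
    from path.round_bounds(1)[OF this] show "risk (\<theta>h n \<omega>) - risk \<theta>s \<le> mean n"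
      unfolding mean_def by (intro slope_ge(1)) simp
  qed
  have mean_le: "mean n \<le> B * l1_norm (\<theta>h n \<omega> - \<theta>s)" if "l1_norm (\<theta>h n \<omega>) \<le> 2 * U" for n
    unfolding mean_def by (rule slope_le[OF that])
  have good: "\<omega> \<notin> total_event T (rate1 T)" "\<omega> \<notin> total_event T (rate2 T)"
    using \<omega>(2) unfolding bad_event_def by auto
  note cumulative = path.cumulative_bounds[OF T mean_le dev[OF good(1)] dev[OF good(2)]]
  show ?thesis
    using order.trans[OF risk_le cumulative(1)] order.trans[OF risk_le cumulative(2)]
    by (rule min.boundedI)
qed

lemma bounded_predictions:
  assumes "\<omega> \<in> space M"
  shows "l1_norm (\<theta>h n \<omega>) \<le> U * (real n + 1)"
proof -
  have run': "saew_run S a b d0 \<alpha> U B \<delta> (G \<omega>) (\<lambda>t. \<theta>h t \<omega>)"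
    using run[OF assms] unfolding G_def .
  obtain c \<theta>a where path: "\<theta>a 0 = 0"
    "\<And>n i s. sess (G \<omega>) n = (i, s) \<Longrightarrow> is_truncation d0 (\<theta>a (s - 1)) (c i)"
    "\<And>n i s. sess (G \<omega>) n = (i, s) \<Longrightarrow> \<theta>h n \<omega> = S B s (c i) (radius i) (map (G \<omega>) [s..<Suc n])"
    "\<And>n i s. sess (G \<omega>) n = (i, s) \<Longrightarrow>
       \<theta>a (Suc n) = (1 / real (Suc n - s + 1)) *\<^sub>R (\<Sum>r=s..Suc n. \<theta>h (r - 1) \<omega>)"
    by (rule run_rounds[OF run']) blast
  interpret path: saew_run_path S a b \<alpha> U B \<delta> d0 "G \<omega>" "\<lambda>n. \<theta>h n \<omega>" c \<theta>a
    by unfold_locales (fact path)+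
  show ?thesis by (rule path.prediction_le)
qed

lemma measurable_excess_risk:
  "(\<lambda>\<omega>. \<Sum>t=1..T. excess_risk M loss \<theta>s t (\<theta>h (t - 1)) \<omega>) \<in> borel_measurable M"
  unfolding excess_risk_def
  by (intro borel_measurable_sum borel_measurable_diff borel_measurable_const borel_measurable_cond_exp2)

lemma prob_excess_risk_mono:
  assumes "x \<le> y"
  shows "prob {\<omega> \<in> space M. (\<Sum>t=1..T. excess_risk M loss \<theta>s t (\<theta>h (t - 1)) \<omega>) \<le> x}
    \<le> prob {\<omega> \<in> space M. (\<Sum>t=1..T. excess_risk M loss \<theta>s t (\<theta>h (t - 1)) \<omega>) \<le> y}"
proof (rule finite_measure_mono)
  show "{\<omega> \<in> space M. (\<Sum>t=1..T. excess_risk M loss \<theta>s t (\<theta>h (t - 1)) \<omega>) \<le> x}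
    \<subseteq> {\<omega> \<in> space M. (\<Sum>t=1..T. excess_risk M loss \<theta>s t (\<theta>h (t - 1)) \<omega>) \<le> y}"
    using assms by (blast intro: order.trans)
qed (rule borel_measurable_le[OF measurable_excess_risk borel_measurable_const])

lemma cumulative_excess_risk:
  assumes T: "1 \<le> T"
  shows "1 - \<delta> \<le> prob {\<omega> \<in> space M.
    (\<Sum>t=1..T. excess_risk M loss \<theta>s t (\<theta>h (t - 1)) \<omega>)
      \<le> min (4 * U * B * ((a + sqrt (2 * conf T)) * sqrt (real T) + (b + 1/2 + conf T) + 1))
            (2 * (16 * real d0 * B / \<alpha>) * B * (a + sqrt (2 * conf T))\<^sup>2 * log 2 (real T)
              + 4 * U * B * (1 + (b + 1/2 + conf T)))}"
    (is "_ \<le> prob ?A")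
proof -
  have A: "?A \<in> sets M" by (rule borel_measurable_le[OF measurable_excess_risk borel_measurable_const])
  have "AE \<omega> in M. \<forall>n. excess_risk M loss \<theta>s (Suc n) (\<theta>h n) \<omega> = risk (\<theta>h n \<omega>) - risk \<theta>s"
    unfolding AE_all_countable by (intro allI, rule excess_risk_eq[OF adapted bounded_predictions])
  moreover note grad_bounded
  ultimately have "AE \<omega> in M. \<omega> \<in> space M - bad_event T \<longrightarrow> \<omega> \<in> ?A"
  proof eventually_elim
    fix \<omega>
    assume risk: "\<forall>n. excess_risk M loss \<theta>s (Suc n) (\<theta>h n) \<omega> = risk (\<theta>h n \<omega>) - risk \<theta>s"
      and B': "\<forall>t\<ge>1. \<forall>\<theta>. l1_norm \<theta> \<le> 2 * U \<longrightarrow> infnorm (grad (loss t \<omega>) \<theta>) \<le> B"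
    show "\<omega> \<in> space M - bad_event T \<longrightarrow> \<omega> \<in> ?A"
    proof
      assume \<omega>: "\<omega> \<in> space M - bad_event T"
      have "(\<Sum>t=1..T. excess_risk M loss \<theta>s t (\<theta>h (t - 1)) \<omega>) = (\<Sum>n<T. risk (\<theta>h n \<omega>) - risk \<theta>s)"
        using risk by (simp add: sum.atLeast1_atMost_eq)
      then show "\<omega> \<in> ?A" using good_path[OF T _ _ B'] \<omega> by simp
    qed
  qed
  then have "prob (space M - bad_event T) \<le> prob ?A"
    by (rule finite_measure_mono_AE[OF _ A])
  moreover have "prob (space M - bad_event T) = 1 - prob (bad_event T)"
    by (rule prob_compl[OF bad_event(1)[OF T]])
  ultimately show ?thesis using bad_event(2)[OF T] by linarith
qed

end

theorem theorem2:
  fixes M :: "'w measure"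
    and loss :: "nat \<Rightarrow> 'w \<Rightarrow> real ^ 'd \<Rightarrow> real"
    and grad :: "(real ^ 'd \<Rightarrow> real) \<Rightarrow> real ^ 'd \<Rightarrow> real ^ 'd"
    and S :: "('d::finite) subroutine"
    and \<theta>s :: "real ^ 'd"
    and \<theta>h :: "nat \<Rightarrow> 'w \<Rightarrow> real ^ 'd"
    and \<alpha> U B \<delta> a b :: real
    and d0 T :: nat
  assumes "prob_space M"
    and grad: "subgradient_oracle grad"
    and indep: "prob_space.indep_vars M (\<lambda>_. loss_space) loss {1..}"
    and ident: "\<And>t. t \<ge> 1 \<Longrightarrow> distr M loss_space (loss t) = distr M loss_space (loss 1)"
    and risk_finite: "\<And>t \<theta>. t \<ge> 1 \<Longrightarrow> integrable M (\<lambda>\<omega>. loss t \<omega> \<theta>)"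
    and "\<alpha> > 0"
    and strong_convexity:
      "\<And>t \<theta>1 \<theta>2. t \<ge> 1 \<Longrightarrow>
         (\<integral>\<omega>. loss t \<omega> \<theta>1 - loss t \<omega> \<theta>2 \<partial>M)
           \<le> (\<integral>\<omega>. grad (loss t \<omega>) \<theta>1 \<partial>M) \<bullet> (\<theta>1 - \<theta>2) - \<alpha> * (norm (\<theta>1 - \<theta>2))\<^sup>2"
    and unique_minimizer:
      "\<And>t \<theta>. t \<ge> 1 \<Longrightarrow>
         is_arg_min (\<lambda>\<theta>'. \<integral>\<omega>. loss t \<omega> \<theta>' \<partial>M) (\<lambda>_. True) \<theta> \<longleftrightarrow> \<theta> = \<theta>s"
    and "d0 \<ge> 1" "U > 0" "B > 0"
    and "l0_norm \<theta>s \<le> d0" "l1_norm \<theta>s \<le> U"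
    and grad_bounded:
      "AE \<omega> in M. \<forall>t\<ge>1. \<forall>\<theta>. l1_norm \<theta> \<le> 2 * U \<longrightarrow> infnorm (grad (loss t \<omega>) \<theta>) \<le> B"
    and "0 < \<delta>" "\<delta> < 1" "T \<ge> 1"
    and "a \<ge> 0" "b \<ge> 0" "regret_bound S a b"
    and adapted: "\<And>t. \<theta>h t \<in> borel_measurable (past M loss t)"
    and run: "\<And>\<omega>. \<omega> \<in> space M \<Longrightarrow>
      saew_run S a b d0 \<alpha> U B \<delta> (\<lambda>t. grad (loss t \<omega>) (\<theta>h (t - 1) \<omega>)) (\<lambda>t. \<theta>h t \<omega>)"
  defines "a' \<equiv> a + sqrt (6 * ln (1 + 3 * ln (real T)) - 2 * ln \<delta>)"
    and "b' \<equiv> b + 1/2 + 3 * ln (1 + 3 * ln (real T)) - ln \<delta>"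
  shows "measure M {\<omega> \<in> space M.
      (\<Sum>t=1..T. excess_risk M loss \<theta>s t (\<theta>h (t - 1)) \<omega>)
        \<le> min (4 * U * B * (a' * sqrt (real T) + b' + 1))
              (2 ^ 5 * real d0 * B\<^sup>2 / \<alpha> * a'\<^sup>2 * log 2 (real T) + 4 * U * B * (1 + b')
               + \<alpha> * U\<^sup>2 / (8 * real d0))}
    \<ge> 1 - \<delta>"
proof -
  interpret prob_space M by fact
  interpret loss_model M loss grad \<theta>s \<alpha> U B
  proof unfold_locales
    show "indep_vars (\<lambda>_. loss_space) loss {1..}" by (rule indep)
    show "distr M loss_space (loss t) = distr M loss_space (loss 1)" if "t \<ge> 1" for t by (rule ident[OF that])
    show "subgradient_oracle grad" by (rule grad)
    show "integrable M (\<lambda>\<omega>. loss 1 \<omega> \<theta>)" for \<theta> by (rule risk_finite) simp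
    show "(\<integral>\<omega>. loss 1 \<omega> \<theta>1 - loss 1 \<omega> \<theta>2 \<partial>M)
        \<le> (\<integral>\<omega>. grad (loss 1 \<omega>) \<theta>1 \<partial>M) \<bullet> (\<theta>1 - \<theta>2) - \<alpha> * (norm (\<theta>1 - \<theta>2))\<^sup>2" for \<theta>1 \<theta>2
      by (rule strong_convexity) simp
    have "is_arg_min (\<lambda>\<theta>'. \<integral>\<omega>. loss 1 \<omega> \<theta>' \<partial>M) (\<lambda>_. True) \<theta>s"
      using unique_minimizer[of 1 \<theta>s] by simp
    then show "(\<integral>\<omega>. loss 1 \<omega> \<theta>s \<partial>M) \<le> (\<integral>\<omega>. loss 1 \<omega> \<theta> \<partial>M)" for \<theta>
      by (simp add: is_arg_min_linorder)
    show "AE \<omega> in M. \<forall>t\<ge>1. \<forall>\<theta>. l1_norm \<theta> \<le> 2 * U \<longrightarrow> infnorm (grad (loss t \<omega>) \<theta>) \<le> B"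
      by (rule grad_bounded)
  qed fact+
  interpret saew S a b \<alpha> U B \<delta> d0
    by unfold_locales (fact | rule \<alpha>_le)+
  interpret saew_losses M loss grad \<theta>s \<alpha> U B S a b \<delta> d0 \<theta>h
    by unfold_locales (fact | rule adapted | rule run, assumption)+
  have a': "a' = a + sqrt (2 * conf T)" and b': "b' = b + 1/2 + conf T"
    by (simp_all add: a'_def b'_def conf_def)
  have const: "2 * (16 * real d0 * B / \<alpha>) * B = 2 ^ 5 * real d0 * B\<^sup>2 / \<alpha>"
    by (simp add: power2_eq_square)
  have "0 \<le> \<alpha> * U\<^sup>2 / (8 * real d0)" using \<open>\<alpha> > 0\<close> by simp
  then have "min x (y + v) \<le> min x (y + v + \<alpha> * U\<^sup>2 / (8 * real d0))" for x y v :: real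
    by (intro min.mono order_refl) simp
  note order.trans[OF cumulative_excess_risk[OF \<open>T \<ge> 1\<close>, unfolded const] prob_excess_risk_mono[OF this]]
  then show ?thesis unfolding a' b' .
qed

end
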